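(* The critical points of the generalized Rayleigh-quotient are generically non-degenerate; that is, the set of all $A\in\mathfrak{her}_N$ such that every critical point of $\rho_A:\mathrm{Gr}^{\times r}(\mathbf m,\mathbf n)\to\mathbb{R}$ is non-degenerate (i.e. the Hessian of $\rho_A$ at that point is non-degenerate) is open and dense in $\mathfrak{her}_N$.
   Context: Let $r\ge 1$, $1\le m_j\le n_j$ be integers for $j=1,\dots,r$, $N:=n_1\cdots n_r$, $(\mathbf m,\mathbf n):=((m_1,n_1),\dots,(m_r,n_r))$. $\mathfrak{her}_n$ is the real vector space of Hermitian $n\times n$ complex matrices. $\mathrm{Gr}_{m,n}:=\{P\in\mathbb{C}^{n\times n}\mid P=P^\dagger=P^2,\ \operatorname{tr}P=m\}$, a smooth compact submanifold of $\mathfrak{her}_n$, and $\mathrm{Gr}^{\times r}(\mathbf m,\mathbf n):=\mathrm{Gr}_{m_1,n_1}\times\cdots\times\mathrm{Gr}_{m_r,n_r}$. The generalized Rayleigh-quotient of $A\in\mathfrak{her}_N$ is $\rho_A:\mathrm{Gr}^{\times r}(\mathbf m,\mathbf n)\to\mathbb{R}$, $\rho_A(P_1,\dots,P_r)=\operatorname{tr}(A(P_1\otimes\cdots\otimes P_r))$, with $\otimes$ the Kronecker product. *)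

theory Defs
  imports "HOL-Analysis.Analysis" "Jordan_Normal_Form.Schur_Decomposition"
begin

subsection \<open>Hermitian matrices and their topology\<close>

definition her :: "nat \<Rightarrow> complex mat set" where
  "her n = {A \<in> carrier_mat n n. mat_adjoint A = A}"

definition frobenius_dist :: "nat \<Rightarrow> complex mat \<Rightarrow> complex mat \<Rightarrow> real" where
  "frobenius_dist n A B = L2_set (\<lambda>ij. cmod (A $$ ij - B $$ ij)) ({..<n} \<times> {..<n})"

lemma Metric_space_her: "Metric_space (her n) (frobenius_dist n)"
proof
  fix A B :: "complex mat"
  show "0 \<le> frobenius_dist n A B"
    by (simp add: frobenius_dist_def)
  show "frobenius_dist n A B = frobenius_dist n B A"
    by (simp add: frobenius_dist_def norm_minus_commute)
next
  fix A B :: "complex mat"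
  assume "A \<in> her n" "B \<in> her n"
  then have d: "dim_row A = n" "dim_col A = n" "dim_row B = n" "dim_col B = n"
    by (auto simp: her_def)
  show "frobenius_dist n A B = 0 \<longleftrightarrow> A = B"
    using d by (auto simp: frobenius_dist_def L2_set_eq_0_iff intro!: eq_matI)
next
  fix A B C assume "A \<in> her n" "B \<in> her n" "C \<in> her n"
  then have d: "dim_row A = n" "dim_col A = n" "dim_row B = n" "dim_col B = n"
    by (auto simp: her_def)
  let ?I = "{..<n} \<times> {..<n}"
  have "frobenius_dist n A C \<le>
      L2_set (\<lambda>ij. cmod (A $$ ij - B $$ ij) + cmod (B $$ ij - C $$ ij)) ?I"
    unfolding frobenius_dist_def d
    by (rule L2_set_mono) (auto intro: norm_diff_triangle_le)
  also have "\<dots> \<le> frobenius_dist n A B + frobenius_dist n B C"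
    unfolding frobenius_dist_def d by (rule L2_set_triangle_ineq)
  finally show "frobenius_dist n A C \<le> frobenius_dist n A B + frobenius_dist n B C" .
qed

definition her_topology :: "nat \<Rightarrow> complex mat topology" where
  "her_topology n = Metric_space.mtopology (her n) (frobenius_dist n)"

subsection \<open>Products of Grassmannians and the generalized Rayleigh-quotient\<close>

definition mat_trace :: "complex mat \<Rightarrow> complex" where
  "mat_trace A = (\<Sum>i<dim_row A. A $$ (i, i))"

definition Gr :: "nat \<Rightarrow> nat \<Rightarrow> complex mat set" where
  "Gr m n = {P \<in> carrier_mat n n. mat_adjoint P = P \<and> P * P = P \<and> mat_trace P = of_nat m}"

definition Gr_prod :: "(nat \<times> nat) list \<Rightarrow> complex mat list set" where
  "Gr_prod mn = {Ps. list_all2 (\<lambda>P (m, n). P \<in> Gr m n) Ps mn}"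

definition kronecker :: "complex mat \<Rightarrow> complex mat \<Rightarrow> complex mat" where
  "kronecker A B = mat (dim_row A * dim_row B) (dim_col A * dim_col B)
     (\<lambda>(i, j). A $$ (i div dim_row B, j div dim_col B) * B $$ (i mod dim_row B, j mod dim_col B))"

definition kronecker_list :: "complex mat list \<Rightarrow> complex mat" where
  "kronecker_list Ps = foldr kronecker Ps (1\<^sub>m 1)"

text \<open>The trace below is real for Hermitian \<open>A\<close> and Hermitian factors, so taking the
  real part only changes the type.\<close>

definition rayleigh :: "complex mat \<Rightarrow> complex mat list \<Rightarrow> real" where
  "rayleigh A Ps = Re (mat_trace (A * kronecker_list Ps))"

subsection \<open>Critical points and the Hessian on a submanifold\<close>

text \<open>A submanifold \<open>M\<close> of a space of matrix tuples is given as a subset of that space. Since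
  \<open>M\<close> is embedded, a curve in \<open>M\<close> is smooth iff it is smooth as a curve in the ambient space,
  that is, entrywise.\<close>

definition same_shape :: "complex mat list \<Rightarrow> complex mat list \<Rightarrow> bool" where
  "same_shape = list_all2 (\<lambda>X Y. dim_row X = dim_row Y \<and> dim_col X = dim_col Y)"

definition has_velocity :: "(real \<Rightarrow> complex mat list) \<Rightarrow> complex mat list \<Rightarrow> real \<Rightarrow> bool" where
  "has_velocity \<gamma> \<xi> t \<longleftrightarrow>
     (\<forall>s. same_shape (\<gamma> s) \<xi>) \<and>
     (\<forall>k < length \<xi>. \<forall>i < dim_row (\<xi> ! k). \<forall>j < dim_col (\<xi> ! k).
        ((\<lambda>s. (\<gamma> s ! k) $$ (i, j)) has_vector_derivative (\<xi> ! k) $$ (i, j)) (at t))"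

definition smooth_curve :: "(real \<Rightarrow> complex mat list) \<Rightarrow> bool" where
  "smooth_curve \<gamma> \<longleftrightarrow>
     (\<exists>D :: nat \<Rightarrow> real \<Rightarrow> complex mat list.
        D 0 = \<gamma> \<and> (\<forall>k t. has_velocity (D k) (D (Suc k) t) t))"

definition curves_through ::
  "complex mat list set \<Rightarrow> complex mat list \<Rightarrow> complex mat list \<Rightarrow> (real \<Rightarrow> complex mat list) set" where
  "curves_through M P \<xi> =
     {\<gamma>. smooth_curve \<gamma> \<and> range \<gamma> \<subseteq> M \<and> \<gamma> 0 = P \<and> has_velocity \<gamma> \<xi> 0}"

definition tangent_space ::
  "complex mat list set \<Rightarrow> complex mat list \<Rightarrow> complex mat list set" where
  "tangent_space M P = {\<xi>. curves_through M P \<xi> \<noteq> {}}"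

definition critical_point ::
  "complex mat list set \<Rightarrow> (complex mat list \<Rightarrow> real) \<Rightarrow> complex mat list \<Rightarrow> bool" where
  "critical_point M f P \<longleftrightarrow> P \<in> M \<and>
     (\<forall>\<xi>. \<forall>\<gamma> \<in> curves_through M P \<xi>. ((\<lambda>t. f (\<gamma> t)) has_real_derivative 0) (at 0))"

text \<open>At a critical point the second derivative of \<open>f\<close> along a curve in \<open>M\<close> depends only on
  the velocity \<open>\<xi>\<close> of the curve. This is the quadratic form of the Hessian; the Hessian itself
  is the symmetric bilinear form on the tangent space obtained from it by polarization. Both are
  only meaningful at critical points.\<close>

definition hessian_quad ::
  "complex mat list set \<Rightarrow> (complex mat list \<Rightarrow> real) \<Rightarrow> complex mat list \<Rightarrow> complex mat list \<Rightarrow> real" where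
  "hessian_quad M f P \<xi> =
     (THE c. \<forall>\<gamma> \<in> curves_through M P \<xi>. deriv (deriv (\<lambda>t. f (\<gamma> t))) 0 = c)"

definition hessian ::
  "complex mat list set \<Rightarrow> (complex mat list \<Rightarrow> real) \<Rightarrow> complex mat list \<Rightarrow>
   complex mat list \<Rightarrow> complex mat list \<Rightarrow> real" where
  "hessian M f P \<xi> \<eta> =
     (hessian_quad M f P (map2 (+) \<xi> \<eta>) - hessian_quad M f P \<xi> - hessian_quad M f P \<eta>) / 2"

definition nondegenerate_critical_point ::
  "complex mat list set \<Rightarrow> (complex mat list \<Rightarrow> real) \<Rightarrow> complex mat list \<Rightarrow> bool" where
  "nondegenerate_critical_point M f P \<longleftrightarrow> critical_point M f P \<and>
     (\<forall>\<xi> \<in> tangent_space M P.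
        (\<forall>\<eta> \<in> tangent_space M P. hessian M f P \<xi> \<eta> = 0) \<longrightarrow>
        (\<forall>X \<in> set \<xi>. X = 0\<^sub>m (dim_row X) (dim_col X)))"

end

(*
  Perturbing A by the sum of the matrices 1 x ... x H_j x ... x 1 changes the Rayleigh quotient on
  the product of Grassmannians by the linear function P |-> sum_j tr (H_j P_j), up to the choice of
  positive scalars. For a critical point P of the perturbed function, H + gradient commutes with P
  componentwise, and the Hermitian tuple X = H + gradient + c P with large c determines P and H in a
  Lipschitz way, since P is a spectral projection of X. So the critical pairs (P, H) are
  parametrized by a set X of the same dimension as that of H. If v is a null vector of the Hessian
  at P, then H moves only to second order in the direction v when X moves to first order. Counting
  grid points, as in the proof of Sard's theorem, shows that not every small H admits a degenerate
  critical point; this is density. Openness is compactness of the Grassmannian.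
*)
theory Submission
  imports Defs
begin

subsection \<open>The algebra of finitely supported matrices\<close>

text \<open>The classical route applies Sard's theorem to the projection from the manifold of
  critical pairs to the perturbations. Two devices replace its charts and measures. Criticality says
  that \<open>u = H + grad\<close> is normal to the Grassmannians, so a critical pair is a point of
  the normal bundle, and adding a multiple of the projections encodes it inside the vector space in
  which H lives. Singularity of the projection is used only as an inequality: the change of H,
  paired with the null vector, reduces to pairings that vanish at either critical point, and the
  Hessian identity cancels what is left to first order. The Grassmannians are curved, so the Hessian
  contains the first derivative along the normal acceleration of a curve. The linear perturbations
  interact with this term alone: tangent vectors and normal accelerations have trace zero, hence the
  mixed second derivatives of the perturbation vanish and H enters the Hessian only through u. The
  positive scalars are products of the ranks of the other factors, nonzero because every rank is at
  least one.\<close>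

text \<open>Matrices of all sizes are embedded into one non-unital normed algebra, so that type class
  reasoning about rings, norms and limits replaces carrier conditions.\<close>

typedef fmat = "{f :: nat \<Rightarrow> nat \<Rightarrow> complex. \<exists>N. \<forall>i j. N \<le> i \<or> N \<le> j \<longrightarrow> f i j = 0}"
  morphisms ent Fmat
  by (rule exI[of _ "\<lambda>_ _. 0"]) simp

setup_lifting type_definition_fmat

lemma fmat_eqI: "(\<And>i j. ent x i j = ent y i j) \<Longrightarrow> x = y"
  by (simp add: ent_inject[symmetric] ext)

text \<open>The size of a matrix becomes a monotone bound instead of a carrier set: finitely many
  elements always lie in a common corner, so that all their sums can run over one finite
  range.\<close>

definition corner :: "nat \<Rightarrow> fmat \<Rightarrow> bool" where
  "corner n x \<longleftrightarrow> (\<forall>i j. n \<le> i \<or> n \<le> j \<longrightarrow> ent x i j = 0)"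

lemma cornerD: "corner n x \<Longrightarrow> n \<le> i \<or> n \<le> j \<Longrightarrow> ent x i j = 0"
  unfolding corner_def by blast

lemma cornerD1: "corner n x \<Longrightarrow> ent x i j \<noteq> 0 \<Longrightarrow> i < n"
  and cornerD2: "corner n x \<Longrightarrow> ent x i j \<noteq> 0 \<Longrightarrow> j < n"
  by (auto simp: corner_def not_le[symmetric])

lemma corner_mono: "corner n x \<Longrightarrow> n \<le> m \<Longrightarrow> corner m x"
  by (auto simp: corner_def)

lemma corner_ex: "\<exists>n. corner n x"
  using ent[of x] by (auto simp: corner_def)

lemma corner_ex3:
  obtains n where "corner n x" "corner n y" "corner n z"
proof -
  obtain a b c where "corner a x" "corner b y" "corner c z"
    using corner_ex by meson
  then show ?thesis
    using that[of "max a (max b c)"] by (meson corner_mono max.cobounded1 max.cobounded2 order_trans)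
qed

instantiation fmat :: "{zero, plus, minus, uminus, times, scaleR}"
begin

lift_definition zero_fmat :: fmat is "\<lambda>_ _. 0"
  by simp

lift_definition plus_fmat :: "fmat \<Rightarrow> fmat \<Rightarrow> fmat" is "\<lambda>f g i j. f i j + g i j"
  by (metis add_0 max.bounded_iff)

lift_definition minus_fmat :: "fmat \<Rightarrow> fmat \<Rightarrow> fmat" is "\<lambda>f g i j. f i j - g i j"
  by (metis diff_zero max.bounded_iff)

lift_definition uminus_fmat :: "fmat \<Rightarrow> fmat" is "\<lambda>f i j. - f i j"
  by simp

lift_definition scaleR_fmat :: "real \<Rightarrow> fmat \<Rightarrow> fmat" is "\<lambda>c f i j. c *\<^sub>R f i j"
  by (metis scaleR_zero_right)

text \<open>Summing over the support of row \<open>i\<close>, which is finite, avoids choosing a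
  size; \<open>ent_times\<close> returns to the usual sum once a corner is known.\<close>

lift_definition times_fmat :: "fmat \<Rightarrow> fmat \<Rightarrow> fmat"
  is "\<lambda>f g i j. \<Sum>k | f i k \<noteq> 0. f i k * g k j"
proof -
  fix f g :: "nat \<Rightarrow> nat \<Rightarrow> complex"
  assume "\<exists>N. \<forall>i j. N \<le> i \<or> N \<le> j \<longrightarrow> f i j = 0" "\<exists>N. \<forall>i j. N \<le> i \<or> N \<le> j \<longrightarrow> g i j = 0"
  then obtain M N where "\<forall>i j. M \<le> i \<or> M \<le> j \<longrightarrow> f i j = 0" "\<forall>i j. N \<le> i \<or> N \<le> j \<longrightarrow> g i j = 0"
    by blast
  then have "\<forall>i j. max M N \<le> i \<or> max M N \<le> j \<longrightarrow> (\<Sum>k | f i k \<noteq> 0. f i k * g k j) = 0"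
    by (auto intro!: sum.neutral)
  then show "\<exists>N. \<forall>i j. N \<le> i \<or> N \<le> j \<longrightarrow> (\<Sum>k | f i k \<noteq> 0. f i k * g k j) = 0"
    by blast
qed

instance ..

end

text \<open>The entrywise sum of moduli is submultiplicative and invariant under adjoints, and it
  dominates every entry and the trace with constant one.\<close>

lift_definition l1_norm :: "fmat \<Rightarrow> real"
  is "\<lambda>f. \<Sum>(i, j) | f i j \<noteq> 0. cmod (f i j)" .

lemmas ent_simps [simp] = zero_fmat.rep_eq plus_fmat.rep_eq minus_fmat.rep_eq
  uminus_fmat.rep_eq scaleR_fmat.rep_eq

lemma ent_times:
  assumes "corner n x"
  shows "ent (x * y) i j = (\<Sum>k<n. ent x i k * ent y k j)"
  unfolding times_fmat.rep_eq
  by (rule sum.mono_neutral_left) (auto dest: cornerD2[OF assms])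

lemma l1_norm_corner:
  assumes "corner n x"
  shows "l1_norm x = (\<Sum>i<n. \<Sum>j<n. cmod (ent x i j))"
proof -
  have "l1_norm x = (\<Sum>(i, j)\<in>{..<n} \<times> {..<n}. cmod (ent x i j))"
    unfolding l1_norm.rep_eq
    by (rule sum.mono_neutral_left) (auto dest: cornerD1[OF assms] cornerD2[OF assms])
  then show ?thesis
    by (simp add: sum.cartesian_product)
qed

lemma corner_zero [simp, intro]: "corner n 0"
  and corner_plus [intro]: "corner n x \<Longrightarrow> corner n y \<Longrightarrow> corner n (x + y)"
  and corner_minus [intro]: "corner n x \<Longrightarrow> corner n y \<Longrightarrow> corner n (x - y)"
  and corner_uminus [intro]: "corner n x \<Longrightarrow> corner n (- x)"
  and corner_scaleR [intro]: "corner n x \<Longrightarrow> corner n (c *\<^sub>R x)"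
  by (auto simp: corner_def)

lemma corner_times [intro]:
  assumes "corner n x" "corner n y"
  shows "corner n (x * y)"
  using assms(2) by (auto simp: corner_def ent_times[OF assms(1)] cornerD[OF assms(1)])

lemma l1_norm_mult_le: "l1_norm (x * y) \<le> l1_norm x * l1_norm (y :: fmat)"
proof -
  obtain n where n: "corner n x" "corner n y"
    using corner_ex3[of x y x] by blast
  let ?r = "\<lambda>k. \<Sum>j<n. cmod (ent y k j)"
  have "l1_norm (x * y) = (\<Sum>i<n. \<Sum>j<n. cmod (\<Sum>k<n. ent x i k * ent y k j))"
    by (simp add: l1_norm_corner[OF corner_times[OF n]] ent_times[OF n(1)])
  also have "\<dots> \<le> (\<Sum>i<n. \<Sum>j<n. \<Sum>k<n. cmod (ent x i k) * cmod (ent y k j))"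
    by (intro sum_mono order_trans[OF norm_sum]) (simp add: norm_mult)
  also have "\<dots> = (\<Sum>i<n. \<Sum>k<n. cmod (ent x i k) * ?r k)"
    by (subst sum.swap) (simp add: sum_distrib_left)
  also have "\<dots> \<le> (\<Sum>i<n. \<Sum>k<n. cmod (ent x i k) * l1_norm y)"
    unfolding l1_norm_corner[OF n(2)]
    by (intro sum_mono mult_left_mono member_le_sum) (auto intro: sum_nonneg)
  also have "\<dots> = l1_norm x * l1_norm y"
    by (simp add: l1_norm_corner[OF n(1)] sum_distrib_right)
  finally show ?thesis .
qed

instantiation fmat :: real_normed_algebra
begin

definition norm_fmat :: "fmat \<Rightarrow> real" where
  "norm_fmat = l1_norm"

definition sgn_fmat :: "fmat \<Rightarrow> fmat" where
  "sgn_fmat x = x /\<^sub>R norm x"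

definition dist_fmat :: "fmat \<Rightarrow> fmat \<Rightarrow> real" where
  "dist_fmat x y = norm (x - y)"

definition uniformity_fmat :: "(fmat \<times> fmat) filter" where
  "uniformity_fmat = (INF e\<in>{0<..}. principal {(x, y). dist x y < e})"

definition open_fmat :: "fmat set \<Rightarrow> bool" where
  "open_fmat U \<longleftrightarrow> (\<forall>x\<in>U. eventually (\<lambda>(x', y). x' = x \<longrightarrow> y \<in> U) uniformity)"

instance
proof
  fix x y z :: fmat and a b :: real and U :: "fmat set"
  obtain n where n: "corner n x" "corner n y" "corner n z"
    using corner_ex3 by blast
  show "x + y + z = x + (y + z)" "x + y = y + x" "0 + x = x" "- x + x = 0" "x - y = x + - y"
    by (auto intro!: fmat_eqI)
  show "a *\<^sub>R (x + y) = a *\<^sub>R x + a *\<^sub>R y" "(a + b) *\<^sub>R x = a *\<^sub>R x + b *\<^sub>R x"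
    "a *\<^sub>R b *\<^sub>R x = (a * b) *\<^sub>R x" "1 *\<^sub>R x = x"
    by (auto intro!: fmat_eqI simp: algebra_simps)
  show "x * y * z = x * (y * z)"
  proof (rule fmat_eqI)
    fix i j
    have "ent (x * y * z) i j = (\<Sum>k<n. \<Sum>l<n. ent x i l * ent y l k * ent z k j)"
      by (simp add: ent_times[OF n(1)] ent_times[OF corner_times[OF n(1,2)]] sum_distrib_right)
    also have "\<dots> = (\<Sum>l<n. \<Sum>k<n. ent x i l * ent y l k * ent z k j)"
      by (rule sum.swap)
    also have "\<dots> = ent (x * (y * z)) i j"
      by (simp add: ent_times[OF n(1)] ent_times[OF n(2)] sum_distrib_left mult.assoc)
    finally show "ent (x * y * z) i j = ent (x * (y * z)) i j" .
  qed
  show "(x + y) * z = x * z + y * z"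
    by (rule fmat_eqI)
      (simp add: ent_times[OF n(1)] ent_times[OF n(2)] ent_times[OF corner_plus[OF n(1,2)]]
        distrib_right sum.distrib)
  show "x * (y + z) = x * y + x * z"
    by (rule fmat_eqI) (simp add: ent_times[OF n(1)] distrib_left sum.distrib)
  show "a *\<^sub>R x * y = a *\<^sub>R (x * y)"
    by (rule fmat_eqI)
      (simp add: ent_times[OF n(1)] ent_times[OF corner_scaleR[OF n(1)]] scaleR_sum_right)
  show "x * a *\<^sub>R y = a *\<^sub>R (x * y)"
    by (rule fmat_eqI) (simp add: ent_times[OF n(1)] scaleR_sum_right)
  show "dist x y = norm (x - y)" "sgn x = x /\<^sub>R norm x"
    by (simp_all add: dist_fmat_def sgn_fmat_def)
  show "uniformity = (INF e\<in>{0<..}. principal {(x :: fmat, y). dist x y < e})"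
    "open U \<longleftrightarrow> (\<forall>x\<in>U. eventually (\<lambda>(x', y). x' = x \<longrightarrow> y \<in> U) uniformity)"
    by (simp_all add: uniformity_fmat_def open_fmat_def)
  show "norm x = 0 \<longleftrightarrow> x = 0"
  proof
    assume "norm x = 0"
    then have "\<forall>i<n. \<forall>j<n. ent x i j = 0"
      by (simp add: norm_fmat_def l1_norm_corner[OF n(1)] sum_nonneg_eq_0_iff sum_nonneg)
    then have "ent x i j = 0" for i j
      using cornerD[OF n(1), of i j] by (cases "i < n \<and> j < n") auto
    then show "x = 0"
      by (auto intro!: fmat_eqI)
  qed (simp add: norm_fmat_def l1_norm_corner[OF corner_zero[of 0]])
  show "norm (x + y) \<le> norm x + norm y"
    unfolding norm_fmat_def l1_norm_corner[OF n(1)] l1_norm_corner[OF n(2)]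
      l1_norm_corner[OF corner_plus[OF n(1,2)]] sum.distrib[symmetric] plus_fmat.rep_eq
    by (intro sum_mono norm_triangle_ineq)
  show "norm (a *\<^sub>R x) = \<bar>a\<bar> * norm x"
    unfolding norm_fmat_def l1_norm_corner[OF n(1)] l1_norm_corner[OF corner_scaleR[OF n(1)]]
    by (simp add: sum_distrib_left)
  show "norm (x * y) \<le> norm x * norm y"
    unfolding norm_fmat_def by (rule l1_norm_mult_le)
qed

end

lemma norm_fmat_corner: "corner n x \<Longrightarrow> norm x = (\<Sum>i<n. \<Sum>j<n. cmod (ent x i j))"
  by (simp add: norm_fmat_def l1_norm_corner)

lemma ent_sum [simp]: "ent (sum f A) i j = (\<Sum>a\<in>A. ent (f a) i j)"
  by (induction A rule: infinite_finite_induct) auto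

lemma corner_sum [intro]: "(\<And>a. a \<in> A \<Longrightarrow> corner n (f a)) \<Longrightarrow> corner n (sum f A)"
  by (auto simp: corner_def)

lemma norm_ent_le: "cmod (ent x i j) \<le> norm x"
proof -
  obtain n where n: "corner n x"
    using corner_ex by blast
  show ?thesis
  proof (cases "i < n \<and> j < n")
    case True
    then have "cmod (ent x i j) \<le> (\<Sum>j<n. cmod (ent x i j))"
      by (intro member_le_sum) auto
    also have "\<dots> \<le> norm x"
      unfolding norm_fmat_corner[OF n]
      by (rule member_le_sum) (use True in \<open>auto intro: sum_nonneg\<close>)
    finally show ?thesis .
  qed (use cornerD[OF n, of i j] in auto)
qed

lemma norm_le_ent:
  assumes "corner n x" "\<And>i j. i < n \<Longrightarrow> j < n \<Longrightarrow> cmod (ent x i j) \<le> b"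
  shows "norm x \<le> real n * (real n * b)"
proof -
  have "norm x \<le> (\<Sum>i<n. \<Sum>j<n. b)"
    unfolding norm_fmat_corner[OF assms(1)] by (intro sum_mono assms(2)) auto
  then show ?thesis
    by simp
qed

lemma bounded_linear_ent: "bounded_linear (\<lambda>x. ent x i j)"
  by (rule bounded_linear_intro[where K = 1]) (auto simp: norm_ent_le)

section \<open>Adjoint and trace\<close>

lift_definition adj :: "fmat \<Rightarrow> fmat" is "\<lambda>f i j. cnj (f j i)"
  by (metis complex_cnj_zero)

lemmas ent_adj [simp] = adj.rep_eq

lemma corner_adj [intro]: "corner n x \<Longrightarrow> corner n (adj x)"
  by (auto simp: corner_def)

lemma adj_simps [simp]:
  "adj 0 = 0" "adj (x + y) = adj x + adj y" "adj (x - y) = adj x - adj y" "adj (- x) = - adj x"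
  "adj (c *\<^sub>R x) = c *\<^sub>R adj x" "adj (adj x) = x"
  by (auto intro!: fmat_eqI)

lemma adj_mult [simp]: "adj (x * y) = adj y * adj x"
proof -
  obtain n where n: "corner n x" "corner n y"
    using corner_ex3[of x y x] by blast
  then show ?thesis
    by (auto intro!: fmat_eqI simp: ent_times[of n] corner_adj mult.commute)
qed

lemma norm_adj: "norm (adj x) = norm x"
proof -
  obtain n where n: "corner n x"
    using corner_ex by blast
  show ?thesis
    by (simp add: norm_fmat_corner[OF corner_adj[OF n]] norm_fmat_corner[OF n]) (rule sum.swap)
qed

lemma bounded_linear_adj: "bounded_linear adj"
  by (rule bounded_linear_intro[where K = 1]) (auto simp: norm_adj)

lift_definition tr :: "fmat \<Rightarrow> complex" is "\<lambda>f. \<Sum>i | f i i \<noteq> 0. f i i" .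

lemma tr_corner: "corner n x \<Longrightarrow> tr x = (\<Sum>i<n. ent x i i)"
  unfolding tr.rep_eq by (rule sum.mono_neutral_left) (auto dest: cornerD1)

lemma tr_simps [simp]:
  "tr 0 = 0" "tr (x + y) = tr x + tr y" "tr (x - y) = tr x - tr y" "tr (- x) = - tr x"
  "tr (c *\<^sub>R x) = c *\<^sub>R tr x"
proof -
  obtain n where n: "corner n x" "corner n y"
    using corner_ex3[of x y x] by blast
  then show "tr 0 = 0" "tr (x + y) = tr x + tr y" "tr (x - y) = tr x - tr y" "tr (- x) = - tr x"
    "tr (c *\<^sub>R x) = c *\<^sub>R tr x"
    by (simp_all add: tr_corner[of n] corner_plus corner_minus corner_uminus corner_scaleR
        sum.distrib sum_subtractf sum_negf scaleR_sum_right)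
qed

lemma tr_mult_corner:
  "corner n x \<Longrightarrow> corner n y \<Longrightarrow> tr (x * y) = (\<Sum>i<n. \<Sum>j<n. ent x i j * ent y j i)"
  by (simp add: tr_corner[OF corner_times] ent_times[of n])

lemma tr_mult_commute: "tr (x * y) = tr (y * x)"
proof -
  obtain n where n: "corner n x" "corner n y"
    using corner_ex3[of x y x] by blast
  show ?thesis
    unfolding tr_mult_corner[OF n] tr_mult_corner[OF n(2,1)]
    by (subst sum.swap) (simp add: mult.commute)
qed

lemma tr_adj: "tr (adj x) = cnj (tr x)"
proof -
  obtain n where n: "corner n x"
    using corner_ex by blast
  show ?thesis
    by (simp add: tr_corner[OF n] tr_corner[OF corner_adj[OF n]])
qed

lemma norm_tr_le: "cmod (tr x) \<le> norm x"
proof -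
  obtain n where n: "corner n x"
    using corner_ex by blast
  have "cmod (tr x) \<le> (\<Sum>i<n. cmod (ent x i i))"
    unfolding tr_corner[OF n] by (rule norm_sum)
  also have "\<dots> \<le> norm x"
    unfolding norm_fmat_corner[OF n] by (intro sum_mono member_le_sum) auto
  finally show ?thesis .
qed

lemma bounded_linear_tr: "bounded_linear tr"
  by (rule bounded_linear_intro[where K = 1]) (auto simp: norm_tr_le)

section \<open>Matrix units and entrywise limits\<close>

lift_definition munit :: "nat \<Rightarrow> nat \<Rightarrow> complex \<Rightarrow> fmat"
  is "\<lambda>i j z a b. if a = i \<and> b = j then z else 0"
proof -
  fix i j :: nat and z :: complex
  show "\<exists>N. \<forall>a b. N \<le> a \<or> N \<le> b \<longrightarrow> (if a = i \<and> b = j then z else 0) = 0"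
    by (rule exI[of _ "Suc (i + j)"]) auto
qed

lemma corner_munit [intro]: "i < n \<Longrightarrow> j < n \<Longrightarrow> corner n (munit i j z)"
  by (auto simp: corner_def munit.rep_eq)

lemma sum_two_delta:
  fixes z :: "nat \<Rightarrow> nat \<Rightarrow> 'a::comm_monoid_add"
  assumes "a < n" "b < n"
  shows "(\<Sum>i<n. \<Sum>j<n. if a = i \<and> b = j then z i j else 0) = z a b"
proof -
  have "(\<Sum>i<n. \<Sum>j<n. if a = i \<and> b = j then z i j else 0) =
      (\<Sum>i<n. if a = i then (\<Sum>j<n. if b = j then z i j else 0) else 0)"
    by (intro sum.cong) auto
  then show ?thesis
    using assms by simp
qed

lemma norm_munit: "norm (munit i j z) = cmod z"
proof -
  obtain n where n: "i < n" "j < n"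
    by (meson less_add_Suc1 less_add_Suc2)
  have "norm (munit i j z) = (\<Sum>a<n. \<Sum>b<n. if i = a \<and> j = b then cmod z else 0)"
    using n by (subst norm_fmat_corner[of n]) (auto intro!: corner_munit sum.cong simp: munit.rep_eq)
  then show ?thesis
    using n by (simp add: sum_two_delta)
qed

lemma bounded_linear_munit: "bounded_linear (munit i j)"
  by (rule bounded_linear_intro[where K = 1])
    (auto simp: norm_munit munit.rep_eq intro!: fmat_eqI)

lemma fmat_expand: 
  assumes "corner n x"
  shows "x = (\<Sum>i<n. \<Sum>j<n. munit i j (ent x i j))"
proof (rule fmat_eqI)
  fix a b
  show "ent x a b = ent (\<Sum>i<n. \<Sum>j<n. munit i j (ent x i j)) a b"
  proof (cases "a < n \<and> b < n")
    case True
    then show ?thesis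
      by (simp add: munit.rep_eq sum_two_delta)
  next
    case False
    then show ?thesis
      using cornerD[OF assms, of a b] by (auto simp: munit.rep_eq not_less intro!: sum.neutral)
  qed
qed

lemma tr_munit_mult: "tr (munit i j z * x) = z * ent x j i"
proof -
  obtain n where "corner n x"
    using corner_ex by blast
  then have m: "corner (Suc (n + i + j)) x" "i < Suc (n + i + j)" "j < Suc (n + i + j)"
    using corner_mono[of n x "Suc (n + i + j)"] by auto
  define m where "m = Suc (n + i + j)"
  note m = m[folded m_def]
  have "tr (munit i j z * x) = (\<Sum>a<m. \<Sum>b<m. if i = a \<and> j = b then z * ent x b a else 0)"
    unfolding tr_mult_corner[OF corner_munit[OF m(2,3)] m(1)]
    by (auto intro!: sum.cong simp: munit.rep_eq)
  then show ?thesis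
    using m by (simp add: sum_two_delta)
qed

text \<open>The common corner matters: only then is the family a finite combination of matrix units,
  whose coefficients may be passed to the limit one by one.\<close>

lemma tendsto_fmat:
  assumes "\<And>k. corner n (f k)" "corner n l"
    and "\<And>i j. i < n \<Longrightarrow> j < n \<Longrightarrow> ((\<lambda>k. ent (f k) i j) \<longlongrightarrow> ent l i j) F"
  shows "(f \<longlongrightarrow> l) F"
proof -
  have "((\<lambda>k. \<Sum>i<n. \<Sum>j<n. munit i j (ent (f k) i j)) \<longlongrightarrow>
      (\<Sum>i<n. \<Sum>j<n. munit i j (ent l i j))) F"
    by (intro tendsto_sum bounded_linear.tendsto[OF bounded_linear_munit] assms(3)) auto
  then show ?thesis
    by (simp add: fmat_expand[OF assms(1), symmetric] fmat_expand[OF assms(2), symmetric])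
qed

lemma has_vector_derivative_fmat:
  assumes "\<And>s. corner n (f s)" "corner n d"
    and "\<And>i j. i < n \<Longrightarrow> j < n \<Longrightarrow> ((\<lambda>s. ent (f s) i j) has_vector_derivative ent d i j) F"
  shows "(f has_vector_derivative d) F"
proof -
  have "((\<lambda>s. \<Sum>i<n. \<Sum>j<n. munit i j (ent (f s) i j)) has_vector_derivative
      (\<Sum>i<n. \<Sum>j<n. munit i j (ent d i j))) F"
    by (intro has_vector_derivative_sum
        bounded_linear.has_vector_derivative[OF bounded_linear_munit] assms(3)) auto
  then show ?thesis
    by (simp add: fmat_expand[OF assms(1), symmetric] fmat_expand[OF assms(2), symmetric])
qed

subsection \<open>Projections and their tangent spaces\<close>

text \<open>On Hermitian arguments this is the trace inner product. Leaving out the adjoint keeps it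
  bilinear and makes the cyclicity of the trace directly applicable.\<close>

definition ip :: "fmat \<Rightarrow> fmat \<Rightarrow> real" where
  "ip x y = Re (tr (x * y))"

lemma ip_simps:
  "ip (x + y) z = ip x z + ip y z" "ip z (x + y) = ip z x + ip z y"
  "ip (x - y) z = ip x z - ip y z" "ip z (x - y) = ip z x - ip z y"
  "ip (c *\<^sub>R x) z = c * ip x z" "ip z (c *\<^sub>R x) = c * ip z x"
  by (simp_all add: ip_def algebra_simps)

lemma ip_commute: "ip x y = ip y x"
  by (simp add: ip_def tr_mult_commute[of x])

lemma ip_le: "\<bar>ip x y\<bar> \<le> norm x * norm y"
  unfolding ip_def by (meson abs_Re_le_cmod norm_mult_ineq norm_tr_le order_trans)

lemma ip_self:
  assumes "corner n x" "adj x = x"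
  shows "ip x x = (\<Sum>i<n. \<Sum>j<n. (cmod (ent x i j))\<^sup>2)"
proof -
  have "ent x i j * ent x j i = of_real ((cmod (ent x i j))\<^sup>2)" for i j
    using arg_cong[OF assms(2), of "\<lambda>x. ent x j i"]
    by (simp add: complex_norm_square del: of_real_power)
  then show ?thesis
    by (simp add: ip_def tr_mult_corner[OF assms(1) assms(1)])
qed

text \<open>Cauchy-Schwarz over the \<open>n\<^sup>2\<close> entries: the price of comparing the
  entrywise sum norm with the Hilbert-Schmidt norm.\<close>

lemma norm_square_le_ip:
  assumes "corner n x" "adj x = x"
  shows "(norm x)\<^sup>2 \<le> (real n)\<^sup>2 * ip x x"
proof -
  let ?I = "{..<n} \<times> {..<n}"
  have "(norm x)\<^sup>2 = (\<Sum>ij\<in>?I. 1 * cmod (ent x (fst ij) (snd ij)))\<^sup>2"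
    by (simp add: norm_fmat_corner[OF assms(1)] sum.cartesian_product case_prod_beta)
  also have "\<dots> \<le> (\<Sum>ij\<in>?I. 1\<^sup>2) * (\<Sum>ij\<in>?I. (cmod (ent x (fst ij) (snd ij)))\<^sup>2)"
    by (rule Cauchy_Schwarz_ineq_sum)
  also have "\<dots> = (real n)\<^sup>2 * ip x x"
    by (simp add: ip_self[OF assms] sum.cartesian_product case_prod_beta power2_eq_square)
  finally show ?thesis .
qed

lemma ip_self_eq_0:
  assumes "adj x = x" "ip x x = 0"
  shows "x = 0"
proof -
  obtain n where "corner n x"
    using corner_ex by blast
  from norm_square_le_ip[OF this assms(1)] show ?thesis
    by (simp add: assms(2))
qed

definition gr :: "nat \<Rightarrow> nat \<Rightarrow> fmat set" where
  "gr m n = {p. corner n p \<and> adj p = p \<and> p * p = p \<and> tr p = of_nat m}"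

text \<open>The linearization of \<open>p * p = p\<close> among Hermitian matrices. That the trace
  is constant to first order is a consequence, \<open>tr_tang\<close>.\<close>

definition tang :: "nat \<Rightarrow> fmat \<Rightarrow> fmat set" where
  "tang n p = {x. corner n x \<and> adj x = x \<and> p * x + x * p = x}"

text \<open>For idempotent \<open>p\<close> this is the double commutator of \<open>p\<close> with
  \<open>x\<close>. It deletes the two diagonal blocks of \<open>x\<close> with respect to
  \<open>p\<close>, hence is the orthogonal projection onto the tangent space.\<close>

definition tproj :: "fmat \<Rightarrow> fmat \<Rightarrow> fmat" where
  "tproj p x = p * x + x * p - 2 *\<^sub>R (p * x * p)"

text \<open>The normal component of the acceleration of a curve in the Grassmannian, polarized.\<close>

definition curv :: "fmat \<Rightarrow> fmat \<Rightarrow> fmat \<Rightarrow> fmat" where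
  "curv p x y = x * y + y * x - 2 *\<^sub>R (p * (x * y + y * x))"

lemma grD:
  assumes "p \<in> gr m n"
  shows "corner n p" "adj p = p" "p * p = p" "tr p = of_nat m"
  using assms by (auto simp: gr_def)

lemma tangD:
  assumes "x \<in> tang n p"
  shows "corner n x" "adj x = x" "x * p = x - p * x"
  using assms by (auto simp: tang_def algebra_simps)

lemmas ring_expand = distrib_left distrib_right left_diff_distrib right_diff_distrib mult.assoc scaleR_2

lemma idem_assoc: "p * p = p \<Longrightarrow> p * (p * z) = p * (z :: fmat)"
  by (simp flip: mult.assoc)

text \<open>Moves \<open>p\<close> to the left past a tangent vector. With \<open>idem_assoc\<close>
  and \<open>ring_expand\<close> it normalizes words in \<open>p\<close> and tangent vectors, which
  proves the noncommutative identities below by rewriting.\<close>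

lemma anti_assoc: "x * p = x - p * x \<Longrightarrow> x * (p * z) = x * z - p * (x * (z :: fmat))"
  by (metis left_diff_distrib mult.assoc)

text \<open>The squared Hilbert-Schmidt norm of a projection is its rank \<open>m\<close>; enlarging
  \<open>m\<close> to \<open>m\<^sup>2\<close> avoids a square root in the bound.\<close>

lemma norm_gr_le:
  assumes "p \<in> gr m n"
  shows "norm p \<le> real n * real m"
proof -
  have "(norm p)\<^sup>2 \<le> (real n)\<^sup>2 * real m"
    using norm_square_le_ip[of n p] grD[OF assms] by (simp add: ip_def)
  also have "\<dots> \<le> (real n)\<^sup>2 * (real m)\<^sup>2"
    by (intro mult_left_mono) (cases m; simp add: power2_eq_square)+
  finally have "(norm p)\<^sup>2 \<le> (real n * real m)\<^sup>2"
    by (simp add: power_mult_distrib)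
  then show ?thesis
    by (rule power2_le_imp_le) simp
qed

lemma tang_sandwich:
  assumes "p * p = p" "x \<in> tang n p"
  shows "p * (x * p) = 0"
  by (simp add: tangD(3)[OF assms(2)] idem_assoc[OF assms(1)] assms(1) ring_expand)

lemma tr_tang:
  assumes "p * p = p" "x \<in> tang n p"
  shows "tr x = 0"
proof -
  have "tr (p * x) = tr (p * (x * p))"
    using assms(1) tr_mult_commute[of p "p * x"]
    by (simp add: idem_assoc mult.assoc)
  then have "tr (p * x) = 0"
    by (simp add: tang_sandwich[OF assms])
  then have "tr (p * x + x * p) = 0"
    by (simp add: tr_mult_commute[of x])
  moreover have "p * x + x * p = x"
    using assms(2) by (simp add: tang_def)
  ultimately show ?thesis
    by metis
qed

lemma tang_plus: "x \<in> tang n p \<Longrightarrow> y \<in> tang n p \<Longrightarrow> x + y \<in> tang n p"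
  and tang_scaleR: "x \<in> tang n p \<Longrightarrow> c *\<^sub>R x \<in> tang n p"
  and tang_zero: "0 \<in> tang n p"
   apply (auto simp: tang_def algebra_simps)
  by (metis scaleR_add_right)

lemma tproj_tang:
  assumes "p \<in> gr m n" "corner n x" "adj x = x"
  shows "tproj p x \<in> tang n p"
  using assms grD[OF assms(1)] idem_assoc[of p]
  by (auto simp: tang_def tproj_def algebra_simps scaleR_2)

lemma tproj_id:
  assumes "p * p = p" "x \<in> tang n p"
  shows "tproj p x = x"
  using assms tang_sandwich[OF assms] by (simp add: tproj_def tang_def mult.assoc)

lemma ip_tproj: "ip v (tproj p x) = ip (tproj p v) x"
proof -
  have "tr (v * (p * x)) = tr (v * p * x)" "tr (v * (x * p)) = tr (p * v * x)"
    "tr (v * (p * x * p)) = tr (p * v * p * x)"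
    by (simp_all add: mult.assoc tr_mult_commute[of p])
  then show ?thesis
    by (simp add: ip_def tproj_def ring_distribs)
qed

lemma curv_commute: "curv p x y = curv p y x"
  by (simp add: curv_def add.commute)

lemma curv_add: "curv p x (y + z) = curv p x y + curv p x z"
  by (simp add: curv_def algebra_simps scaleR_2)

lemma curv_diff: "curv p x (y - z) = curv p x y - curv p x z"
  by (simp add: curv_def algebra_simps scaleR_2)

lemma curv_scaleR: "curv p (c *\<^sub>R x) y = c *\<^sub>R curv p x y"
  by (simp add: curv_def algebra_simps)

lemma curv_corner: "corner n p \<Longrightarrow> corner n x \<Longrightarrow> corner n y \<Longrightarrow> corner n (curv p x y)"
  unfolding curv_def by (intro corner_minus corner_plus corner_scaleR corner_times)

lemma curv_adj:
  assumes "p \<in> gr m n" "x \<in> tang n p" "y \<in> tang n p"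
  shows "adj (curv p x y) = curv p x y"
  by (simp add: curv_def ring_expand grD[OF assms(1)] tangD[OF assms(2)] tangD[OF assms(3)]
    anti_assoc[OF tangD(3)[OF assms(2)]] anti_assoc[OF tangD(3)[OF assms(3)]])

text \<open>Curvature terms are normal vectors, yet share the zero trace of tangent vectors; this
  makes \<open>D1_pert\<close> applicable to them.\<close>

lemma tr_curv:
  assumes "p \<in> gr m n" "x \<in> tang n p" "y \<in> tang n p"
  shows "tr (curv p x y) = 0"
proof -
  have "tr (p * (y * x)) = tr ((x * p) * y)"
    by (metis mult.assoc tr_mult_commute)
  also have "\<dots> = tr (x * y) - tr (p * (x * y))"
    by (simp add: tangD(3)[OF assms(2)] algebra_simps)
  finally show ?thesis
    by (simp add: curv_def tr_mult_commute[of y x] ring_distribs scaleR_2)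
qed

lemma norm_curv_le:
  assumes "norm p \<le> K"
  shows "norm (curv p x y) \<le> (2 + 4 * K) * norm x * norm y"
proof -
  let ?z = "x * y + y * x"
  have z: "norm ?z \<le> 2 * norm x * norm y"
    using norm_triangle_ineq[of "x * y" "y * x"] norm_mult_ineq[of x y] norm_mult_ineq[of y x]
    by (simp add: mult.commute[of "norm y"])
  have "norm (curv p x y) \<le> norm ?z + 2 * (norm p * norm ?z)"
    unfolding curv_def
    using norm_triangle_ineq4[of ?z "2 *\<^sub>R (p * ?z)"] norm_mult_ineq[of p ?z] by simp
  also have "\<dots> = (1 + 2 * norm p) * norm ?z"
    by (simp add: algebra_simps)
  also have "\<dots> \<le> (1 + 2 * K) * (2 * norm x * norm y)"
    using assms z norm_ge_zero[of p] norm_ge_zero[of ?z] by (intro mult_mono) linarith+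
  finally show ?thesis
    by (simp add: algebra_simps)
qed

text \<open>Differentiating \<open>p * p = p\<close> twice gives the hypothesis on the acceleration \<open>z\<close>.\<close>

lemma acceleration_tang:
  assumes "p \<in> gr m n" "x \<in> tang n p" "corner n z" "adj z = z"
    and "z * p + 2 *\<^sub>R (x * x) + p * z = z"
  shows "z - curv p x x \<in> tang n p"
proof -
  note p = grD[OF assms(1)] and x = tangD[OF assms(2)]
  have z: "z * p = z - p * z - 2 *\<^sub>R (x * x)"
    using assms(5) by (simp add: algebra_simps)
  have "p * (z - curv p x x) + (z - curv p x x) * p = z - curv p x x"
    by (simp add: curv_def ring_expand p(3) x(3) z idem_assoc[OF p(3)] anti_assoc[OF x(3)])
  then show ?thesis
    using assms p x curv_adj[OF assms(1,2,2)]
    by (auto simp: tang_def intro!: curv_corner)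
qed

text \<open>Tested against its own tangential part, \<open>v\<close> turns out to have none; its
  off-diagonal blocks then vanish, which is commutation with \<open>p\<close>.\<close>

lemma normal_commutes:
  assumes "p \<in> gr m n" "corner n v" "adj v = v" "\<And>x. x \<in> tang n p \<Longrightarrow> ip v x = 0"
  shows "v * p = p * v"
proof -
  note p = grD[OF assms(1)]
  have t: "tproj p v \<in> tang n p"
    by (rule tproj_tang[OF assms(1-3)])
  have "ip (tproj p v) (tproj p v) = 0"
    using assms(4)[OF tproj_tang[OF assms(1)], of "tproj p v"] tangD[OF t] ip_tproj[of v p "tproj p v"]
    by simp
  then have 0: "tproj p v = 0"
    using ip_self_eq_0 tangD(2)[OF t] by blast
  have "p * tproj p v = p * v - p * (v * p)" "tproj p v * p = v * p - p * (v * p)"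
    using p idem_assoc[OF p(3)] by (simp_all add: tproj_def algebra_simps scaleR_2)
  then show ?thesis
    by (simp add: 0)
qed

text \<open>A chord between projections is tangent at \<open>p\<close> up to a quadratic error, and
  an element commuting with \<open>p\<close> is orthogonal to the tangent space. So the pairing with
  the chord is exactly quadratic in it.\<close>

lemma ip_normal_diff:
  assumes "p * p = p" "q * q = q" "u * p = p * u"
  shows "ip u (p - q) = ip (2 *\<^sub>R (u * p) - u) ((p - q) * (p - q))"
proof -
  have "tr (u * (p * (q * p))) = tr (u * (p * q))"
    using tr_mult_commute[of "u * p * q" p] assms
    by (simp add: mult.assoc) (metis mult.assoc)
  moreover have "tr (u * (q * p)) = tr (u * (p * q))"
    using tr_mult_commute[of "u * q" p] assms by (simp add: mult.assoc) (metis mult.assoc)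
  moreover have "u * (p * z) = p * (u * z)" for z
    by (simp add: assms(3) flip: mult.assoc)
  ultimately show ?thesis
    by (simp add: ip_def ring_expand assms idem_assoc[OF assms(1)])
qed

text \<open>For large \<open>c\<close>, \<open>p\<close> is the spectral projection of \<open>u + c *\<^sub>R p\<close> for the upper part of the
  spectrum, and the spectral gap gives the Lipschitz bound.\<close>

lemma spectral_lipschitz:
  fixes R :: real
  obtains c where "\<And>p q u v. p \<in> gr m n \<Longrightarrow> q \<in> gr m n \<Longrightarrow> u * p = p * u \<Longrightarrow> v * q = q * v \<Longrightarrow>
    norm u \<le> R \<Longrightarrow> norm v \<le> R \<Longrightarrow>
    norm (p - q) \<le> (real n)\<^sup>2 * norm ((u + c *\<^sub>R p) - (v + c *\<^sub>R q))"
proof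
  define L where "L = 2 * (R * (real n * real m)) + R"
  fix p q u v
  assume gr: "p \<in> gr m n" "q \<in> gr m n" and comm: "u * p = p * u" "v * q = q * v"
    and R: "norm u \<le> R" "norm v \<le> R"
  \<comment> \<open>The two normal parts cost at most \<open>2 * L * (norm d)\<^sup>2\<close>, hence
    at most \<open>2 * L * (real n)\<^sup>2 * ip d d\<close>; the summand \<open>1\<close> leaves
    one \<open>ip d d\<close> over.\<close>
  let ?c = "2 * L * (real n)\<^sup>2 + 1"
  define d where "d = p - q"
  define D where "D = (u + ?c *\<^sub>R p) - (v + ?c *\<^sub>R q)"
  note p = grD[OF gr(1)] and q = grD[OF gr(2)]
  have d: "corner n d" "adj d = d"
    using p q by (auto simp: d_def)
  have dd: "(norm d)\<^sup>2 \<le> (real n)\<^sup>2 * ip d d"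
    by (rule norm_square_le_ip[OF d])
  have L: "norm (2 *\<^sub>R (w * e) - w) \<le> L" if "e \<in> gr m n" "norm w \<le> R" for w e
  proof -
    have "norm (2 *\<^sub>R (w * e) - w) \<le> 2 * (norm w * norm e) + norm w"
      using norm_triangle_ineq4[of "2 *\<^sub>R (w * e)" w] norm_mult_ineq[of w e] by simp
    also have "\<dots> \<le> L"
      unfolding L_def using that norm_gr_le[OF that(1)]
      by (intro add_mono mult_left_mono mult_mono order_trans[OF _ that(2)]) auto
    finally show ?thesis .
  qed
  have bound: "\<bar>ip w (d * d)\<bar> \<le> L * (norm d)\<^sup>2" if "norm w \<le> L" for w
    using ip_le[of w "d * d"] mult_mono[OF that norm_mult_ineq[of d d]] that norm_ge_zero[of w]
    by (simp add: power2_eq_square)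
  have "L \<ge> 0"
    using L[OF gr(1) R(1)] norm_ge_zero order_trans by blast
  have "ip u d = ip (2 *\<^sub>R (u * p) - u) (d * d)"
    unfolding d_def by (rule ip_normal_diff[OF p(3) q(3) comm(1)])
  then have u: "\<bar>ip u d\<bar> \<le> L * (norm d)\<^sup>2"
    using bound[OF L[OF gr(1) R(1)]] by presburger
  have "ip v (q - p) = ip (2 *\<^sub>R (v * q) - v) (d * d)"
    using ip_normal_diff[OF q(3) p(3) comm(2)] by (simp add: d_def algebra_simps)
  moreover have "ip v (q - p) = - ip v d"
    by (simp add: d_def ip_simps)
  ultimately have v: "\<bar>ip v d\<bar> \<le> L * (norm d)\<^sup>2"
    using bound[OF L[OF gr(2) R(2)]] by simp
  have "ip D d = ip u d - ip v d + ?c * ip d d"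
    unfolding D_def d_def by (simp add: ip_simps algebra_simps)
  moreover have "L * (norm d)\<^sup>2 \<le> L * ((real n)\<^sup>2 * ip d d)"
    by (rule mult_left_mono[OF dd \<open>L \<ge> 0\<close>])
  ultimately have "ip d d \<le> ip D d"
    using u v by (simp add: algebra_simps)
  also have "\<dots> \<le> norm D * norm d"
    using ip_le[of D d] by linarith
  finally have "(real n)\<^sup>2 * ip d d \<le> (real n)\<^sup>2 * (norm D * norm d)"
    by (rule mult_left_mono) simp
  with dd have "norm d * norm d \<le> ((real n)\<^sup>2 * norm D) * norm d"
    by (simp add: power2_eq_square mult.assoc)
  then have "norm d \<le> (real n)\<^sup>2 * norm D"
    by (cases "norm d = 0") (simp, metis mult_right_le_imp_le norm_ge_zero order_le_less)
  then show "norm (p - q) \<le> (real n)\<^sup>2 * norm ((u + ?c *\<^sub>R p) - (v + ?c *\<^sub>R q))"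
    by (simp add: d_def D_def)
qed

section \<open>Transport of tangent vectors between projections\<close>

lemma tproj_diff:
  assumes "p * p = p" "q * q = q"
  shows "tproj p (q - p) = (q - p) - (q - p) * (q - p) + 2 *\<^sub>R (p * ((q - p) * (q - p)))"
  by (simp add: tproj_def ring_expand assms idem_assoc[OF assms(1)] idem_assoc[OF assms(2)])

lemma tproj_move:
  assumes "p * p = p" "q * q = q" "w \<in> tang n p"
  shows "tproj q w = w + curv p w (q - p) - 2 *\<^sub>R ((q - p) * (q - p) * w) - 2 *\<^sub>R ((q - p) * w * (q - p))"
  by (simp add: tproj_def curv_def ring_expand assms(1,2) tangD(3)[OF assms(3)] idem_assoc[OF assms(1)]
      idem_assoc[OF assms(2)] anti_assoc[OF tangD(3)[OF assms(3)]])

text \<open>Projecting a tangent vector at \<open>p\<close> to the tangent space at \<open>q\<close>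
  changes it to first order by the curvature term along the tangential displacement. This term is
  what the Hessian identity later cancels, so the remainder has to be quadratic.\<close>

lemma tproj_estimates:
  assumes p: "p * p = p" and q: "q * q = q" and w: "w \<in> tang n p"
    and K: "norm p \<le> K" "norm q \<le> K"
  shows "norm (q - p - tproj p (q - p)) \<le> (1 + 2 * K) * (norm (q - p))\<^sup>2" (is ?A)
    and "norm (tproj q w - w - curv p w (tproj p (q - p))) \<le>
      (4 + (2 + 4 * K) * (1 + 2 * K)) * norm w * (norm (q - p))\<^sup>2" (is ?B)
    and "norm (tproj q w - w) \<le> (2 + 12 * K) * norm w * norm (q - p)" (is ?C)
proof -
  define d where "d = q - p"
  have "K \<ge> 0"
    using K(1) norm_ge_zero order_trans by blast
  have dd: "norm (d * d) \<le> (norm d)\<^sup>2"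
    by (simp add: norm_mult_ineq power2_eq_square)
  have "norm (d - tproj p d) = norm (d * d - 2 *\<^sub>R (p * (d * d)))"
    unfolding d_def tproj_diff[OF p q] by (simp add: algebra_simps)
  also have "\<dots> \<le> norm (d * d) + 2 * (norm p * norm (d * d))"
    using norm_triangle_ineq4[of "d * d" "2 *\<^sub>R (p * (d * d))"] norm_mult_ineq[of p "d * d"] by simp
  also have "\<dots> = (1 + 2 * norm p) * norm (d * d)"
    by (simp add: algebra_simps)
  also have "\<dots> \<le> (1 + 2 * K) * (norm d)\<^sup>2"
    using K dd norm_ge_zero[of p] norm_ge_zero[of "d * d"] by (intro mult_mono) linarith+
  finally have 1: "norm (d - tproj p d) \<le> (1 + 2 * K) * (norm d)\<^sup>2" .
  then show ?A
    by (simp add: d_def)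
  have "norm (d * d * w) \<le> (norm d)\<^sup>2 * norm w"
    using norm_mult_ineq[of "d * d" w] mult_right_mono[OF dd norm_ge_zero[of w]] by linarith
  moreover have "norm (d * w * d) \<le> (norm d)\<^sup>2 * norm w"
    using norm_mult_ineq[of "d * w" d] mult_right_mono[OF norm_mult_ineq[of d w] norm_ge_zero[of d]]
    by (simp add: power2_eq_square mult_ac)
  ultimately have quad: "norm (2 *\<^sub>R (d * d * w) + 2 *\<^sub>R (d * w * d)) \<le> 4 * norm w * (norm d)\<^sup>2"
    using norm_triangle_ineq[of "2 *\<^sub>R (d * d * w)" "2 *\<^sub>R (d * w * d)"] by (simp add: algebra_simps)
  have eq: "tproj q w - w = curv p w d - (2 *\<^sub>R (d * d * w) + 2 *\<^sub>R (d * w * d))"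
    unfolding d_def tproj_move[OF p q w] by (simp add: algebra_simps)
  have "norm (curv p w (d - tproj p d)) \<le> (2 + 4 * K) * norm w * norm (d - tproj p d)"
    by (rule norm_curv_le[OF K(1)])
  also have "\<dots> \<le> (2 + 4 * K) * norm w * ((1 + 2 * K) * (norm d)\<^sup>2)"
    using \<open>K \<ge> 0\<close> by (intro mult_left_mono[OF 1]) simp
  finally have c: "norm (curv p w (d - tproj p d)) \<le> (2 + 4 * K) * norm w * ((1 + 2 * K) * (norm d)\<^sup>2)" .
  have "tproj q w - w - curv p w (tproj p d) =
      curv p w (d - tproj p d) - (2 *\<^sub>R (d * d * w) + 2 *\<^sub>R (d * w * d))"
    by (simp add: eq curv_diff algebra_simps)
  then have "norm (tproj q w - w - curv p w (tproj p d)) \<le>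
      (2 + 4 * K) * norm w * ((1 + 2 * K) * (norm d)\<^sup>2) + 4 * norm w * (norm d)\<^sup>2"
    using norm_triangle_ineq4[of "curv p w (d - tproj p d)"] c quad by (smt (verit))
  then show ?B
    by (simp add: d_def algebra_simps)
  \<comment> \<open>Bounding one factor of the quadratic remainder by \<open>2 * K\<close> turns it
    into a linear one.\<close>
  have "norm d \<le> 2 * K"
    using norm_triangle_ineq4[of q p] K by (simp add: d_def)
  then have "4 * norm w * (norm d * norm d) \<le> 4 * norm w * (2 * K * norm d)"
    by (intro mult_left_mono mult_right_mono) auto
  then have "norm (tproj q w - w) \<le> (2 + 4 * K) * norm w * norm d + 4 * norm w * (2 * K * norm d)"
    unfolding eq using norm_triangle_ineq4[of "curv p w d"] norm_curv_le[OF K(1), of w d] quad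
    by (smt (verit) power2_eq_square)
  then show ?C
    by (simp add: d_def algebra_simps)
qed

subsection \<open>Critical values are avoided: a counting form of Sard's theorem\<close>

lemma floor_bounds: "\<bar>x\<bar> \<le> real b \<Longrightarrow> \<lfloor>x\<rfloor> \<in> {- int b..int b}" for x :: real
  by (auto simp: le_floor_iff floor_le_iff abs_le_iff)

text \<open>Think of \<open>H\<close> as the image of a parameter \<open>X\<close> under a map of a space into one of the same
  dimension, and of \<open>w\<close> as a covector that annihilates the derivative. If every point of a box
  were a critical value, then the points of a \<open>\<delta>\<^sup>2\<close>-grid in the box would be distributed over
  the \<open>\<delta>\<close>-cells of the parameter space, of which there are \<open>O(\<delta> powr (-D))\<close>. The grid points
  belonging to one cell lie in a slab of width \<open>\<delta>\<close> and thickness \<open>\<delta>\<^sup>2\<close>, hence number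
  only \<open>O(\<delta> powr (1 - D))\<close>. This is too few for small \<open>\<delta>\<close>.\<close>

lemma counting_sard:
  fixes S :: "('i \<Rightarrow> real) \<Rightarrow> ('i \<Rightarrow> real) \<Rightarrow> ('i \<Rightarrow> real) \<Rightarrow> bool"
    and I :: "'i set" and R C \<epsilon> :: real
  assumes I: "finite I" and "0 < \<epsilon>"
    and bound: "\<And>X H w i. S X H w \<Longrightarrow> i \<in> I \<Longrightarrow> \<bar>X i\<bar> \<le> R"
    and pivot: "\<And>X H w. S X H w \<Longrightarrow> \<exists>k\<in>I. \<bar>w k\<bar> = 1"
    and slab: "\<And>X H w X' H' w' \<delta>. S X H w \<Longrightarrow> S X' H' w' \<Longrightarrow> 0 < \<delta> \<Longrightarrow> \<delta> \<le> 1 \<Longrightarrow>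
      (\<And>i. i \<in> I \<Longrightarrow> \<bar>X' i - X i\<bar> \<le> \<delta>) \<Longrightarrow>
      (\<forall>i\<in>I. \<bar>H' i - H i\<bar> \<le> C * \<delta>) \<and> \<bar>\<Sum>i\<in>I. w i * (H' i - H i)\<bar> \<le> C * \<delta>\<^sup>2"
  shows "\<exists>H. (\<forall>i\<in>I. 0 \<le> H i \<and> H i \<le> \<epsilon>) \<and> (\<forall>X w. \<not> S X H w)"
proof (rule ccontr)
  assume neg: "\<not> ?thesis"
  then have "\<forall>H. \<exists>X w. (\<forall>i\<in>I. 0 \<le> H i \<and> H i \<le> \<epsilon>) \<longrightarrow> S X H w"
    by blast
  then obtain Xf wf where S: "\<And>H. (\<forall>i\<in>I. 0 \<le> H i \<and> H i \<le> \<epsilon>) \<Longrightarrow> S (Xf H) H (wf H)"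
    by metis
  \<comment> \<open>The origin lies in the box, and its pivot shows that \<open>I\<close> is
    nonempty; hence the exponent \<open>D - 1\<close> below is a true predecessor.\<close>
  have "S (Xf (\<lambda>_. 0)) (\<lambda>_. 0) (wf (\<lambda>_. 0))"
    using \<open>0 < \<epsilon>\<close> by (intro S) auto
  then have "I \<noteq> {}"
    using pivot by blast
  define D where "D = card I"
  have "D > 0"
    using I \<open>I \<noteq> {}\<close> by (simp add: D_def card_gt_0_iff)
  \<comment> \<open>Natural upper bounds for \<open>R\<close> and \<open>C / \<epsilon>\<close>,
    both at least one so that every count \<open>2 * x + 1\<close> below is at most
    \<open>3 * x\<close>.\<close>
  obtain R' :: nat where R': "R \<le> real R'" "1 \<le> R'"
    by (metis le_add2 linorder_le_cases of_nat_1 order_trans real_arch_simple of_nat_le_iff)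
  obtain b :: nat where b: "C / \<epsilon> \<le> real b" "1 \<le> b"
    by (metis le_add2 linorder_le_cases of_nat_1 order_trans real_arch_simple of_nat_le_iff)
  have C: "C \<le> real b * \<epsilon>"
    using b(1) \<open>0 < \<epsilon>\<close> by (simp add: field_simps)
  \<comment> \<open>The final count reads
    \<open>(q\<^sup>2) ^ D \<le> K * (q ^ D * q ^ (D - 1))\<close>, that is
    \<open>q \<le> K\<close>, which the choice of \<open>q\<close> contradicts. The factor 9
    consists of a 3 from counting cells and a 3 from counting the points of one cell.\<close>
  define K where "K = (9 * R' * b) ^ D"
  define q where "q = Suc K"
  \<comment> \<open>Cells have width \<open>1 / real q\<close>; the mesh is
    \<open>\<epsilon>\<close> times its square, so that each axis of the box carries
    \<open>q\<^sup>2 + 1\<close> grid points.\<close>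
  define \<eta> where "\<eta> = \<epsilon> / (real q)\<^sup>2"
  have q: "0 < q" "0 < real q"
    by (auto simp: q_def)
  have "\<eta> > 0"
    using \<open>0 < \<epsilon>\<close> q by (simp add: \<eta>_def)
  define G where "G = PiE I (\<lambda>_. {0..q\<^sup>2})"
  define h where "h \<kappa> i = real (\<kappa> i) * \<eta>" for \<kappa> :: "'i \<Rightarrow> nat" and i
  define X where "X \<kappa> = Xf (h \<kappa>)" for \<kappa>
  define w where "w \<kappa> = wf (h \<kappa>)" for \<kappa>
  define cell where "cell \<kappa> = (\<lambda>i\<in>I. \<lfloor>X \<kappa> i * real q\<rfloor>)" for \<kappa>
  define CC where "CC = PiE I (\<lambda>_. {- int (R' * q)..int (R' * q)})"
  have SG: "S (X \<kappa>) (h \<kappa>) (w \<kappa>)" if "\<kappa> \<in> G" for \<kappa>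
    unfolding X_def w_def
  proof (rule S, intro ballI)
    fix i assume "i \<in> I"
    then have "\<kappa> i \<le> q\<^sup>2"
      using that by (auto simp: G_def PiE_iff)
    then have "real (\<kappa> i) \<le> (real q)\<^sup>2"
      by (metis of_nat_le_iff of_nat_power)
    then show "0 \<le> h \<kappa> i \<and> h \<kappa> i \<le> \<epsilon>"
      using \<open>0 < \<epsilon>\<close> q by (simp add: h_def \<eta>_def field_simps)
  qed
  have fin: "finite G" "finite CC"
    by (auto simp: G_def CC_def I intro!: finite_PiE)
  have cell_in: "cell \<kappa> \<in> CC" if "\<kappa> \<in> G" for \<kappa>
  proof -
    have "\<lfloor>X \<kappa> i * real q\<rfloor> \<in> {- int (R' * q)..int (R' * q)}" if "i \<in> I" for i
    proof (rule floor_bounds)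
      have "\<bar>X \<kappa> i\<bar> \<le> real R'"
        using bound[OF SG[OF \<open>\<kappa> \<in> G\<close>] that] R' by linarith
      then show "\<bar>X \<kappa> i * real q\<bar> \<le> real (R' * q)"
        by (simp add: abs_mult mult_right_mono)
    qed
    then show ?thesis
      by (auto simp: cell_def CC_def)
  qed
  define M where "M = (3 * b) ^ D * q ^ (D - 1)"
  have fiber: "card {\<kappa> \<in> G. cell \<kappa> = c} \<le> M" for c
  proof (cases "{\<kappa> \<in> G. cell \<kappa> = c} = {}")
    case False
    then obtain \<kappa>0 where \<kappa>0: "\<kappa>0 \<in> G" "cell \<kappa>0 = c"
      by blast
    obtain k where k: "k \<in> I" "\<bar>w \<kappa>0 k\<bar> = 1"
      using pivot[OF SG[OF \<kappa>0(1)]] by blast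
    define l where "l \<kappa> = (\<Sum>i\<in>I. w \<kappa>0 i * (real (\<kappa> i) - real (\<kappa>0 i)))" for \<kappa> :: "'i \<Rightarrow> nat"
    \<comment> \<open>In the pivot direction the displacement is replaced by the integer part of the
      slab functional, which takes at most \<open>2 * b + 1\<close> values. The code stays
      injective: with the other coordinates fixed, \<open>l\<close> changes by exactly as much as
      coordinate \<open>k\<close>, because \<open>\<bar>w \<kappa>0 k\<bar> = 1\<close>.\<close>
    define \<theta> where "\<theta> \<kappa> = (\<lambda>i\<in>I. if i = k then \<lfloor>l \<kappa>\<rfloor> else int (\<kappa> i) - int (\<kappa>0 i))"
      for \<kappa> :: "'i \<Rightarrow> nat"
    define T where "T = PiE I (\<lambda>i. if i = k then {- int b..int b} else {- int (b * q)..int (b * q)})"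
    have "\<theta> \<kappa> \<in> T" if \<kappa>: "\<kappa> \<in> G" "cell \<kappa> = c" for \<kappa>
    proof -
      have close: "\<bar>X \<kappa> i - X \<kappa>0 i\<bar> \<le> 1 / real q" if "i \<in> I" for i
      proof -
        have "\<lfloor>X \<kappa> i * real q\<rfloor> = \<lfloor>X \<kappa>0 i * real q\<rfloor>"
          using fun_cong[OF trans[OF \<kappa>(2) \<kappa>0(2)[symmetric]], of i] that by (simp add: cell_def)
        then have "\<bar>X \<kappa> i * real q - X \<kappa>0 i * real q\<bar> \<le> 1"
          by linarith
        then have "\<bar>(X \<kappa> i - X \<kappa>0 i) * real q\<bar> \<le> 1"
          by (simp add: algebra_simps)
        then have "\<bar>X \<kappa> i - X \<kappa>0 i\<bar> * real q \<le> 1"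
          by (simp add: abs_mult)
        then show ?thesis
          using q by (simp add: pos_le_divide_eq)
      qed
      have sl: "\<forall>i\<in>I. \<bar>h \<kappa> i - h \<kappa>0 i\<bar> \<le> C * (1 / real q)"
        "\<bar>\<Sum>i\<in>I. w \<kappa>0 i * (h \<kappa> i - h \<kappa>0 i)\<bar> \<le> C * (1 / real q)\<^sup>2"
        using slab[OF SG[OF \<kappa>0(1)] SG[OF \<kappa>(1)], of "1 / real q"] close q
        by (auto simp: q_def)
      have hd: "h \<kappa> i - h \<kappa>0 i = (real (\<kappa> i) - real (\<kappa>0 i)) * \<eta>" for i
        by (simp add: h_def algebra_simps)
      have "int (\<kappa> i) - int (\<kappa>0 i) \<in> {- int (b * q)..int (b * q)}" if "i \<in> I" for i
      proof -
        have "\<bar>real (\<kappa> i) - real (\<kappa>0 i)\<bar> * \<eta> \<le> C * (1 / real q)"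
          using sl(1) that \<open>\<eta> > 0\<close> by (simp add: hd abs_mult)
        also have "\<dots> \<le> real b * \<epsilon> * (1 / real q)"
          using C by (intro mult_right_mono) auto
        also have "\<dots> = real (b * q) * \<eta>"
          using q by (simp add: \<eta>_def field_simps power2_eq_square)
        finally have "\<bar>real (\<kappa> i) - real (\<kappa>0 i)\<bar> \<le> real (b * q)"
          using \<open>\<eta> > 0\<close> by simp
        then have "\<bar>real_of_int (int (\<kappa> i) - int (\<kappa>0 i))\<bar> \<le> real (b * q)"
          by simp
        from floor_bounds[OF this] show ?thesis
          by (simp only: floor_of_int)
      qed
      moreover have "\<lfloor>l \<kappa>\<rfloor> \<in> {- int b..int b}"
      proof (rule floor_bounds)
        have "l \<kappa> * \<eta> = (\<Sum>i\<in>I. w \<kappa>0 i * (h \<kappa> i - h \<kappa>0 i))"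
          by (simp add: l_def hd sum_distrib_right mult.assoc)
        then have "\<bar>l \<kappa>\<bar> * \<eta> = \<bar>\<Sum>i\<in>I. w \<kappa>0 i * (h \<kappa> i - h \<kappa>0 i)\<bar>"
          using \<open>\<eta> > 0\<close> by (metis abs_mult abs_of_pos)
        also have "\<dots> \<le> real b * \<epsilon> * (1 / real q)\<^sup>2"
          using sl(2) mult_right_mono[OF C, of "(1 / real q)\<^sup>2"] by simp
        also have "\<dots> = real b * \<eta>"
          by (simp add: \<eta>_def field_simps)
        finally show "\<bar>l \<kappa>\<bar> \<le> real b"
          using \<open>\<eta> > 0\<close> by simp
      qed
      ultimately show ?thesis
        by (auto simp: \<theta>_def T_def)
    qed
    then have "\<theta> ` {\<kappa> \<in> G. cell \<kappa> = c} \<subseteq> T"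
      by blast
    moreover have "inj_on \<theta> {\<kappa> \<in> G. cell \<kappa> = c}"
    proof (rule inj_onI)
      fix \<kappa> \<mu> assume "\<kappa> \<in> {\<kappa> \<in> G. cell \<kappa> = c}" "\<mu> \<in> {\<kappa> \<in> G. cell \<kappa> = c}" and eq: "\<theta> \<kappa> = \<theta> \<mu>"
      then have in_G: "\<kappa> \<in> G" "\<mu> \<in> G"
        by auto
      have off: "\<kappa> i = \<mu> i" if "i \<in> I" "i \<noteq> k" for i
        using fun_cong[OF eq, of i] that by (simp add: \<theta>_def)
      have "\<lfloor>l \<kappa>\<rfloor> = \<lfloor>l \<mu>\<rfloor>"
        using fun_cong[OF eq, of k] k by (simp add: \<theta>_def)
      then have "\<bar>l \<kappa> - l \<mu>\<bar> < 1"
        by linarith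
      moreover have "l \<kappa> - l \<mu> = (\<Sum>i\<in>I. w \<kappa>0 i * (real (\<kappa> i) - real (\<mu> i)))"
        by (simp add: l_def algebra_simps flip: sum_subtractf)
      moreover have "\<dots> = w \<kappa>0 k * (real (\<kappa> k) - real (\<mu> k))"
        using off by (simp add: sum.remove[OF I k(1)])
      ultimately have "\<bar>real (\<kappa> k) - real (\<mu> k)\<bar> < 1"
        using k by (simp add: abs_mult)
      then have "\<kappa> k = \<mu> k"
        by linarith
      with off have "\<kappa> i = \<mu> i" if "i \<in> I" for i
        using that by (cases "i = k") auto
      then show "\<kappa> = \<mu>"
        using in_G unfolding G_def by (intro PiE_ext) auto
    qed
    moreover have "finite T"
      by (auto simp: T_def I intro!: finite_PiE)
    ultimately have "card {\<kappa> \<in> G. cell \<kappa> = c} \<le> card T"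
      using card_inj_on_le by blast
    also have "card T = (2 * b + 1) * (2 * (b * q) + 1) ^ (D - 1)"
    proof -
      have "card T = (\<Prod>i\<in>I. if i = k then 2 * b + 1 else 2 * (b * q) + 1)"
        unfolding T_def card_PiE[OF I] by (intro prod.cong) (auto simp: nat_add_distrib nat_mult_distrib)
      also have "\<dots> = (2 * b + 1) * (\<Prod>i\<in>I - {k}. 2 * (b * q) + 1)"
        by (subst prod.remove[OF I k(1)]) simp
      finally show ?thesis
        using k(1) by (simp add: D_def)
    qed
    also have "\<dots> \<le> (3 * b) * (3 * b * q) ^ (D - 1)"
      using b q by (intro mult_mono power_mono) (simp_all add: Suc_le_eq)
    also have "\<dots> = M"
      using \<open>D > 0\<close> by (cases D) (simp_all add: M_def power_mult_distrib)
    finally show ?thesis .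
  qed (simp only: card.empty)
  have "(q\<^sup>2 + 1) ^ D = card G"
    by (simp add: G_def card_PiE I D_def)
  also have "G = (\<Union>c\<in>CC. {\<kappa> \<in> G. cell \<kappa> = c})"
    using cell_in by blast
  also have "card \<dots> \<le> (\<Sum>c\<in>CC. card {\<kappa> \<in> G. cell \<kappa> = c})"
    by (rule card_UN_le[OF fin(2)])
  also have "\<dots> \<le> card CC * M"
    using sum_bounded_above[of CC, OF fiber] by simp
  also have "card CC = (2 * (R' * q) + 1) ^ D"
    by (simp add: CC_def card_PiE I D_def nat_add_distrib nat_mult_distrib)
  also have "\<dots> \<le> (3 * R' * q) ^ D"
    using R' q by (intro power_mono) (simp_all add: Suc_le_eq)
  finally have "(q\<^sup>2 + 1) ^ D \<le> (3 * R' * q) ^ D * M"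
    by simp
  moreover have "(q\<^sup>2) ^ D \<le> (q\<^sup>2 + 1) ^ D"
    by (intro power_mono) auto
  ultimately have "(q\<^sup>2) ^ D \<le> (3 * R' * q) ^ D * M"
    by linarith
  also have "\<dots> = K * (q ^ D * q ^ (D - 1))"
    unfolding K_def M_def by (simp add: power_mult_distrib mult_ac flip: power_mult_distrib[of 3 3])
  also have "(q\<^sup>2) ^ D = q * (q ^ D * q ^ (D - 1))"
    using \<open>D > 0\<close> by (cases D) (simp_all add: power2_eq_square power_mult_distrib mult_ac)
  finally have "q \<le> K"
    using q by simp
  then show False
    by (simp add: q_def)
qed

subsection \<open>Multilinear forms on tuples of matrices\<close>

text \<open>Both estimates come from one induction, since the quadratic remainder of a product with
  one more factor contains the linear remainder of the shorter product.\<close>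

lemma prod_taylor:
  fixes x y :: "'i \<Rightarrow> complex"
  assumes "finite J" "1 \<le> K" "\<And>k. k \<in> J \<Longrightarrow> cmod (x k) \<le> K"
    "\<And>k. k \<in> J \<Longrightarrow> cmod (y k) \<le> K" "\<And>k. k \<in> J \<Longrightarrow> cmod (y k - x k) \<le> \<delta>"
  shows "cmod (prod y J - prod x J) \<le> real (card J) * K ^ card J * \<delta>" (is ?A)
    and "cmod (prod y J - prod x J - (\<Sum>i\<in>J. (y i - x i) * prod x (J - {i}))) \<le>
      (real (card J))\<^sup>2 * K ^ card J * \<delta>\<^sup>2" (is ?B)
proof -
  have "?A \<and> cmod (prod x J) \<le> K ^ card J \<and> ?B"
    using assms
  proof (induction J rule: finite_induct)
    case (insert a J)
    define n where "n = card J"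
    define L where "L = (\<Sum>i\<in>J. (y i - x i) * prod x (J - {i}))"
    have IH: "cmod (prod y J - prod x J) \<le> real n * K ^ n * \<delta>" "cmod (prod x J) \<le> K ^ n"
      "cmod (prod y J - prod x J - L) \<le> (real n)\<^sup>2 * K ^ n * \<delta>\<^sup>2"
      using insert unfolding n_def L_def by auto
    have a: "cmod (x a) \<le> K" "cmod (y a) \<le> K" "cmod (y a - x a) \<le> \<delta>"
      using insert.prems by auto
    then have "0 \<le> \<delta>"
      using norm_ge_zero order_trans by blast
    have card: "card (insert a J) = Suc n"
      using insert by (simp add: n_def)
    have K: "K ^ n \<le> K ^ Suc n"
      using \<open>1 \<le> K\<close> by simp
    have "prod y (insert a J) - prod x (insert a J) =
        y a * (prod y J - prod x J) + (y a - x a) * prod x J"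
      using insert by (simp add: algebra_simps)
    then have "cmod (prod y (insert a J) - prod x (insert a J)) \<le>
        cmod (y a) * cmod (prod y J - prod x J) + cmod (y a - x a) * cmod (prod x J)"
      by (metis norm_mult norm_triangle_ineq)
    also have "\<dots> \<le> K * (real n * K ^ n * \<delta>) + \<delta> * K ^ Suc n"
      using a IH(1) order_trans[OF IH(2) K] \<open>0 \<le> \<delta>\<close> \<open>1 \<le> K\<close> by (intro add_mono mult_mono) auto
    finally have 1: "cmod (prod y (insert a J) - prod x (insert a J)) \<le> real (Suc n) * K ^ Suc n * \<delta>"
      by (simp add: algebra_simps)
    have "(\<Sum>i\<in>J. (y i - x i) * prod x (insert a J - {i})) = (\<Sum>i\<in>J. x a * ((y i - x i) * prod x (J - {i})))"
    proof (rule sum.cong)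
      fix i assume "i \<in> J"
      then have "insert a J - {i} = insert a (J - {i})"
        using insert.hyps by auto
      then show "(y i - x i) * prod x (insert a J - {i}) = x a * ((y i - x i) * prod x (J - {i}))"
        using insert.hyps by simp
    qed simp
    moreover have "insert a J - {a} = J"
      using insert.hyps by auto
    ultimately have L: "(\<Sum>i\<in>insert a J. (y i - x i) * prod x (insert a J - {i})) =
        (y a - x a) * prod x J + x a * L"
      using insert.hyps by (simp add: L_def sum_distrib_left)
    have "prod y (insert a J) - prod x (insert a J) - ((y a - x a) * prod x J + x a * L) =
        x a * (prod y J - prod x J - L) + (y a - x a) * (prod y J - prod x J)"
      using insert by (simp add: algebra_simps)
    then have "cmod (prod y (insert a J) - prod x (insert a J) - ((y a - x a) * prod x J + x a * L)) \<le>
        cmod (x a) * cmod (prod y J - prod x J - L) + cmod (y a - x a) * cmod (prod y J - prod x J)"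
      by (metis norm_mult norm_triangle_ineq)
    also have "\<dots> \<le> K * ((real n)\<^sup>2 * K ^ n * \<delta>\<^sup>2) + \<delta> * (real n * K ^ n * \<delta>)"
      using a IH(1,3) \<open>0 \<le> \<delta>\<close> \<open>1 \<le> K\<close> by (intro add_mono mult_mono) auto
    also have "\<dots> \<le> (real n)\<^sup>2 * K ^ Suc n * \<delta>\<^sup>2 + real n * K ^ Suc n * \<delta>\<^sup>2"
      using mult_left_mono[OF K, of "real n * (\<delta> * \<delta>)"] \<open>0 \<le> \<delta>\<close>
      by (simp add: power2_eq_square mult_ac)
    \<comment> \<open>Enlarging \<open>real n\<close> to \<open>2 * real n + 1\<close> completes the
      square of \<open>real (Suc n)\<close>.\<close>
    also have "\<dots> \<le> (real n)\<^sup>2 * K ^ Suc n * \<delta>\<^sup>2 + (2 * real n + 1) * K ^ Suc n * \<delta>\<^sup>2"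
      using \<open>1 \<le> K\<close> by (intro add_left_mono mult_right_mono) auto
    also have "\<dots> = (real (Suc n))\<^sup>2 * K ^ Suc n * \<delta>\<^sup>2"
      by (simp add: algebra_simps power2_eq_square)
    finally have 2: "cmod (prod y (insert a J) - prod x (insert a J) - ((y a - x a) * prod x J + x a * L)) \<le>
      (real (Suc n))\<^sup>2 * K ^ Suc n * \<delta>\<^sup>2" .
    have 3: "cmod (prod x (insert a J)) \<le> K ^ Suc n"
      using insert.hyps a(1) IH(2) \<open>1 \<le> K\<close> by (simp add: norm_mult mult_mono)
    show ?case
      unfolding card L using 1 2 3 by blast
  qed simp
  then show ?A ?B
    by auto
qed

lemma norm_ent_diff_le: "cmod (ent x i j - ent y i j) \<le> norm (x - y)"
  using norm_ent_le[of "x - y" i j] by simp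

lemma has_vector_derivative_prod:
  fixes e :: "'i \<Rightarrow> real \<Rightarrow> complex"
  assumes "\<And>j. j \<in> J \<Longrightarrow> (e j has_vector_derivative e' j) (at t)"
  shows "((\<lambda>s. \<Prod>j\<in>J. e j s) has_vector_derivative (\<Sum>j\<in>J. e' j * (\<Prod>k\<in>J - {j}. e k t))) (at t)"
proof -
  have "((\<lambda>s. \<Prod>j\<in>J. e j s) has_derivative
      (\<lambda>h. \<Sum>j\<in>J. (h *\<^sub>R e' j) * (\<Prod>k\<in>J - {j}. e k t))) (at t)"
    using assms by (intro has_derivative_prod) (auto simp: has_vector_derivative_def)
  then show ?thesis
    by (simp add: has_vector_derivative_def scaleR_sum_right)
qed

text \<open>A term \<open>t\<close> picks one entry, at \<open>(a t j, b t j)\<close>, from each of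
  the \<open>r\<close> matrices. How a Kronecker index splits into digits is hidden, and only
  multilinearity is left.\<close>

locale multilinear_form =
  fixes r :: nat and S :: "'t set" and a b :: "'t \<Rightarrow> nat \<Rightarrow> nat"
  assumes finite_S: "finite S"
begin

abbreviation e :: "'t \<Rightarrow> (nat \<Rightarrow> fmat) \<Rightarrow> nat \<Rightarrow> complex" where
  "e t y j \<equiv> ent (y j) (a t j) (b t j)"

definition mon :: "'t \<Rightarrow> (nat \<Rightarrow> fmat) \<Rightarrow> complex" where
  "mon t y = (\<Prod>j<r. e t y j)"

definition phi :: "('t \<Rightarrow> complex) \<Rightarrow> (nat \<Rightarrow> fmat) \<Rightarrow> real" where
  "phi c y = Re (\<Sum>t\<in>S. c t * mon t y)"

definition D1 :: "('t \<Rightarrow> complex) \<Rightarrow> (nat \<Rightarrow> fmat) \<Rightarrow> (nat \<Rightarrow> fmat) \<Rightarrow> real" where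
  "D1 c p w = (\<Sum>j<r. phi c (p(j := w j)))"

definition D2 :: "('t \<Rightarrow> complex) \<Rightarrow> (nat \<Rightarrow> fmat) \<Rightarrow> (nat \<Rightarrow> fmat) \<Rightarrow> (nat \<Rightarrow> fmat) \<Rightarrow> real" where
  "D2 c p v w = (\<Sum>j<r. \<Sum>i\<in>{..<r} - {j}. phi c (p(j := w j, i := v i)))"

text \<open>Along a curve of projections the acceleration is the curvature term plus a tangent
  vector, on which the first derivative vanishes at a critical point. What remains is the ambient
  second derivative corrected by \<open>D1\<close> of the curvature term.\<close>

definition hess :: "('t \<Rightarrow> complex) \<Rightarrow> (nat \<Rightarrow> fmat) \<Rightarrow> (nat \<Rightarrow> fmat) \<Rightarrow> (nat \<Rightarrow> fmat) \<Rightarrow> real" where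
  "hess c p w x = D2 c p w x + D1 c p (\<lambda>j. curv (p j) (w j) (x j))"

lemma phi_cong: "(\<And>j. j < r \<Longrightarrow> x j = y j) \<Longrightarrow> phi c x = phi c y"
  by (simp add: phi_def mon_def)

lemma mon_upd:
  assumes "j < r"
  shows "mon t (p(j := x)) = ent x (a t j) (b t j) * (\<Prod>k\<in>{..<r} - {j}. e t p k)"
  unfolding mon_def using assms by (subst prod.remove[of _ j]) auto

lemma mon_upd2:
  assumes "j < r" "i < r" "i \<noteq> j"
  shows "mon t (p(j := x, i := y)) = ent x (a t j) (b t j) * (ent y (a t i) (b t i) *
    (\<Prod>k\<in>{..<r} - {j} - {i}. e t p k))"
proof -
  have "p(j := x, i := y) = p(i := y, j := x)"
    using assms by (simp add: fun_upd_twist)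
  then have "mon t (p(j := x, i := y)) =
      ent x (a t j) (b t j) * (\<Prod>k\<in>{..<r} - {j}. e t (p(i := y)) k)"
    using mon_upd[OF assms(1)] by metis
  also have "(\<Prod>k\<in>{..<r} - {j}. e t (p(i := y)) k) =
      ent y (a t i) (b t i) * (\<Prod>k\<in>{..<r} - {j} - {i}. e t p k)"
    using assms by (subst prod.remove[of _ i]) auto
  finally show ?thesis .
qed

lemma phi_upd_add: "j < r \<Longrightarrow> phi c (p(j := x + y)) = phi c (p(j := x)) + phi c (p(j := y))"
  by (simp add: phi_def mon_upd algebra_simps sum.distrib)

lemma phi_upd_scaleR: "j < r \<Longrightarrow> phi c (p(j := s *\<^sub>R x)) = s * phi c (p(j := x))"
  by (simp add: phi_def mon_upd scaleR_conv_of_real sum_distrib_left mult_ac)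

lemma phi_coeff_add: "phi (\<lambda>t. c t + c' t) y = phi c y + phi c' y"
  by (simp add: phi_def algebra_simps sum.distrib)

lemma D1_coeff_add: "D1 (\<lambda>t. c t + c' t) p w = D1 c p w + D1 c' p w"
  by (simp add: D1_def phi_coeff_add sum.distrib)

lemma D2_coeff_add: "D2 (\<lambda>t. c t + c' t) p v w = D2 c p v w + D2 c' p v w"
  by (simp add: D2_def phi_coeff_add sum.distrib)

lemma D1_cong: "(\<And>j. j < r \<Longrightarrow> p j = q j) \<Longrightarrow> (\<And>j. j < r \<Longrightarrow> w j = x j) \<Longrightarrow> D1 c p w = D1 c q x"
  unfolding D1_def by (intro sum.cong phi_cong) auto

lemma D2_cong:
  "(\<And>j. j < r \<Longrightarrow> p j = q j) \<Longrightarrow> (\<And>j. j < r \<Longrightarrow> v j = u j) \<Longrightarrow> (\<And>j. j < r \<Longrightarrow> w j = x j) \<Longrightarrow>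
    D2 c p v w = D2 c q u x"
  unfolding D2_def by (intro sum.cong phi_cong) auto

lemma hess_cong:
  "(\<And>j. j < r \<Longrightarrow> p j = q j) \<Longrightarrow> (\<And>j. j < r \<Longrightarrow> v j = u j) \<Longrightarrow> (\<And>j. j < r \<Longrightarrow> w j = x j) \<Longrightarrow>
    hess c p v w = hess c q u x"
  unfolding hess_def by (intro arg_cong2[where f = "(+)"] D1_cong D2_cong) auto

lemma D1_add: "D1 c p (\<lambda>j. v j + w j) = D1 c p v + D1 c p w"
  by (simp add: D1_def phi_upd_add sum.distrib)

lemma D1_scaleR: "D1 c p (\<lambda>j. s *\<^sub>R w j) = s * D1 c p w"
  by (simp add: D1_def phi_upd_scaleR sum_distrib_left)

lemma D1_diff: "D1 c p (\<lambda>j. v j - w j) = D1 c p v - D1 c p w"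
  using D1_add[of c p v "\<lambda>j. (-1) *\<^sub>R w j"] D1_scaleR[of c p "-1" w] by simp

lemma D2_commute: "D2 c p v w = D2 c p w v"
proof -
  have 1: "D2 c p v w = (\<Sum>(j, i)\<in>{(j, i). j < r \<and> i < r \<and> i \<noteq> j}. phi c (p(j := w j, i := v i)))" for v w
    unfolding D2_def by (subst sum.Sigma) (auto intro!: sum.cong)
  show ?thesis
    unfolding 1
    by (rule sum.reindex_bij_witness[where i = "\<lambda>(j, i). (i, j)" and j = "\<lambda>(j, i). (i, j)"])
      (auto simp: fun_upd_twist)
qed

lemma D2_add_left: "D2 c p (\<lambda>j. u j + v j) w = D2 c p u w + D2 c p v w"
  by (simp add: D2_def phi_upd_add sum.distrib)

lemma D2_scaleR_left: "D2 c p (\<lambda>j. s *\<^sub>R v j) w = s * D2 c p v w"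
  by (simp add: D2_def phi_upd_scaleR sum_distrib_left)

lemma hess_commute: "hess c p v w = hess c p w v"
  by (simp add: hess_def D2_commute[of c p v] curv_commute)

lemma hess_add: "hess c p w (\<lambda>j. u j + v j) = hess c p w u + hess c p w v"
  by (simp add: hess_def D2_commute[of c p w] D2_add_left curv_add D1_add)

lemma hess_scaleR_left: "hess c p (\<lambda>j. s *\<^sub>R w j) v = s * hess c p w v"
  by (simp add: hess_def D2_scaleR_left curv_scaleR D1_scaleR algebra_simps)

lemma phi_has_derivative:
  assumes "\<And>j. j < r \<Longrightarrow> ((\<lambda>s. g s j) has_vector_derivative g' j) (at t)"
  shows "((\<lambda>s. phi c (g s)) has_real_derivative D1 c (g t) g') (at t)"
proof -
  have e: "((\<lambda>s. ent (g s j) k l) has_vector_derivative ent (g' j) k l) (at t)" if "j < r" for j k l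
    by (rule bounded_linear.has_vector_derivative[OF bounded_linear_ent assms[OF that]])
  have "((\<lambda>s. mon u (g s)) has_vector_derivative (\<Sum>j<r. mon u ((g t)(j := g' j)))) (at t)" for u
  proof -
    have "((\<lambda>s. mon u (g s)) has_vector_derivative
        (\<Sum>j<r. ent (g' j) (a u j) (b u j) * (\<Prod>k\<in>{..<r} - {j}. ent (g t k) (a u k) (b u k)))) (at t)"
      unfolding mon_def by (rule has_vector_derivative_prod) (simp add: e)
    then show ?thesis
      by (simp add: mon_upd)
  qed
  then have "((\<lambda>s. \<Sum>u\<in>S. c u * mon u (g s)) has_vector_derivative
      (\<Sum>u\<in>S. c u * (\<Sum>j<r. mon u ((g t)(j := g' j))))) (at t)"
    by (intro has_vector_derivative_sum
        bounded_linear.has_vector_derivative[OF bounded_linear_mult_right])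
  then have "((\<lambda>s. phi c (g s)) has_vector_derivative
      Re (\<Sum>u\<in>S. c u * (\<Sum>j<r. mon u ((g t)(j := g' j))))) (at t)"
    unfolding phi_def by (rule bounded_linear.has_vector_derivative[OF bounded_linear_Re])
  moreover have "(\<Sum>u\<in>S. c u * (\<Sum>j<r. mon u ((g t)(j := g' j)))) =
      (\<Sum>j<r. \<Sum>u\<in>S. c u * mon u ((g t)(j := g' j)))"
    by (simp add: sum_distrib_left) (rule sum.swap)
  ultimately show ?thesis
    by (simp add: has_real_derivative_iff_has_vector_derivative D1_def phi_def)
qed

text \<open>In each summand of \<open>D1\<close> one slot holds the velocity: differentiating that
  slot produces the acceleration, differentiating the others the mixed terms.\<close>

lemma D1_has_derivative:
  assumes "\<And>j. j < r \<Longrightarrow> ((\<lambda>s. g s j) has_vector_derivative g1 t j) (at t)"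
    and "\<And>j. j < r \<Longrightarrow> ((\<lambda>s. g1 s j) has_vector_derivative g2 j) (at t)"
  shows "((\<lambda>s. D1 c (g s) (g1 s)) has_real_derivative
    D2 c (g t) (g1 t) (g1 t) + D1 c (g t) g2) (at t)"
proof -
  have "((\<lambda>s. phi c ((g s)(j := g1 s j))) has_real_derivative
      (\<Sum>i\<in>{..<r} - {j}. phi c ((g t)(j := g1 t j, i := g1 t i))) + phi c ((g t)(j := g2 j))) (at t)"
    if "j < r" for j
  proof -
    have "((\<lambda>s. phi c ((g s)(j := g1 s j))) has_real_derivative
        D1 c ((g t)(j := g1 t j)) ((g1 t)(j := g2 j))) (at t)"
      using assms by (intro phi_has_derivative) auto
    moreover have "D1 c ((g t)(j := g1 t j)) ((g1 t)(j := g2 j)) =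
      (\<Sum>i\<in>{..<r} - {j}. phi c ((g t)(j := g1 t j, i := g1 t i))) + phi c ((g t)(j := g2 j))"
      unfolding D1_def using that by (subst sum.remove[of _ j]) (auto intro!: sum.cong)
    ultimately show ?thesis
      by simp
  qed
  then have "((\<lambda>s. \<Sum>j<r. phi c ((g s)(j := g1 s j))) has_real_derivative
      (\<Sum>j<r. (\<Sum>i\<in>{..<r} - {j}. phi c ((g t)(j := g1 t j, i := g1 t i))) + phi c ((g t)(j := g2 j)))) (at t)"
    by (intro DERIV_sum) auto
  then show ?thesis
    by (simp add: D1_def D2_def sum.distrib)
qed

lemma tendsto_phi:
  assumes "\<And>t. t \<in> S \<Longrightarrow> (\<lambda>k. c k t) \<longlonglongrightarrow> c' t" "\<And>j. j < r \<Longrightarrow> (\<lambda>k. y k j) \<longlonglongrightarrow> y' j"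
  shows "(\<lambda>k. phi (c k) (y k)) \<longlonglongrightarrow> phi c' y'"
  unfolding phi_def mon_def
  by (intro tendsto_Re tendsto_sum tendsto_mult tendsto_prod assms
      bounded_linear.tendsto[OF bounded_linear_ent]) auto

lemma tendsto_D1:
  assumes "\<And>t. t \<in> S \<Longrightarrow> (\<lambda>k. c k t) \<longlonglongrightarrow> c' t" "\<And>j. j < r \<Longrightarrow> (\<lambda>k. p k j) \<longlonglongrightarrow> p' j"
    "\<And>j. j < r \<Longrightarrow> (\<lambda>k. w k j) \<longlonglongrightarrow> w' j"
  shows "(\<lambda>k. D1 (c k) (p k) (w k)) \<longlonglongrightarrow> D1 c' p' w'"
  unfolding D1_def using assms by (intro tendsto_sum tendsto_phi) auto

lemma tendsto_D2:
  assumes "\<And>t. t \<in> S \<Longrightarrow> (\<lambda>k. c k t) \<longlonglongrightarrow> c' t" "\<And>j. j < r \<Longrightarrow> (\<lambda>k. p k j) \<longlonglongrightarrow> p' j"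
    "\<And>j. j < r \<Longrightarrow> (\<lambda>k. v k j) \<longlonglongrightarrow> v' j" "\<And>j. j < r \<Longrightarrow> (\<lambda>k. w k j) \<longlonglongrightarrow> w' j"
  shows "(\<lambda>k. D2 (c k) (p k) (v k) (w k)) \<longlonglongrightarrow> D2 c' p' v' w'"
  unfolding D2_def using assms by (intro tendsto_sum tendsto_phi) auto

lemma tendsto_hess:
  assumes "\<And>t. t \<in> S \<Longrightarrow> (\<lambda>k. c k t) \<longlonglongrightarrow> c' t" "\<And>j. j < r \<Longrightarrow> (\<lambda>k. p k j) \<longlonglongrightarrow> p' j"
    "\<And>j. j < r \<Longrightarrow> (\<lambda>k. v k j) \<longlonglongrightarrow> v' j" "\<And>j. j < r \<Longrightarrow> (\<lambda>k. w k j) \<longlonglongrightarrow> w' j"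
  shows "(\<lambda>k. hess (c k) (p k) (v k) (w k)) \<longlonglongrightarrow> hess c' p' v' w'"
  unfolding hess_def curv_def using assms
  by (intro tendsto_add tendsto_D1 tendsto_D2 tendsto_diff tendsto_mult tendsto_scaleR) auto

text \<open>The matrix unit carries the indices transposed, because
  \<open>tr (munit i j z * x)\<close> reads off \<open>ent x j i\<close>. Symmetrizing keeps the
  pairing with Hermitian arguments and makes the gradient Hermitian.\<close>

definition grad :: "('t \<Rightarrow> complex) \<Rightarrow> (nat \<Rightarrow> fmat) \<Rightarrow> nat \<Rightarrow> fmat" where
  "grad c p j = (let Y = \<Sum>t\<in>S. munit (b t j) (a t j) (c t * (\<Prod>k\<in>{..<r} - {j}. e t p k))
    in (1/2) *\<^sub>R (Y + adj Y))"

lemma adj_grad: "adj (grad c p j) = grad c p j"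
  by (simp add: grad_def Let_def add.commute)

lemma corner_grad:
  assumes "\<And>t. t \<in> S \<Longrightarrow> a t j < n" "\<And>t. t \<in> S \<Longrightarrow> b t j < n"
  shows "corner n (grad c p j)"
  unfolding grad_def Let_def using assms
  by (intro corner_scaleR corner_plus corner_adj corner_sum corner_munit) auto

lemma ip_grad:
  assumes "j < r" "adj x = x"
  shows "ip (grad c p j) x = phi c (p(j := x))"
proof -
  let ?z = "\<lambda>t. c t * (\<Prod>k\<in>{..<r} - {j}. e t p k)"
  define Y where "Y = (\<Sum>t\<in>S. munit (b t j) (a t j) (?z t))"
  have "tr (adj Y * x) = cnj (tr (Y * x))"
    by (metis adj_mult assms(2) tr_adj tr_mult_commute adj_simps(6))
  then have "ip (grad c p j) x = Re (tr (Y * x))"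
    by (simp add: grad_def Let_def Y_def ip_def distrib_right)
  also have "tr (Y * x) = (\<Sum>t\<in>S. tr (munit (b t j) (a t j) (?z t) * x))"
    unfolding Y_def sum_distrib_right
    by (rule bounded_linear.linear[OF bounded_linear_tr, THEN linear_sum])
  also have "\<dots> = (\<Sum>t\<in>S. c t * mon t (p(j := x)))"
    by (intro sum.cong) (simp_all add: tr_munit_mult mon_upd assms(1))
  finally show ?thesis
    by (simp add: phi_def)
qed

lemma D1_eq_ip_grad:
  assumes "\<And>j. j < r \<Longrightarrow> adj (x j) = x j"
  shows "D1 c p x = (\<Sum>j<r. ip (grad c p j) (x j))"
  unfolding D1_def using assms by (intro sum.cong) (auto simp: ip_grad)

lemma norm_grad_diff_le:
  assumes "1 \<le> K"
  obtains C where "0 \<le> C" "\<And>p q \<delta> j. (\<And>k. k < r \<Longrightarrow> norm (p k) \<le> K) \<Longrightarrow>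
    (\<And>k. k < r \<Longrightarrow> norm (q k) \<le> K) \<Longrightarrow> (\<And>k. k < r \<Longrightarrow> norm (q k - p k) \<le> \<delta>) \<Longrightarrow> 0 \<le> \<delta> \<Longrightarrow>
    norm (grad c q j - grad c p j) \<le> C * \<delta>"
proof
  let ?B = "real r * K ^ r"
  show "0 \<le> (\<Sum>t\<in>S. cmod (c t) * ?B)"
    using assms by (intro sum_nonneg) auto
  fix p q :: "nat \<Rightarrow> fmat" and \<delta> j
  assume p: "\<And>k. k < r \<Longrightarrow> norm (p k) \<le> K" and q: "\<And>k. k < r \<Longrightarrow> norm (q k) \<le> K"
    and d: "\<And>k. k < r \<Longrightarrow> norm (q k - p k) \<le> \<delta>" "0 \<le> \<delta>"
  let ?J = "{..<r} - {j}"
  let ?P = "\<lambda>p t. \<Prod>k\<in>?J. e t p k"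
  have P: "cmod (?P q t - ?P p t) \<le> ?B * \<delta>" for t
  proof -
    have "cmod (?P q t - ?P p t) \<le> real (card ?J) * K ^ card ?J * \<delta>"
      by (intro prod_taylor(1)[OF _ assms] order_trans[OF norm_ent_diff_le]
          order_trans[OF norm_ent_le] p q d) auto
    also have "\<dots> \<le> ?B * \<delta>"
      using card_Diff1_le[of "{..<r}" j] assms d(2)
      by (intro mult_right_mono[OF mult_mono] power_increasing) auto
    finally show ?thesis .
  qed
  define Y where "Y p = (\<Sum>t\<in>S. munit (b t j) (a t j) (c t * ?P p t))" for p
  have lin: "munit i k u - munit i k v = munit i k (u - v)" for i k u v
    by (rule fmat_eqI) (simp add: munit.rep_eq)
  have "norm (Y q - Y p) = norm (\<Sum>t\<in>S. munit (b t j) (a t j) (c t * (?P q t - ?P p t)))"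
    unfolding Y_def sum_subtractf[symmetric] lin by (simp add: algebra_simps)
  also have "\<dots> \<le> (\<Sum>t\<in>S. cmod (c t) * (?B * \<delta>))"
    by (intro order_trans[OF norm_sum] sum_mono) (auto simp: norm_munit norm_mult intro!: mult_left_mono P)
  finally have Y: "norm (Y q - Y p) \<le> (\<Sum>t\<in>S. cmod (c t) * ?B) * \<delta>"
    by (simp add: sum_distrib_right mult.assoc)
  have "grad c q j - grad c p j = (1/2) *\<^sub>R ((Y q - Y p) + adj (Y q - Y p))"
    unfolding grad_def Let_def Y_def[symmetric] by (simp add: algebra_simps)
  then have "norm (grad c q j - grad c p j) \<le> norm (Y q - Y p)"
    using norm_triangle_ineq[of "Y q - Y p" "adj (Y q - Y p)"] norm_adj[of "Y q - Y p"] by simp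
  with Y show "norm (grad c q j - grad c p j) \<le> (\<Sum>t\<in>S. cmod (c t) * ?B) * \<delta>"
    by linarith
qed

text \<open>In the summand for \<open>j\<close> that slot holds \<open>w j\<close> on both sides, so
  only the product over the other slots moves and \<open>prod_taylor\<close> applies to it.\<close>

lemma D1_taylor:
  assumes "1 \<le> K"
  obtains C where "0 \<le> C" "\<And>p q w \<delta>. (\<And>k. k < r \<Longrightarrow> norm (p k) \<le> K) \<Longrightarrow>
    (\<And>k. k < r \<Longrightarrow> norm (q k) \<le> K) \<Longrightarrow> (\<And>k. k < r \<Longrightarrow> norm (q k - p k) \<le> \<delta>) \<Longrightarrow>
    (\<And>k. k < r \<Longrightarrow> norm (w k) \<le> W) \<Longrightarrow>
    \<bar>D1 c q w - D1 c p w - D2 c p (\<lambda>j. q j - p j) w\<bar> \<le> C * \<delta>\<^sup>2"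
proof
  let ?B = "(real r)\<^sup>2 * K ^ r"
  show "0 \<le> (\<Sum>j<r. \<Sum>t\<in>S. cmod (c t) * (\<bar>W\<bar> * ?B))"
    using assms by (intro sum_nonneg mult_nonneg_nonneg) auto
  fix p q w :: "nat \<Rightarrow> fmat" and \<delta>
  assume p: "\<And>k. k < r \<Longrightarrow> norm (p k) \<le> K" and q: "\<And>k. k < r \<Longrightarrow> norm (q k) \<le> K"
    and d: "\<And>k. k < r \<Longrightarrow> norm (q k - p k) \<le> \<delta>" and w: "\<And>k. k < r \<Longrightarrow> norm (w k) \<le> W"
  let ?R = "\<lambda>t j. prod (e t q) ({..<r} - {j}) - prod (e t p) ({..<r} - {j}) -
    (\<Sum>i\<in>{..<r} - {j}. (e t q i - e t p i) * prod (e t p) ({..<r} - {j} - {i}))"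
  have R: "cmod (?R t j) \<le> ?B * \<delta>\<^sup>2" for t j
  proof -
    let ?J = "{..<r} - {j}"
    have "cmod (?R t j) \<le> (real (card ?J))\<^sup>2 * K ^ card ?J * \<delta>\<^sup>2"
      by (intro prod_taylor(2)[OF _ assms] order_trans[OF norm_ent_diff_le]
          order_trans[OF norm_ent_le] p q d) auto
    also have "\<dots> \<le> ?B * \<delta>\<^sup>2"
      using card_Diff1_le[of "{..<r}" j] assms
      by (intro mult_right_mono[OF mult_mono] power_increasing power_mono) auto
    finally show ?thesis .
  qed
  have eq: "D1 c q w - D1 c p w - D2 c p (\<lambda>j. q j - p j) w =
      (\<Sum>j<r. Re (\<Sum>t\<in>S. c t * (e t w j * ?R t j)))"
  proof -
    have "phi c (q(j := w j)) - phi c (p(j := w j)) - (\<Sum>i\<in>{..<r} - {j}. phi c (p(j := w j, i := q i - p i)))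
      = Re (\<Sum>t\<in>S. c t * (e t w j * ?R t j))" if "j < r" for j
    proof -
      have "(\<Sum>i\<in>{..<r} - {j}. \<Sum>t\<in>S. c t * mon t (p(j := w j, i := q i - p i))) =
          (\<Sum>t\<in>S. \<Sum>i\<in>{..<r} - {j}. c t * mon t (p(j := w j, i := q i - p i)))"
        by (rule sum.swap)
      also have "\<dots> = (\<Sum>t\<in>S. c t * (e t w j *
          (\<Sum>i\<in>{..<r} - {j}. (e t q i - e t p i) * prod (e t p) ({..<r} - {j} - {i}))))"
        using that by (intro sum.cong) (auto simp: sum_distrib_left mon_upd2)
      finally show ?thesis
        unfolding phi_def mon_upd[OF that] Re_sum[symmetric] minus_complex.sel[symmetric]
        by (simp add: right_diff_distrib sum_subtractf del: Re_sum)
    qed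
    then show ?thesis
      by (simp add: D1_def D2_def flip: sum_subtractf)
  qed
  have "\<bar>D1 c q w - D1 c p w - D2 c p (\<lambda>j. q j - p j) w\<bar> \<le> (\<Sum>j<r. \<Sum>t\<in>S. cmod (c t) * (\<bar>W\<bar> * (?B * \<delta>\<^sup>2)))"
    unfolding eq
  proof (intro order_trans[OF sum_abs] sum_mono order_trans[OF abs_Re_le_cmod] order_trans[OF norm_sum])
    fix j t assume "j \<in> {..<r}"
    then have "cmod (e t w j) \<le> \<bar>W\<bar>"
      using w[of j] norm_ent_le[of "w j" "a t j" "b t j"] by auto
    then show "cmod (c t * (e t w j * ?R t j)) \<le> cmod (c t) * (\<bar>W\<bar> * (?B * \<delta>\<^sup>2))"
      unfolding norm_mult by (intro mult_left_mono mult_mono R) auto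
  qed
  also have "\<dots> = (\<Sum>j<r. \<Sum>t\<in>S. cmod (c t) * (\<bar>W\<bar> * ?B)) * \<delta>\<^sup>2"
    by (simp add: sum_distrib_right mult.assoc)
  finally show "\<bar>D1 c q w - D1 c p w - D2 c p (\<lambda>j. q j - p j) w\<bar> \<le>
      (\<Sum>j<r. \<Sum>t\<in>S. cmod (c t) * (\<bar>W\<bar> * ?B)) * \<delta>\<^sup>2" .
qed

lemma abs_phi_upd_le:
  assumes "1 \<le> K"
  obtains C where "0 \<le> C" "\<And>p j x. (\<And>k. k < r \<Longrightarrow> norm (p k) \<le> K) \<Longrightarrow> j < r \<Longrightarrow>
    \<bar>phi c (p(j := x))\<bar> \<le> C * norm x"
proof
  let ?C = "\<Sum>t\<in>S. cmod (c t) * K ^ r"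
  show "0 \<le> ?C"
    using assms by (intro sum_nonneg) auto
  fix p :: "nat \<Rightarrow> fmat" and j x
  assume p: "\<And>k. k < r \<Longrightarrow> norm (p k) \<le> K" and j: "j < r"
  have "\<bar>phi c (p(j := x))\<bar> \<le> (\<Sum>t\<in>S. cmod (c t) * (norm x * K ^ r))"
    unfolding phi_def mon_upd[OF j]
  proof (intro order_trans[OF abs_Re_le_cmod] order_trans[OF norm_sum] sum_mono)
    fix t
    have "cmod (\<Prod>k\<in>{..<r} - {j}. e t p k) \<le> (\<Prod>k\<in>{..<r} - {j}. K)"
      unfolding prod_norm[symmetric] using p by (intro prod_mono) (auto intro: order_trans[OF norm_ent_le])
    also have "\<dots> \<le> K ^ r"
      using assms card_Diff1_le[of "{..<r}" j] by (simp add: power_increasing)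
    finally show "cmod (c t * (ent x (a t j) (b t j) * (\<Prod>k\<in>{..<r} - {j}. e t p k)))
        \<le> cmod (c t) * (norm x * K ^ r)"
      unfolding norm_mult by (intro mult_left_mono mult_mono norm_ent_le) auto
  qed
  also have "\<dots> = ?C * norm x"
    by (simp add: sum_distrib_right mult.assoc mult.commute[of "norm x"])
  finally show "\<bar>phi c (p(j := x))\<bar> \<le> ?C * norm x" .
qed

end

subsection \<open>Curves in the Grassmannian\<close>

text \<open>An exponential generating series, so that differentiation is the shift of the
  coefficient sequence and all derivatives are again of this form. Working entrywise reduces
  termwise differentiation to complex power series.\<close>

definition exp_series :: "nat \<Rightarrow> (nat \<Rightarrow> fmat) \<Rightarrow> real \<Rightarrow> fmat" where
  "exp_series n z t =
    (\<Sum>i<n. \<Sum>j<n. munit i j (\<Sum>k. ent (z k) i j / fact k * complex_of_real t ^ k))"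

lemma corner_exp_series [intro]: "corner n (exp_series n z t)"
  unfolding exp_series_def by (intro corner_sum corner_munit) auto

context
  fixes n :: nat and z :: "nat \<Rightarrow> fmat" and A B :: real
  assumes corner: "\<And>k. corner n (z k)" and bound: "\<And>k. norm (z k) \<le> A * B ^ k" and nn: "0 \<le> B"
begin

lemma exp_series_summable: "summable (\<lambda>k. ent (z k) i j / fact k * (w :: complex) ^ k)"
proof (rule summable_comparison_test')
  show "summable (\<lambda>k. A * (inverse (fact k) * (B * cmod w) ^ k))"
    by (intro summable_mult summable_exp)
  fix k
  have "cmod (ent (z k) i j) \<le> A * B ^ k"
    by (rule order_trans[OF norm_ent_le bound])
  then have "cmod (ent (z k) i j / fact k * w ^ k) \<le> (A * B ^ k) / fact k * cmod w ^ k"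
    unfolding norm_mult norm_divide norm_power
    by (intro mult_right_mono) (simp_all add: divide_right_mono)
  then show "norm (ent (z k) i j / fact k * w ^ k) \<le> A * (inverse (fact k) * (B * cmod w) ^ k)"
    by (simp add: power_mult_distrib divide_inverse mult_ac)
qed

lemma exp_series_sums: "(\<lambda>k. (t ^ k / fact k) *\<^sub>R z k) sums exp_series n z t"
proof -
  have "(\<lambda>k. ent (z k) i j / fact k * complex_of_real t ^ k) sums
      (\<Sum>k. ent (z k) i j / fact k * complex_of_real t ^ k)" for i j
    by (rule summable_sums[OF exp_series_summable])
  then have "(\<lambda>k. \<Sum>i<n. \<Sum>j<n. munit i j (ent (z k) i j / fact k * complex_of_real t ^ k)) sums
      exp_series n z t"
    unfolding exp_series_def by (intro sums_sum bounded_linear.sums[OF bounded_linear_munit])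
  moreover have "(t ^ k / fact k) *\<^sub>R z k =
      (\<Sum>i<n. \<Sum>j<n. munit i j (ent (z k) i j / fact k * complex_of_real t ^ k))" for k
    by (rule trans[OF fmat_expand[OF corner_scaleR[OF corner]]])
      (simp add: scaleR_conv_of_real mult.commute)
  ultimately show ?thesis
    by simp
qed

lemma exp_series_0: "exp_series n z 0 = z 0"
proof -
  have "(\<lambda>k. (0 ^ k / fact k) *\<^sub>R z k) sums z 0"
  proof -
    have "(\<lambda>k. (0 ^ k / fact k) *\<^sub>R z k) = (\<lambda>k. if k = 0 then z k else 0)"
      by (auto simp: power_0_left)
    then show ?thesis
      using sums_single[of 0 z] by simp
  qed
  then show ?thesis
    using exp_series_sums[of 0] sums_unique2 by blast
qed

lemma exp_series_has_derivative:
  "(exp_series n z has_vector_derivative exp_series n (\<lambda>k. z (Suc k)) t) (at t)"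
proof -
  have "((\<lambda>t. \<Sum>k. ent (z k) i j / fact k * complex_of_real t ^ k) has_vector_derivative
      (\<Sum>k. ent (z (Suc k)) i j / fact k * complex_of_real t ^ k)) (at t)" for i j
  proof (rule has_vector_derivative_real_field)
    let ?a = "\<lambda>k. ent (z k) i j / fact k"
    have d: "diffs ?a = (\<lambda>k. ent (z (Suc k)) i j / fact k)"
      by (rule ext) (simp add: diffs_def divide_simps del: of_nat_Suc)
    show "((\<lambda>w. \<Sum>k. ?a k * w ^ k) has_field_derivative
        (\<Sum>k. ent (z (Suc k)) i j / fact k * complex_of_real t ^ k)) (at (complex_of_real t))"
      using termdiffs_strong_converges_everywhere[of ?a, OF exp_series_summable] unfolding d .
  qed
  then show ?thesis
    unfolding exp_series_def
    by (intro has_vector_derivative_sum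
        bounded_linear.has_vector_derivative[OF bounded_linear_munit])
qed

end

text \<open>The curve is \<open>exp (t W) p exp (-t W)\<close> with \<open>W = x p - p x\<close>. As \<open>2 p - 1\<close> anticommutes
  with \<open>W\<close>, its Taylor coefficients after the first are \<open>(2 W)\<^sup>k x\<close>, so that the curve solves both
  \<open>g' = 2 W g - W\<close> and \<open>g' = W - 2 g W\<close>.\<close>

lemma gr_curve_exists:
  assumes p: "p \<in> gr m n" and x: "x \<in> tang n p"
  obtains G where "G 0 0 = p" "G (Suc 0) 0 = x" "\<And>t. G 0 t \<in> gr m n" "\<And>k t. corner n (G k t)"
    "\<And>k t. (G k has_vector_derivative G (Suc k) t) (at t)"
proof
  note P = grD[OF p] and X = tangD[OF x]
  \<comment> \<open>The skew-adjoint generator of the conjugation; its commutator with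
    \<open>p\<close> is \<open>x\<close>.\<close>
  define W where "W = x * p - p * x"
  define y where "y = rec_nat x (\<lambda>_ u. 2 *\<^sub>R (W * u))"
  have y: "y 0 = x" "y (Suc k) = 2 *\<^sub>R (W * y k)" for k
    by (simp_all add: y_def)
  \<comment> \<open>\<open>p\<close> is put in front separately, since only the later coefficients
    anticommute with \<open>W\<close> and follow the recursion.\<close>
  define z where "z k = (case k of 0 \<Rightarrow> p | Suc k \<Rightarrow> y k)" for k
  have z: "z 0 = p" "z (Suc 0) = x" "z (Suc (Suc k)) = 2 *\<^sub>R (W * z (Suc k))" for k
    by (simp_all add: z_def y)
  have W: "corner n W" "adj W = - W"
    using P X by (auto simp: W_def)
  have W1: "2 *\<^sub>R (W * p) - W = x" "W - 2 *\<^sub>R (p * W) = x" "W * x = - (x * W)"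
    by (simp_all add: W_def ring_expand P(3) X(3) idem_assoc[OF P(3)] anti_assoc[OF X(3)])
  have anti: "W * z (Suc k) = - (z (Suc k) * W)" for k
  proof (induction k)
    case (Suc k)
    have "W * (W * z (Suc k)) = - (W * z (Suc k) * W)"
      by (subst Suc) (simp add: mult.assoc)
    then show ?case
      by (simp add: z)
  qed (simp add: z W1)
  have zc: "corner n (z k)" for k
  proof (cases k)
    case (Suc l)
    have "corner n (z (Suc l))"
      by (induction l) (use X W in \<open>auto simp: z\<close>)
    then show ?thesis
      by (simp add: Suc)
  qed (simp add: z P)
  have zh: "adj (z k) = z k" for k
  proof (cases k)
    case (Suc l)
    have "adj (z (Suc l)) = z (Suc l)"
      by (induction l) (simp_all add: z X W anti)
    then show ?thesis
      by (simp add: Suc)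
  qed (simp add: z P)
  define B where "B = 1 + 2 * norm W"
  have "0 \<le> B" "1 \<le> B"
    by (auto simp: B_def)
  have zb: "norm (z k) \<le> (norm p + norm x) * B ^ k" for k
  proof (cases k)
    case (Suc l)
    have "norm (z (Suc l)) \<le> norm x * B ^ l"
    proof (induction l)
      case (Suc l)
      have "norm (z (Suc (Suc l))) \<le> 2 * norm W * norm (z (Suc l))"
        using norm_mult_ineq[of W "z (Suc l)"] by (simp add: z)
      also have "\<dots> \<le> B * (norm x * B ^ l)"
        by (intro mult_mono Suc) (auto simp: B_def)
      finally show ?case
        by (simp add: mult_ac)
    qed (simp add: z)
    also have "\<dots> \<le> (norm p + norm x) * B ^ Suc l"
      using \<open>1 \<le> B\<close> by (intro mult_mono power_increasing) auto
    finally show ?thesis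
      by (simp add: Suc)
  qed (simp add: z)
  have zb': "norm (z (k + q)) \<le> ((norm p + norm x) * B ^ q) * B ^ k" for k q
    using zb[of "k + q"] by (simp add: power_add mult_ac)
  define G where "G q = exp_series n (\<lambda>k. z (k + q))" for q
  note ser = exp_series_sums[of n "\<lambda>k. z (k + _)", OF zc zb' \<open>0 \<le> B\<close>, folded G_def]
  show der: "(G k has_vector_derivative G (Suc k) t) (at t)" for k t
    using exp_series_has_derivative[of n "\<lambda>l. z (l + k)", OF zc zb' \<open>0 \<le> B\<close>, of t]
    by (simp add: G_def)
  show "G 0 0 = p" "G (Suc 0) 0 = x"
    using exp_series_0[of n "\<lambda>l. z (l + 0)", OF zc zb' \<open>0 \<le> B\<close>]
      exp_series_0[of n "\<lambda>l. z (l + Suc 0)", OF zc zb' \<open>0 \<le> B\<close>] by (simp_all add: G_def z)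
  show corner: "corner n (G k t)" for k t
    by (auto simp: G_def)
  have G1: "G (Suc 0) t = 2 *\<^sub>R (W * G 0 t) - W" for t
  proof -
    have "(\<lambda>k. (t ^ k / fact k) *\<^sub>R z (k + Suc 0) - 2 *\<^sub>R (W * ((t ^ k / fact k) *\<^sub>R z (k + 0)))) sums
        (G (Suc 0) t - 2 *\<^sub>R (W * G 0 t))"
      by (intro sums_diff ser bounded_linear.sums[OF bounded_linear_scaleR_right]
          bounded_linear.sums[OF bounded_linear_mult_right])
    \<comment> \<open>Only the coefficient at \<open>k = 0\<close> departs from the recursion, and
      it does so by exactly \<open>- W\<close>, the inhomogeneous term of the equation.\<close>
    moreover have "(t ^ k / fact k) *\<^sub>R z (k + Suc 0) - 2 *\<^sub>R (W * ((t ^ k / fact k) *\<^sub>R z (k + 0))) =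
        (if k = 0 then - W else 0)" for k
      using W1(1) by (cases k) (simp_all add: z algebra_simps)
    ultimately have "(\<lambda>k. if k = 0 then - W else 0) sums (G (Suc 0) t - 2 *\<^sub>R (W * G 0 t))"
      by simp
    then have "G (Suc 0) t - 2 *\<^sub>R (W * G 0 t) = - W"
      using sums_single[of 0 "\<lambda>_. - W"] sums_unique2 by blast
    then show ?thesis
      by (simp add: algebra_simps)
  qed
  have G1': "G (Suc 0) t = W - 2 *\<^sub>R (G 0 t * W)" for t
  proof -
    have "(\<lambda>k. (t ^ k / fact k) *\<^sub>R z (k + Suc 0) + 2 *\<^sub>R (((t ^ k / fact k) *\<^sub>R z (k + 0)) * W)) sums
        (G (Suc 0) t + 2 *\<^sub>R (G 0 t * W))"
      by (intro sums_add ser bounded_linear.sums[OF bounded_linear_scaleR_right]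
          bounded_linear.sums[OF bounded_linear_mult_left])
    moreover have "(t ^ k / fact k) *\<^sub>R z (k + Suc 0) + 2 *\<^sub>R (((t ^ k / fact k) *\<^sub>R z (k + 0)) * W) =
        (if k = 0 then W else 0)" for k
      using W1(2) by (cases k) (simp_all add: z anti algebra_simps)
    ultimately have "(\<lambda>k. if k = 0 then W else 0) sums (G (Suc 0) t + 2 *\<^sub>R (G 0 t * W))"
      by simp
    then have "G (Suc 0) t + 2 *\<^sub>R (G 0 t * W) = W"
      using sums_single[of 0 "\<lambda>_. W"] sums_unique2 by blast
    then show ?thesis
      by (simp add: algebra_simps)
  qed
  have comm: "G (Suc 0) t = W * G 0 t - G 0 t * W" for t
  proof -
    have "2 *\<^sub>R G (Suc 0) t = 2 *\<^sub>R (W * G 0 t - G 0 t * W)"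
      using arg_cong2[where f = "(+)", OF G1[of t] G1'[of t]] by (simp add: scaleR_2 algebra_simps)
    then show ?thesis
      by simp
  qed
  have herm: "adj (G 0 t) = G 0 t" for t
  proof (rule sums_unique2[OF _ ser])
    show "(\<lambda>k. (t ^ k / fact k) *\<^sub>R z (k + 0)) sums adj (G 0 t)"
      using bounded_linear.sums[OF bounded_linear_adj ser[of t 0]] by (simp add: zh)
  qed
  have const: "f t = f 0" if f: "\<And>t. (f has_vector_derivative 0) (at t)" for f :: "real \<Rightarrow> 'b::real_normed_vector" and t
  proof -
    obtain c where "\<And>s. s \<in> UNIV \<Longrightarrow> f s = c"
      using has_vector_derivative_zero_constant[of UNIV f] f by auto
    then show ?thesis
      by simp
  qed
  \<comment> \<open>The two differential equations and their mean \<open>comm\<close> make the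
    derivative of the defect of idempotency vanish identically, so the curve never leaves the
    idempotents and no inverse exponential has to be multiplied out.\<close>
  have "((\<lambda>t. G 0 t * G 0 t - G 0 t) has_vector_derivative 0) (at t)" for t
  proof -
    have "G 0 t * G (Suc 0) t + G (Suc 0) t * G 0 t - G (Suc 0) t = 0"
      using comm[of t] by (subst G1, subst G1') (simp add: ring_expand algebra_simps)
    then show ?thesis
      using has_vector_derivative_diff[OF has_vector_derivative_mult[OF der[of 0 t] der[of 0 t]] der[of 0 t]]
      by simp
  qed
  from const[OF this] have idem: "G 0 t * G 0 t = G 0 t" for t
    by (simp add: \<open>G 0 0 = p\<close> P)
  have "((\<lambda>t. tr (G 0 t)) has_vector_derivative 0) (at t)" for t
    using bounded_linear.has_vector_derivative[OF bounded_linear_tr der[of 0 t]]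
    by (simp add: comm tr_mult_commute[of W])
  from const[OF this] have "tr (G 0 t) = of_nat m" for t
    by (simp add: \<open>G 0 0 = p\<close> P)
  then show "G 0 t \<in> gr m n" for t
    by (simp add: gr_def corner herm idem)
qed

lemma has_derivative_adj_eq:
  assumes "(g has_vector_derivative d) (at t)" "\<And>s. adj (g s) = g s"
  shows "adj d = d"
  using bounded_linear.has_vector_derivative[OF bounded_linear_adj assms(1)] assms
    vector_derivative_unique_at by fastforce

lemma gr_velocity:
  assumes "\<And>s. g s \<in> gr m n" "(g has_vector_derivative d) (at t)" "corner n d"
  shows "d \<in> tang n (g t)"
proof -
  have "((\<lambda>s. g s * g s) has_vector_derivative g t * d + d * g t) (at t)"
    by (rule has_vector_derivative_mult[OF assms(2,2)])
  moreover have "(\<lambda>s. g s * g s) = g"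
    using grD(3)[OF assms(1)] by auto
  ultimately have "g t * d + d * g t = d"
    using vector_derivative_unique_at assms(2) by metis
  then show ?thesis
    using has_derivative_adj_eq[OF assms(2)] grD(2)[OF assms(1)] assms(3) by (simp add: tang_def)
qed

lemma gr_acceleration:
  assumes "\<And>s. g s \<in> gr m n" "\<And>s. (g has_vector_derivative g' s) (at s)"
    "(g' has_vector_derivative z) (at t)" "\<And>s. corner n (g' s)" "corner n z"
  shows "z - curv (g t) (g' t) (g' t) \<in> tang n (g t)"
proof -
  have t: "g' s \<in> tang n (g s)" for s
    by (rule gr_velocity[OF assms(1,2,4)])
  have "((\<lambda>s. g s * g' s + g' s * g s) has_vector_derivative
      (g t * z + g' t * g' t) + (g' t * g' t + z * g t)) (at t)"
    by (intro has_vector_derivative_add has_vector_derivative_mult assms)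
  moreover have "(\<lambda>s. g s * g' s + g' s * g s) = g'"
    using t by (auto simp: tang_def)
  ultimately have "(g t * z + g' t * g' t) + (g' t * g' t + z * g t) = z"
    using vector_derivative_unique_at assms(3) by metis
  moreover have "adj z = z"
    using has_derivative_adj_eq[OF assms(3)] tangD(2)[OF t] by blast
  ultimately show ?thesis
    using assms(1,5) t by (intro acceleration_tang) (auto simp: scaleR_2 algebra_simps)
qed

subsection \<open>Embedding of matrices\<close>

lift_definition emb :: "complex mat \<Rightarrow> fmat"
  is "\<lambda>X i j. if i < dim_row X \<and> j < dim_col X then X $$ (i, j) else 0"
proof -
  fix X :: "complex mat"
  show "\<exists>N. \<forall>i j. N \<le> i \<or> N \<le> j \<longrightarrow> (if i < dim_row X \<and> j < dim_col X then X $$ (i, j) else 0) = 0"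
    by (rule exI[of _ "dim_row X + dim_col X"]) auto
qed

definition to_mat :: "nat \<Rightarrow> fmat \<Rightarrow> complex mat" where
  "to_mat n x = mat n n (\<lambda>(i, j). ent x i j)"

lemma ent_emb: "X \<in> carrier_mat n n \<Longrightarrow> i < n \<Longrightarrow> j < n \<Longrightarrow> ent (emb X) i j = X $$ (i, j)"
  by (auto simp: emb.rep_eq)

lemma corner_emb: "X \<in> carrier_mat n n \<Longrightarrow> corner n (emb X)"
  by (auto simp: corner_def emb.rep_eq)

lemma to_mat_carrier [simp, intro]: "to_mat n x \<in> carrier_mat n n"
  by (simp add: to_mat_def)

lemma emb_to_mat: "corner n x \<Longrightarrow> emb (to_mat n x) = x"
  by (rule fmat_eqI) (auto simp: emb.rep_eq to_mat_def corner_def not_less)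

lemma emb_inject: "X \<in> carrier_mat n n \<Longrightarrow> Y \<in> carrier_mat n n \<Longrightarrow> emb X = emb Y \<longleftrightarrow> X = Y"
  by (metis carrier_matD ent_emb eq_matI)

lemma mat_adjoint_carrier: "X \<in> carrier_mat n n \<Longrightarrow> mat_adjoint X \<in> carrier_mat n n"
  by (auto simp: mat_adjoint_def)

lemma mat_adjoint_index:
  "X \<in> carrier_mat n n \<Longrightarrow> i < n \<Longrightarrow> j < n \<Longrightarrow> mat_adjoint X $$ (i, j) = cnj (X $$ (j, i))"
  by (auto simp: mat_adjoint_def mat_of_rows_index)

lemma emb_adjoint: "X \<in> carrier_mat n n \<Longrightarrow> emb (mat_adjoint X) = adj (emb X)"
  using mat_adjoint_carrier[of X n] mat_adjoint_index[of X n]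
  by (intro fmat_eqI) (auto simp: emb.rep_eq)

lemma emb_times:
  assumes "X \<in> carrier_mat n n" "Y \<in> carrier_mat n n"
  shows "emb (X * Y) = emb X * emb Y"
proof (rule fmat_eqI)
  fix i j
  show "ent (emb (X * Y)) i j = ent (emb X * emb Y) i j"
    using assms
    by (auto simp: ent_times[OF corner_emb[OF assms(1)]] emb.rep_eq scalar_prod_def atLeast0LessThan
        intro!: sum.cong sum.neutral[symmetric])
qed

lemma tr_emb: "X \<in> carrier_mat n n \<Longrightarrow> tr (emb X) = mat_trace X"
  by (auto simp: tr_corner[OF corner_emb] mat_trace_def emb.rep_eq intro!: sum.cong)

lemma Gr_iff_gr: "X \<in> Gr m n \<longleftrightarrow> X \<in> carrier_mat n n \<and> emb X \<in> gr m n"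
proof (cases "X \<in> carrier_mat n n")
  case True
  then have "X * X \<in> carrier_mat n n" "mat_adjoint X \<in> carrier_mat n n"
    by (auto intro: mat_adjoint_carrier)
  with True show ?thesis
    by (simp add: Gr_def gr_def corner_emb tr_emb[symmetric] emb_times[symmetric] emb_adjoint[symmetric] emb_inject[of _ n])
qed (simp add: Gr_def)

lemma emb_zero: "emb (0\<^sub>m n n) = 0"
  by (rule fmat_eqI) (simp add: emb.rep_eq)

lemma emb_zero_iff: "X \<in> carrier_mat n n \<Longrightarrow> emb X = 0 \<longleftrightarrow> X = 0\<^sub>m n n"
  using emb_inject[of X n "0\<^sub>m n n"] emb_zero by simp

lemma emb_add: "X \<in> carrier_mat n n \<Longrightarrow> Y \<in> carrier_mat n n \<Longrightarrow> emb (X + Y) = emb X + emb Y"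
  by (intro fmat_eqI) (auto simp: emb.rep_eq)

subsection \<open>Kronecker products and mixed radix digits\<close>

text \<open>Mixed radix digits with the most significant first, matching the right fold of
  \<open>kronecker_list\<close>: the head has place value \<open>prod_list ns\<close>. The value on
  the empty list is a default.\<close>

fun dig :: "nat list \<Rightarrow> nat \<Rightarrow> nat \<Rightarrow> nat" where
  "dig [] j I = 0"
| "dig (n # ns) 0 I = I div prod_list ns"
| "dig (n # ns) (Suc j) I = dig ns j (I mod prod_list ns)"

lemma dig_less: "j < length ns \<Longrightarrow> I < prod_list ns \<Longrightarrow> dig ns j I < ns ! j"
proof (induction ns j I rule: dig.induct)
  case (2 n ns I)
  then show ?case
    by (simp add: less_mult_imp_div_less)
next
  case (3 n ns j I)
  then show ?case
    by (cases "prod_list ns = 0") auto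
qed simp

lemma kronecker_list_index:
  assumes "list_all2 (\<lambda>P n. P \<in> carrier_mat n n) Ps ns"
  shows "kronecker_list Ps \<in> carrier_mat (prod_list ns) (prod_list ns) \<and>
    (\<forall>I < prod_list ns. \<forall>J < prod_list ns.
      kronecker_list Ps $$ (I, J) = (\<Prod>j<length ns. Ps ! j $$ (dig ns j I, dig ns j J)))"
  using assms
proof (induction rule: list_all2_induct)
  case Nil
  then show ?case
    by (simp add: kronecker_list_def)
next
  case (Cons P Ps n ns)
  have K: "kronecker_list (P # Ps) = kronecker P (kronecker_list Ps)"
    by (simp add: kronecker_list_def)
  have d: "dim_row P = n" "dim_col P = n" "dim_row (kronecker_list Ps) = prod_list ns"
    "dim_col (kronecker_list Ps) = prod_list ns"
    using Cons by auto
  have "kronecker_list (P # Ps) $$ (I, J) =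
      (\<Prod>j<length (n # ns). (P # Ps) ! j $$ (dig (n # ns) j I, dig (n # ns) j J))"
    if "I < n * prod_list ns" "J < n * prod_list ns" for I J
  proof -
    have "0 < prod_list ns"
      using that by (metis gr0I mult_0_right not_less_zero)
    then show ?thesis
      using that Cons.IH unfolding K kronecker_def d
      by (simp add: prod.lessThan_Suc_shift del: prod.lessThan_Suc)
  qed
  then show ?case
    unfolding K by (simp add: kronecker_def d)
qed

lemma sum_lessThan_mult:
  fixes F :: "nat \<Rightarrow> 'a::comm_monoid_add"
  shows "(\<Sum>I<n * k. F I) = (\<Sum>x<n. \<Sum>y<k. F (x * k + y))"
proof -
  have "sum F {m * k..<m * k + k} = (\<Sum>y<k. F (m * k + y))" for m
    using sum.shift_bounds_nat_ivl[of F 0 "m * k" k] by (simp add: atLeast0LessThan add.commute)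
  then show ?thesis
    using sum.nat_group[of F k n] by simp
qed

text \<open>The digits of an index range independently over their bases, so the sum of products
  factors. For entries of Kronecker factors this is the multiplicativity of the trace; the general
  \<open>h\<close> covers identity factors as well.\<close>

lemma sum_prod_dig:
  fixes h :: "nat \<Rightarrow> nat \<Rightarrow> nat \<Rightarrow> complex"
  shows "(\<Sum>I<prod_list ns. \<Sum>J<prod_list ns. \<Prod>j<length ns. h j (dig ns j I) (dig ns j J)) =
    (\<Prod>j<length ns. \<Sum>x<ns ! j. \<Sum>y<ns ! j. h j x y)"
proof (induction ns arbitrary: h)
  case (Cons n ns)
  let ?N = "prod_list ns"
  let ?F = "\<lambda>I J. \<Prod>j<length ns. h (Suc j) (dig ns j I) (dig ns j J)"
  have dm: "(x * ?N + y) div ?N = x" "(x * ?N + y) mod ?N = y" if "y < ?N" for x y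
  proof -
    have "?N \<noteq> 0"
      using that by (metis not_less_zero)
    then show "(x * ?N + y) div ?N = x" "(x * ?N + y) mod ?N = y"
      using that by (simp_all del: prod_list_zero_iff)
  qed
  have "(\<Sum>I<n * ?N. \<Sum>J<n * ?N. h 0 (I div ?N) (J div ?N) * ?F (I mod ?N) (J mod ?N)) =
      (\<Sum>x<n. \<Sum>I<?N. \<Sum>y<n. \<Sum>J<?N. h 0 x y * ?F I J)"
    unfolding sum_lessThan_mult by (intro sum.cong refl) (simp add: dm)
  also have "\<dots> = (\<Sum>x<n. \<Sum>y<n. h 0 x y * (\<Sum>I<?N. \<Sum>J<?N. ?F I J))"
  proof (rule sum.cong[OF refl])
    show "(\<Sum>I<?N. \<Sum>y<n. \<Sum>J<?N. h 0 x y * ?F I J) =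
        (\<Sum>y<n. h 0 x y * (\<Sum>I<?N. \<Sum>J<?N. ?F I J))" for x
      by (subst sum.swap) (simp add: sum_distrib_left)
  qed
  also have "\<dots> = (\<Sum>x<n. \<Sum>y<n. h 0 x y) * (\<Prod>j<length ns. \<Sum>x<ns ! j. \<Sum>y<ns ! j. h (Suc j) x y)"
    by (simp add: Cons.IH[of "\<lambda>j. h (Suc j)"] sum_distrib_right)
  finally show ?case
    by (simp add: prod.lessThan_Suc_shift del: prod.lessThan_Suc)
qed simp

subsection \<open>Critical points and Hessian of the Rayleigh quotient\<close>

locale grassmann_tuple =
  fixes mn :: "(nat \<times> nat) list"
begin

abbreviation "r \<equiv> length mn"
abbreviation "m j \<equiv> fst (mn ! j)"
abbreviation "n j \<equiv> snd (mn ! j)"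
abbreviation "ns \<equiv> map snd mn"
abbreviation "N \<equiv> prod_list ns"
abbreviation "GrP \<equiv> Gr_prod mn"

text \<open>Row digits come from \<open>snd t\<close> and column digits from \<open>fst t\<close>,
  since the trace pairs \<open>A $$ (I, J)\<close> with the entry of the Kronecker product at
  \<open>(J, I)\<close>.\<close>

sublocale multilinear_form r "{..<N} \<times> {..<N}" "\<lambda>t j. dig ns j (snd t)" "\<lambda>t j. dig ns j (fst t)"
  by unfold_locales simp

definition coef :: "complex mat \<Rightarrow> nat \<times> nat \<Rightarrow> complex" where
  "coef A t = A $$ t"

text \<open>As a function on all naturals a tuple is determined by the list only below
  \<open>r\<close>. The congruence lemmas for \<open>D1\<close>, \<open>D2\<close> and
  \<open>hess\<close> bridge the differences that arise from passing back and forth.\<close>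

definition tup :: "complex mat list \<Rightarrow> nat \<Rightarrow> fmat" where
  "tup X j = emb (X ! j)"

definition untup :: "(nat \<Rightarrow> fmat) \<Rightarrow> complex mat list" where
  "untup x = map (\<lambda>j. to_mat (n j) (x j)) [0..<r]"

definition shaped :: "complex mat list \<Rightarrow> bool" where
  "shaped X \<longleftrightarrow> length X = r \<and> (\<forall>j<r. X ! j \<in> carrier_mat (n j) (n j))"

definition G :: "(nat \<Rightarrow> fmat) set" where
  "G = {p. \<forall>j<r. p j \<in> gr (m j) (n j)}"

definition T :: "(nat \<Rightarrow> fmat) \<Rightarrow> (nat \<Rightarrow> fmat) set" where
  "T p = {x. \<forall>j<r. x j \<in> tang (n j) (p j)}"

definition crit :: "(nat \<times> nat \<Rightarrow> complex) \<Rightarrow> (nat \<Rightarrow> fmat) \<Rightarrow> bool" where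
  "crit c p \<longleftrightarrow> p \<in> G \<and> (\<forall>x\<in>T p. D1 c p x = 0)"

definition null_dir :: "(nat \<times> nat \<Rightarrow> complex) \<Rightarrow> (nat \<Rightarrow> fmat) \<Rightarrow> (nat \<Rightarrow> fmat) \<Rightarrow> bool" where
  "null_dir c p w \<longleftrightarrow> w \<in> T p \<and> (\<exists>j<r. w j \<noteq> 0) \<and> (\<forall>x\<in>T p. hess c p w x = 0)"

lemma GD: "p \<in> G \<Longrightarrow> j < r \<Longrightarrow> p j \<in> gr (m j) (n j)"
  by (simp add: G_def)

lemma TD: "x \<in> T p \<Longrightarrow> j < r \<Longrightarrow> x j \<in> tang (n j) (p j)"
  by (simp add: T_def)

lemma Gr_prod_iff: "P \<in> GrP \<longleftrightarrow> shaped P \<and> tup P \<in> G"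
  by (auto simp: Gr_prod_def list_all2_conv_all_nth shaped_def G_def tup_def Gr_iff_gr case_prod_beta)

lemma shaped_untup: "shaped (untup x)"
  by (simp add: shaped_def untup_def)

lemma tup_untup: "j < r \<Longrightarrow> corner (n j) (x j) \<Longrightarrow> tup (untup x) j = x j"
  by (simp add: tup_def untup_def emb_to_mat)

lemma shaped_corner: "shaped X \<Longrightarrow> j < r \<Longrightarrow> corner (n j) (tup X j)"
  by (simp add: shaped_def tup_def corner_emb)

lemma untup_in_Gr_prod:
  assumes "p \<in> G"
  shows "untup p \<in> GrP"
  using assms grD(1)[OF GD[OF assms]] by (simp add: Gr_prod_iff shaped_untup G_def tup_untup)

lemma rayleigh_eq_phi:
  assumes "A \<in> carrier_mat N N" "P \<in> GrP"
  shows "rayleigh A P = phi (coef A) (tup P)"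
proof -
  have P: "shaped P"
    using assms by (simp add: Gr_prod_iff)
  then have "list_all2 (\<lambda>P n. P \<in> carrier_mat n n) P ns"
    by (auto simp: list_all2_conv_all_nth shaped_def)
  note K = kronecker_list_index[OF this]
  have "mat_trace (A * kronecker_list P) = (\<Sum>I<N. \<Sum>J<N. A $$ (I, J) * kronecker_list P $$ (J, I))"
    using assms(1) K by (auto simp: mat_trace_def scalar_prod_def atLeast0LessThan intro!: sum.cong)
  also have "\<dots> = (\<Sum>I<N. \<Sum>J<N. coef A (I, J) * mon (I, J) (tup P))"
  proof (intro sum.cong refl)
    fix I J assume IJ: "I \<in> {..<N}" "J \<in> {..<N}"
    have "(\<Prod>j<r. P ! j $$ (dig ns j J, dig ns j I)) = mon (I, J) (tup P)"
      unfolding mon_def tup_def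
    proof (intro prod.cong refl)
      fix j assume "j \<in> {..<r}"
      then have j: "j < r"
        by simp
      then have "dig ns j J < n j" "dig ns j I < n j"
        using dig_less[of j ns] IJ by auto
      then show "P ! j $$ (dig ns j J, dig ns j I) =
          ent (emb (P ! j)) (dig ns j (snd (I, J))) (dig ns j (fst (I, J)))"
        using P j by (simp add: shaped_def ent_emb[of _ "n j"])
    qed
    then show "A $$ (I, J) * kronecker_list P $$ (J, I) = coef A (I, J) * mon (I, J) (tup P)"
      using K IJ by (simp add: coef_def)
  qed
  finally show ?thesis
    by (simp add: rayleigh_def phi_def sum.cartesian_product)
qed

lemma shaped_iff:
  "shaped X \<longleftrightarrow> length X = r \<and> (\<forall>j<r. dim_row (X ! j) = n j \<and> dim_col (X ! j) = n j)"
  unfolding shaped_def by (metis carrier_matD carrier_matI)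

lemma same_shape_shaped: "shaped X \<Longrightarrow> same_shape X Y \<Longrightarrow> shaped Y"
  by (auto simp: shaped_iff same_shape_def list_all2_conv_all_nth)

lemma shaped_same_shape: "shaped X \<Longrightarrow> shaped Y \<Longrightarrow> same_shape X Y"
  by (auto simp: shaped_iff same_shape_def list_all2_conv_all_nth)

lemma has_velocity_iff:
  assumes "\<And>s. shaped (\<gamma> s)"
  shows "has_velocity \<gamma> \<xi> t \<longleftrightarrow>
    shaped \<xi> \<and> (\<forall>j<r. ((\<lambda>s. tup (\<gamma> s) j) has_vector_derivative tup \<xi> j) (at t))"
proof (intro iffI conjI allI impI)
  assume v: "has_velocity \<gamma> \<xi> t"
  show sh: "shaped \<xi>"
    using same_shape_shaped[OF assms] v by (auto simp: has_velocity_def)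
  fix j assume j: "j < r"
  show "((\<lambda>s. tup (\<gamma> s) j) has_vector_derivative tup \<xi> j) (at t)"
  proof (rule has_vector_derivative_fmat[OF shaped_corner[OF assms j] shaped_corner[OF sh j]])
    fix i k assume ik: "i < n j" "k < n j"
    have "((\<lambda>s. (\<gamma> s ! j) $$ (i, k)) has_vector_derivative (\<xi> ! j) $$ (i, k)) (at t)"
      using v sh j ik unfolding has_velocity_def shaped_def by auto
    moreover have "ent (tup X j) i k = X ! j $$ (i, k)" if "shaped X" for X
      using that j ik by (simp add: tup_def shaped_def ent_emb[of _ "n j"])
    ultimately show "((\<lambda>s. ent (tup (\<gamma> s) j) i k) has_vector_derivative ent (tup \<xi> j) i k) (at t)"
      using assms sh by simp
  qed
next
  assume R: "shaped \<xi> \<and> (\<forall>j<r. ((\<lambda>s. tup (\<gamma> s) j) has_vector_derivative tup \<xi> j) (at t))"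
  show "has_velocity \<gamma> \<xi> t"
    unfolding has_velocity_def
  proof (intro conjI allI impI)
    show "same_shape (\<gamma> s) \<xi>" for s
      using shaped_same_shape[OF assms] R by blast
    fix j i k assume "j < length \<xi>" "i < dim_row (\<xi> ! j)" "k < dim_col (\<xi> ! j)"
    then have jik: "j < r" "i < n j" "k < n j"
      using R by (auto simp: shaped_def)
    have "((\<lambda>s. ent (tup (\<gamma> s) j) i k) has_vector_derivative ent (tup \<xi> j) i k) (at t)"
      using R jik(1) bounded_linear.has_vector_derivative[OF bounded_linear_ent] by blast
    moreover have "ent (tup X j) i k = X ! j $$ (i, k)" if "shaped X" for X
      using that jik by (simp add: tup_def shaped_def ent_emb[of _ "n j"])
    ultimately show "((\<lambda>s. (\<gamma> s ! j) $$ (i, k)) has_vector_derivative (\<xi> ! j) $$ (i, k)) (at t)"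
      using assms R by simp
  qed
qed

lemma curve_derivatives:
  assumes "\<gamma> \<in> curves_through GrP P \<xi>"
  obtains g1 z where "\<And>j t. j < r \<Longrightarrow> ((\<lambda>s. tup (\<gamma> s) j) has_vector_derivative g1 t j) (at t)"
    "\<And>j. j < r \<Longrightarrow> ((\<lambda>s. g1 s j) has_vector_derivative z j) (at 0)"
    "\<And>j. j < r \<Longrightarrow> g1 0 j = tup \<xi> j" "\<And>j t. j < r \<Longrightarrow> corner (n j) (g1 t j)"
    "\<And>j. j < r \<Longrightarrow> corner (n j) (z j)" "shaped \<xi>" "\<And>t. \<gamma> t \<in> GrP" "\<gamma> 0 = P"
proof -
  from assms obtain D where D: "D 0 = \<gamma>" "\<And>k t. has_velocity (D k) (D (Suc k) t) t"
    and \<gamma>: "\<And>t. \<gamma> t \<in> GrP" "\<gamma> 0 = P" "has_velocity \<gamma> \<xi> 0"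
    by (auto simp: curves_through_def smooth_curve_def)
  have s0: "shaped (\<gamma> t)" for t
    using \<gamma>(1) by (simp add: Gr_prod_iff)
  have s1: "shaped (D (Suc 0) t)" and
    d1: "j < r \<Longrightarrow> ((\<lambda>s. tup (\<gamma> s) j) has_vector_derivative tup (D (Suc 0) t) j) (at t)" for t j
    using D(2)[of 0 t] has_velocity_iff[OF s0] by (auto simp: D(1))
  have s2: "shaped (D (Suc (Suc 0)) t)" and
    d2: "j < r \<Longrightarrow> ((\<lambda>s. tup (D (Suc 0) s) j) has_vector_derivative tup (D (Suc (Suc 0)) t) j) (at t)" for t j
    using D(2)[of "Suc 0" t] has_velocity_iff[OF s1] by auto
  have x: "shaped \<xi>" "j < r \<Longrightarrow> ((\<lambda>s. tup (\<gamma> s) j) has_vector_derivative tup \<xi> j) (at 0)" for j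
    using \<gamma>(3) has_velocity_iff[OF s0] by auto
  show ?thesis
  proof (rule that[of "\<lambda>t. tup (D (Suc 0) t)" "tup (D (Suc (Suc 0)) 0)"])
    show "tup (D (Suc 0) 0) j = tup \<xi> j" if "j < r" for j
      using vector_derivative_unique_at[OF d1[OF that] x(2)[OF that]] .
  qed (rule x(1) \<gamma>(1,2) | rule d1 d2 shaped_corner[OF s1] shaped_corner[OF s2], assumption)+
qed

text \<open>Differentiating the equations of the Grassmannian gives one inclusion. For the other,
  every solution of the linearized equations is the velocity of a tuple of the curves from
  \<open>gr_curve_exists\<close>.\<close>

lemma tangent_space_eq:
  assumes P: "P \<in> GrP"
  shows "\<xi> \<in> tangent_space GrP P \<longleftrightarrow> shaped \<xi> \<and> tup \<xi> \<in> T (tup P)"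
proof
  assume "\<xi> \<in> tangent_space GrP P"
  then obtain \<gamma> where "\<gamma> \<in> curves_through GrP P \<xi>"
    by (auto simp: tangent_space_def)
  then obtain g1 z where
    d: "\<And>j t. j < r \<Longrightarrow> ((\<lambda>s. tup (\<gamma> s) j) has_vector_derivative g1 t j) (at t)"
      "\<And>j. j < r \<Longrightarrow> ((\<lambda>s. g1 s j) has_vector_derivative z j) (at 0)"
    and g: "\<And>j. j < r \<Longrightarrow> g1 0 j = tup \<xi> j" "\<And>j t. j < r \<Longrightarrow> corner (n j) (g1 t j)"
      "\<And>j. j < r \<Longrightarrow> corner (n j) (z j)" "shaped \<xi>" "\<And>t. \<gamma> t \<in> GrP" "\<gamma> 0 = P"
    by (rule curve_derivatives) (rule that)
  have "tup \<xi> j \<in> tang (n j) (tup P j)" if j: "j < r" for j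
  proof -
    have "tup (\<gamma> s) j \<in> gr (m j) (n j)" for s
      using g(5) j by (simp add: Gr_prod_iff GD)
    from gr_velocity[OF this d(1)[OF j] g(2)[OF j]] show ?thesis
      using g(1)[OF j] g(6) by metis
  qed
  then show "shaped \<xi> \<and> tup \<xi> \<in> T (tup P)"
    using g(4) by (simp add: T_def)
next
  assume \<xi>: "shaped \<xi> \<and> tup \<xi> \<in> T (tup P)"
  have "\<exists>C. C 0 0 = tup P j \<and> C (Suc 0) 0 = tup \<xi> j \<and> (\<forall>t. C 0 t \<in> gr (m j) (n j)) \<and>
      (\<forall>k t. corner (n j) (C k t)) \<and> (\<forall>k t. (C k has_vector_derivative C (Suc k) t) (at t))"
    if "j < r" for j
  proof -
    have "tup P j \<in> gr (m j) (n j)" "tup \<xi> j \<in> tang (n j) (tup P j)"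
      using P \<xi> that by (auto simp: Gr_prod_iff GD TD)
    from gr_curve_exists[OF this] show ?thesis
      by metis
  qed
  then obtain C :: "nat \<Rightarrow> nat \<Rightarrow> real \<Rightarrow> fmat" where
    C: "\<And>j. j < r \<Longrightarrow> C j 0 0 = tup P j" "\<And>j. j < r \<Longrightarrow> C j (Suc 0) 0 = tup \<xi> j"
      "\<And>j t. j < r \<Longrightarrow> C j 0 t \<in> gr (m j) (n j)" "\<And>j k t. j < r \<Longrightarrow> corner (n j) (C j k t)"
      "\<And>j k t. j < r \<Longrightarrow> (C j k has_vector_derivative C j (Suc k) t) (at t)"
    by metis
  define D where "D k t = untup (\<lambda>j. C j k t)" for k t
  have tD: "tup (D k t) j = C j k t" if "j < r" for k t j
    using tup_untup[OF that, of "\<lambda>j. C j k t", OF C(4)[OF that]] by (simp add: D_def)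
  have sD: "shaped (D k t)" for k t
    by (simp add: D_def shaped_untup)
  have vel: "has_velocity (D k) (D (Suc k) t) t" for k t
    unfolding has_velocity_iff[OF sD] using C(5) by (simp add: sD tD)
  have eq: "X = Y" if "shaped X" "shaped Y" "\<And>j. j < r \<Longrightarrow> tup X j = tup Y j" for X Y
  proof (rule nth_equalityI)
    show "X ! j = Y ! j" if "j < length X" for j
      using \<open>shaped X\<close> \<open>shaped Y\<close> \<open>\<And>j. j < r \<Longrightarrow> tup X j = tup Y j\<close>[of j] that
        emb_inject[of "X ! j" "n j" "Y ! j"] by (simp add: shaped_def tup_def)
  qed (use that in \<open>simp add: shaped_def\<close>)
  have P0: "D 0 0 = P"
    using P by (intro eq) (simp_all add: sD tD C Gr_prod_iff)
  have "D (Suc 0) 0 = \<xi>"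
    using \<xi> by (intro eq) (simp_all add: sD tD C)
  with vel[of 0 0] have "has_velocity (D 0) \<xi> 0"
    by simp
  moreover have "smooth_curve (D 0)"
    unfolding smooth_curve_def using vel by blast
  moreover have "D 0 t \<in> GrP" for t
    using C(3) by (simp add: Gr_prod_iff sD G_def tD)
  ultimately have "D 0 \<in> curves_through GrP P \<xi>"
    using P0 by (auto simp: curves_through_def)
  then show "\<xi> \<in> tangent_space GrP P"
    by (auto simp: tangent_space_def)
qed

text \<open>The acceleration without its curvature part is tangent, so criticality removes it; this
  is why the second derivative depends on the velocity alone.\<close>

lemma rayleigh_curve_derivative:
  assumes A: "A \<in> carrier_mat N N" and \<gamma>: "\<gamma> \<in> curves_through GrP P \<xi>"
  shows "((\<lambda>t. rayleigh A (\<gamma> t)) has_real_derivative D1 (coef A) (tup P) (tup \<xi>)) (at 0)"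
    and "crit (coef A) (tup P) \<Longrightarrow>
      deriv (deriv (\<lambda>t. rayleigh A (\<gamma> t))) 0 = hess (coef A) (tup P) (tup \<xi>) (tup \<xi>)"
proof -
  obtain g1 z where
    d: "\<And>j t. j < r \<Longrightarrow> ((\<lambda>s. tup (\<gamma> s) j) has_vector_derivative g1 t j) (at t)"
      "\<And>j. j < r \<Longrightarrow> ((\<lambda>s. g1 s j) has_vector_derivative z j) (at 0)"
    and g: "\<And>j. j < r \<Longrightarrow> g1 0 j = tup \<xi> j" "\<And>j t. j < r \<Longrightarrow> corner (n j) (g1 t j)"
      "\<And>j. j < r \<Longrightarrow> corner (n j) (z j)" "shaped \<xi>" "\<And>t. \<gamma> t \<in> GrP" "\<gamma> 0 = P"
    using \<gamma> by (rule curve_derivatives) (rule that)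
  have f: "(\<lambda>t. rayleigh A (\<gamma> t)) = (\<lambda>t. phi (coef A) (tup (\<gamma> t)))"
    using rayleigh_eq_phi[OF A g(5)] by auto
  have 1: "((\<lambda>t. rayleigh A (\<gamma> t)) has_real_derivative D1 (coef A) (tup (\<gamma> t)) (g1 t)) (at t)" for t
    unfolding f by (rule phi_has_derivative[OF d(1)])
  have "D1 (coef A) (tup (\<gamma> 0)) (g1 0) = D1 (coef A) (tup P) (tup \<xi>)"
    by (rule D1_cong) (simp_all add: g)
  then show "((\<lambda>t. rayleigh A (\<gamma> t)) has_real_derivative D1 (coef A) (tup P) (tup \<xi>)) (at 0)"
    using 1[of 0] by simp
  assume crit: "crit (coef A) (tup P)"
  let ?c = "\<lambda>j. curv (tup P j) (tup \<xi> j) (tup \<xi> j)"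
  have "(\<lambda>j. z j - ?c j) \<in> T (tup P)"
    unfolding T_def
  proof (intro CollectI allI impI)
    fix j assume j: "j < r"
    have "tup (\<gamma> s) j \<in> gr (m j) (n j)" for s
      using g(5) j by (simp add: Gr_prod_iff GD)
    from gr_acceleration[OF this d(1)[OF j] d(2)[OF j] g(2)[OF j] g(3)[OF j]]
    show "z j - ?c j \<in> tang (n j) (tup P j)"
      by (simp add: g j)
  qed
  then have "D1 (coef A) (tup P) (\<lambda>j. z j - ?c j) = 0"
    using crit by (simp add: crit_def)
  then have zc: "D1 (coef A) (tup P) z = D1 (coef A) (tup P) ?c"
    by (simp add: D1_diff)
  have "deriv (\<lambda>t. rayleigh A (\<gamma> t)) = (\<lambda>t. D1 (coef A) (tup (\<gamma> t)) (g1 t))"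
    using DERIV_imp_deriv[OF 1] by auto
  moreover have "((\<lambda>t. D1 (coef A) (tup (\<gamma> t)) (g1 t)) has_real_derivative
      D2 (coef A) (tup (\<gamma> 0)) (g1 0) (g1 0) + D1 (coef A) (tup (\<gamma> 0)) z) (at 0)"
    by (rule D1_has_derivative[OF d(1) d(2)])
  moreover have "D2 (coef A) (tup (\<gamma> 0)) (g1 0) (g1 0) = D2 (coef A) (tup P) (tup \<xi>) (tup \<xi>)"
    by (rule D2_cong) (simp_all add: g)
  ultimately show "deriv (deriv (\<lambda>t. rayleigh A (\<gamma> t))) 0 = hess (coef A) (tup P) (tup \<xi>) (tup \<xi>)"
    using DERIV_imp_deriv by (simp add: hess_def g zc)
qed

lemma untup_tangent:
  assumes "P \<in> GrP" "x \<in> T (tup P)"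
  shows "untup x \<in> tangent_space GrP P" "\<And>j. j < r \<Longrightarrow> tup (untup x) j = x j"
proof -
  show t: "\<And>j. j < r \<Longrightarrow> tup (untup x) j = x j"
    using tangD(1)[OF TD[OF assms(2)]] by (simp add: tup_untup)
  then show "untup x \<in> tangent_space GrP P"
    using assms by (simp add: tangent_space_eq shaped_untup T_def)
qed

lemma critical_point_iff:
  assumes A: "A \<in> carrier_mat N N"
  shows "critical_point GrP (rayleigh A) P \<longleftrightarrow> P \<in> GrP \<and> crit (coef A) (tup P)"
proof (cases "P \<in> GrP")
  case P: True
  show ?thesis
  proof
    assume cp: "critical_point GrP (rayleigh A) P"
    have "D1 (coef A) (tup P) x = 0" if x: "x \<in> T (tup P)" for x
    proof -
      obtain \<gamma> where \<gamma>: "\<gamma> \<in> curves_through GrP P (untup x)"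
        using untup_tangent(1)[OF P x] by (auto simp: tangent_space_def)
      have "D1 (coef A) (tup P) (tup (untup x)) = 0"
        using DERIV_unique[OF rayleigh_curve_derivative(1)[OF A \<gamma>]] cp \<gamma>
        unfolding critical_point_def by blast
      then show ?thesis
        using D1_cong[of "tup P" "tup P" "tup (untup x)" x] untup_tangent(2)[OF P x] by simp
    qed
    then show "P \<in> GrP \<and> crit (coef A) (tup P)"
      using P by (simp add: crit_def Gr_prod_iff)
  next
    assume cr: "P \<in> GrP \<and> crit (coef A) (tup P)"
    have "((\<lambda>t. rayleigh A (\<gamma> t)) has_real_derivative 0) (at 0)"
      if \<gamma>: "\<gamma> \<in> curves_through GrP P \<xi>" for \<gamma> \<xi>
    proof -
      have "\<xi> \<in> tangent_space GrP P"
        using \<gamma> by (auto simp: tangent_space_def)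
      then have "D1 (coef A) (tup P) (tup \<xi>) = 0"
        using cr by (simp add: crit_def tangent_space_eq)
      then show ?thesis
        using rayleigh_curve_derivative(1)[OF A \<gamma>] by simp
    qed
    then show "critical_point GrP (rayleigh A) P"
      using P by (simp add: critical_point_def)
  qed
qed (simp add: critical_point_def)

text \<open>Tangency supplies at least one curve. Without it every number would satisfy the
  condition under the definite description.\<close>

lemma hessian_quad_eq:
  assumes A: "A \<in> carrier_mat N N" and "P \<in> GrP" "crit (coef A) (tup P)"
    and "\<xi> \<in> tangent_space GrP P"
  shows "hessian_quad GrP (rayleigh A) P \<xi> = hess (coef A) (tup P) (tup \<xi>) (tup \<xi>)"
  unfolding hessian_quad_def
proof (rule the_equality)
  show "\<forall>\<gamma>\<in>curves_through GrP P \<xi>. deriv (deriv (\<lambda>t. rayleigh A (\<gamma> t))) 0 =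
      hess (coef A) (tup P) (tup \<xi>) (tup \<xi>)"
    using rayleigh_curve_derivative(2)[OF A] assms(3) by blast
  obtain \<gamma> where "\<gamma> \<in> curves_through GrP P \<xi>"
    using assms(4) by (auto simp: tangent_space_def)
  then show "c = hess (coef A) (tup P) (tup \<xi>) (tup \<xi>)"
    if "\<forall>\<gamma>\<in>curves_through GrP P \<xi>. deriv (deriv (\<lambda>t. rayleigh A (\<gamma> t))) 0 = c" for c
    using that rayleigh_curve_derivative(2)[OF A] assms(3) by fastforce
qed

lemma T_plus: "x \<in> T p \<Longrightarrow> y \<in> T p \<Longrightarrow> (\<lambda>j. x j + y j) \<in> T p"
  by (simp add: T_def tang_plus)

lemma hessian_eq:
  assumes A: "A \<in> carrier_mat N N" and P: "P \<in> GrP" and cr: "crit (coef A) (tup P)"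
    and t: "\<xi> \<in> tangent_space GrP P" "\<eta> \<in> tangent_space GrP P"
  shows "hessian GrP (rayleigh A) P \<xi> \<eta> = hess (coef A) (tup P) (tup \<xi>) (tup \<eta>)"
proof -
  have sh: "shaped \<xi>" "shaped \<eta>" and T: "tup \<xi> \<in> T (tup P)" "tup \<eta> \<in> T (tup P)"
    using t by (auto simp: tangent_space_eq[OF P])
  let ?s = "map2 (+) \<xi> \<eta>"
  have s: "tup ?s j = tup \<xi> j + tup \<eta> j" if "j < r" for j
    using sh that by (simp add: tup_def shaped_def emb_add[of _ "n j"])
  have "?s \<in> tangent_space GrP P"
    unfolding tangent_space_eq[OF P] using sh T_plus[OF T] by (simp add: T_def s) (simp add: shaped_def)
  then have "hessian_quad GrP (rayleigh A) P ?s = hess (coef A) (tup P) (tup ?s) (tup ?s)"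
    by (rule hessian_quad_eq[OF A P cr])
  also have "\<dots> = hess (coef A) (tup P) (\<lambda>j. tup \<xi> j + tup \<eta> j) (\<lambda>j. tup \<xi> j + tup \<eta> j)"
    by (rule hess_cong) (simp_all add: s)
  also have "\<dots> = hess (coef A) (tup P) (tup \<xi>) (tup \<xi>) + hess (coef A) (tup P) (tup \<eta>) (tup \<eta>)
      + 2 * hess (coef A) (tup P) (tup \<xi>) (tup \<eta>)"
    using hess_commute[of "coef A" "tup P"]
    by (simp add: hess_add)
  finally show ?thesis
    by (simp add: hessian_def hessian_quad_eq[OF A P cr] t)
qed

text \<open>Eliminates curves, lists and carrier matrices: from here on degeneracy is an algebraic
  condition on the coefficients of a multilinear form.\<close>

lemma nondegenerate_iff:
  assumes A: "A \<in> carrier_mat N N"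
  shows "(\<forall>P. critical_point GrP (rayleigh A) P \<longrightarrow>
      nondegenerate_critical_point GrP (rayleigh A) P) \<longleftrightarrow>
    (\<forall>p w. crit (coef A) p \<longrightarrow> \<not> null_dir (coef A) p w)"
proof -
  have point: "nondegenerate_critical_point GrP (rayleigh A) P \<longleftrightarrow>
      (\<forall>w. \<not> null_dir (coef A) (tup P) w)"
    if P: "P \<in> GrP" and cr: "crit (coef A) (tup P)" for P
  proof -
    have zero: "(\<forall>X\<in>set \<xi>. X = 0\<^sub>m (dim_row X) (dim_col X)) \<longleftrightarrow> (\<forall>j<r. tup \<xi> j = 0)"
      if "shaped \<xi>" for \<xi>
    proof -
      have "\<xi> ! j = 0\<^sub>m (dim_row (\<xi> ! j)) (dim_col (\<xi> ! j)) \<longleftrightarrow> tup \<xi> j = 0" if "j < r" for j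
        using \<open>shaped \<xi>\<close> that emb_zero_iff[of "\<xi> ! j" "n j"]
        by (auto simp: shaped_def tup_def)
      then show ?thesis
        using that by (simp add: all_set_conv_all_nth shaped_def)
    qed
    have ker: "(\<forall>\<eta>\<in>tangent_space GrP P. hessian GrP (rayleigh A) P \<xi> \<eta> = 0) \<longleftrightarrow>
        (\<forall>x\<in>T (tup P). hess (coef A) (tup P) (tup \<xi>) x = 0)"
      if \<xi>: "\<xi> \<in> tangent_space GrP P" for \<xi>
    proof (intro iffI ballI)
      fix x assume L: "\<forall>\<eta>\<in>tangent_space GrP P. hessian GrP (rayleigh A) P \<xi> \<eta> = 0"
        and x: "x \<in> T (tup P)"
      then have "hess (coef A) (tup P) (tup \<xi>) (tup (untup x)) = 0"
        using hessian_eq[OF A P cr \<xi>] untup_tangent(1)[OF P x] by simp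
      then show "hess (coef A) (tup P) (tup \<xi>) x = 0"
        using hess_cong[of "tup P" "tup P" "tup \<xi>" "tup \<xi>" "tup (untup x)" x] untup_tangent(2)[OF P x]
        by simp
    next
      fix \<eta> assume "\<forall>x\<in>T (tup P). hess (coef A) (tup P) (tup \<xi>) x = 0"
        and "\<eta> \<in> tangent_space GrP P"
      then show "hessian GrP (rayleigh A) P \<xi> \<eta> = 0"
        using hessian_eq[OF A P cr \<xi>] tangent_space_eq[OF P] by simp
    qed
    have "nondegenerate_critical_point GrP (rayleigh A) P \<longleftrightarrow>
        (\<forall>\<xi>. shaped \<xi> \<and> tup \<xi> \<in> T (tup P) \<longrightarrow>
          (\<forall>x\<in>T (tup P). hess (coef A) (tup P) (tup \<xi>) x = 0) \<longrightarrow> (\<forall>j<r. tup \<xi> j = 0))"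
      unfolding nondegenerate_critical_point_def critical_point_iff[OF A]
      using P cr ker zero tangent_space_eq[OF P] by auto
    also have "\<dots> \<longleftrightarrow> (\<forall>w. \<not> null_dir (coef A) (tup P) w)"
    proof (intro iffI allI impI)
      fix w assume L: "\<forall>\<xi>. shaped \<xi> \<and> tup \<xi> \<in> T (tup P) \<longrightarrow>
          (\<forall>x\<in>T (tup P). hess (coef A) (tup P) (tup \<xi>) x = 0) \<longrightarrow> (\<forall>j<r. tup \<xi> j = 0)"
      show "\<not> null_dir (coef A) (tup P) w"
      proof
        assume w: "null_dir (coef A) (tup P) w"
        then have wT: "w \<in> T (tup P)"
          by (simp add: null_dir_def)
        note u = untup_tangent[OF P wT]
        have "hess (coef A) (tup P) (tup (untup w)) x = hess (coef A) (tup P) w x" for x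
          by (rule hess_cong) (simp_all add: u)
        then show False
          using L[rule_format, of "untup w"] w u by (auto simp: null_dir_def tangent_space_eq[OF P])
      qed
    qed (auto simp: null_dir_def)
    finally show ?thesis .
  qed
  show ?thesis
  proof (intro iffI allI impI)
    fix p w assume L: "\<forall>P. critical_point GrP (rayleigh A) P \<longrightarrow>
        nondegenerate_critical_point GrP (rayleigh A) P" and cr: "crit (coef A) p"
    then have p: "p \<in> G"
      by (simp add: crit_def)
    have eq: "j < r \<Longrightarrow> tup (untup p) j = p j" for j
      using grD(1)[OF GD[OF p]] by (simp add: tup_untup)
    have Teq: "T (tup (untup p)) = T p"
      by (simp add: T_def eq)
    have D1eq: "D1 (coef A) (tup (untup p)) x = D1 (coef A) p x" for x
      by (rule D1_cong) (simp_all add: eq)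
    have heq: "hess (coef A) (tup (untup p)) w x = hess (coef A) p w x" for w x
      by (rule hess_cong) (simp_all add: eq)
    have P: "untup p \<in> GrP"
      by (rule untup_in_Gr_prod[OF p])
    then have cr': "crit (coef A) (tup (untup p))"
      using cr by (simp add: crit_def Teq D1eq Gr_prod_iff)
    then have "\<not> null_dir (coef A) (tup (untup p)) w"
      using L P point[OF P cr'] critical_point_iff[OF A] by blast
    then show "\<not> null_dir (coef A) p w"
      by (simp add: null_dir_def Teq heq)
  next
    fix P assume "\<forall>p w. crit (coef A) p \<longrightarrow> \<not> null_dir (coef A) p w"
      and "critical_point GrP (rayleigh A) P"
    then show "nondegenerate_critical_point GrP (rayleigh A) P"
      using point critical_point_iff[OF A] by blast
  qed
qed

end

subsection \<open>Openness\<close>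

lemma finite_family_convergent_subseq:
  fixes f :: "nat \<Rightarrow> 'i \<Rightarrow> complex"
  assumes "finite I" "\<And>k i. i \<in> I \<Longrightarrow> cmod (f k i) \<le> B"
  shows "\<exists>\<rho> l. strict_mono \<rho> \<and> (\<forall>i\<in>I. (\<lambda>k. f (\<rho> k) i) \<longlonglongrightarrow> l i)"
  using assms
proof (induction I rule: finite_induct)
  case empty
  show ?case
    by (rule exI[of _ id]) (simp add: strict_mono_def)
next
  case (insert i I)
  then have "\<exists>\<rho> l. strict_mono \<rho> \<and> (\<forall>i\<in>I. (\<lambda>k. f (\<rho> k) i) \<longlonglongrightarrow> l i)"
    by simp
  then obtain \<rho> l where \<rho>: "strict_mono \<rho>" "\<forall>i\<in>I. (\<lambda>k. f (\<rho> k) i) \<longlonglongrightarrow> l i"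
    by blast
  have "bounded (range (\<lambda>k. f (\<rho> k) i))"
    using insert.prems by (auto simp: bounded_iff)
  then obtain a \<sigma> where \<sigma>: "strict_mono \<sigma>" "((\<lambda>k. f (\<rho> k) i) \<circ> \<sigma>) \<longlonglongrightarrow> a"
    using bounded_imp_convergent_subsequence by blast
  have "(\<lambda>k. f ((\<rho> \<circ> \<sigma>) k) j) \<longlonglongrightarrow> (l(i := a)) j" if "j \<in> insert i I" for j
    using \<sigma>(2) LIMSEQ_subseq_LIMSEQ[OF \<rho>(2)[rule_format] \<sigma>(1)] that by (auto simp: o_def)
  then show ?case
    using strict_mono_o[OF \<rho>(1) \<sigma>(1)] by blast
qed

context grassmann_tuple
begin

lemma tuple_convergent_subseq:
  fixes y :: "nat \<Rightarrow> nat \<Rightarrow> fmat"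
  assumes "\<And>k j. j < r \<Longrightarrow> corner (n j) (y k j)" "\<And>k j. j < r \<Longrightarrow> norm (y k j) \<le> B"
  obtains \<rho> l where "strict_mono \<rho>" "\<And>j. j < r \<Longrightarrow> corner (n j) (l j)"
    "\<And>j. j < r \<Longrightarrow> (\<lambda>k. y (\<rho> k) j) \<longlonglongrightarrow> l j"
proof -
  let ?I = "SIGMA j:{..<r}. {..<n j} \<times> {..<n j}"
  let ?f = "\<lambda>k (j, a, b). ent (y k j) a b"
  have "\<exists>\<rho> l. strict_mono \<rho> \<and> (\<forall>i\<in>?I. (\<lambda>k. ?f (\<rho> k) i) \<longlonglongrightarrow> l i)"
    by (rule finite_family_convergent_subseq[where f = ?f and B = B])
      (auto intro: order_trans[OF norm_ent_le assms(2)])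
  then obtain \<rho> L where \<rho>: "strict_mono \<rho>"
    and L: "\<And>j a b. j < r \<Longrightarrow> a < n j \<Longrightarrow> b < n j \<Longrightarrow> (\<lambda>k. ent (y (\<rho> k) j) a b) \<longlonglongrightarrow> L (j, a, b)"
    by fastforce
  define l where "l j = (\<Sum>a<n j. \<Sum>b<n j. munit a b (L (j, a, b)))" for j
  have lc: "corner (n j) (l j)" for j
    unfolding l_def by (intro corner_sum corner_munit) auto
  have "(\<lambda>k. y (\<rho> k) j) \<longlonglongrightarrow> l j" if "j < r" for j
  proof (rule tendsto_fmat[OF assms(1)[OF that] lc])
    fix a b assume "a < n j" "b < n j"
    then show "(\<lambda>k. ent (y (\<rho> k) j) a b) \<longlonglongrightarrow> ent (l j) a b"
      using L[OF that] by (simp add: l_def munit.rep_eq sum_two_delta)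
  qed
  with \<rho> lc show ?thesis
    using that by blast
qed

text \<open>A norm bound for all components of points of \<open>G\<close>. It is at least one so
  that a power with exponent \<open>card J\<close> may be enlarged to one with exponent
  \<open>r\<close>.\<close>

definition K :: real where
  "K = 1 + (\<Sum>j<r. real (n j) * real (m j))"

lemma K_ge_1: "1 \<le> K"
  by (simp add: K_def sum_nonneg)

lemma norm_G_le:
  assumes "p \<in> G" "j < r"
  shows "norm (p j) \<le> K"
proof -
  have "norm (p j) \<le> real (n j) * real (m j)"
    by (rule norm_gr_le[OF GD[OF assms]])
  also have "\<dots> \<le> (\<Sum>j<r. real (n j) * real (m j))"
    by (rule member_le_sum) (use assms in auto)
  finally show ?thesis
    by (simp add: K_def)
qed

lemma T_scaleR: "x \<in> T p \<Longrightarrow> (\<lambda>j. s *\<^sub>R x j) \<in> T p"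
  by (simp add: T_def tang_scaleR)

lemma null_dir_scaleR: "null_dir c p w \<Longrightarrow> s \<noteq> 0 \<Longrightarrow> null_dir c p (\<lambda>j. s *\<^sub>R w j)"
  by (auto simp: null_dir_def T_scaleR hess_scaleR_left)

lemma T_tproj:
  assumes "p \<in> G" "\<And>j. j < r \<Longrightarrow> corner (n j) (x j)" "\<And>j. j < r \<Longrightarrow> adj (x j) = x j"
  shows "(\<lambda>j. tproj (p j) (x j)) \<in> T p"
  using assms by (auto simp: T_def intro!: tproj_tang[OF GD])

text \<open>Degenerate coefficients form a closed set: critical points and normalized null vectors
  stay in a compact set, and all the defining equations pass to the limit along a
  subsequence.\<close>

lemma degenerate_limit:
  assumes c: "\<And>t. t \<in> {..<N} \<times> {..<N} \<Longrightarrow> (\<lambda>k. c k t) \<longlonglongrightarrow> c' t"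
    and cr: "\<And>k. crit (c k) (p k)" and nd: "\<And>k. null_dir (c k) (p k) (v k)"
  shows "\<exists>p w. crit c' p \<and> null_dir c' p w"
proof -
  \<comment> \<open>Normalizing by the sum of the norms keeps the limit of the null vectors away
    from zero.\<close>
  define s where "s k = (\<Sum>j<r. norm (v k j))" for k
  define w where "w k j = (1 / s k) *\<^sub>R v k j" for k j
  have s: "s k > 0" for k
  proof -
    obtain j where "j < r" "v k j \<noteq> 0"
      using nd[of k] by (auto simp: null_dir_def)
    then show ?thesis
      unfolding s_def by (intro sum_pos2[of _ j]) auto
  qed
  have w: "null_dir (c k) (p k) (w k)" for k
    unfolding w_def using null_dir_scaleR[OF nd] s[of k] by simp
  have sum1: "(\<Sum>j<r. norm (w k j)) = 1" for k
    using s[of k] by (simp add: w_def s_def flip: sum_divide_distrib)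
  have pG: "p k \<in> G" for k
    using cr by (simp add: crit_def)
  have wT: "w k \<in> T (p k)" for k
    using w by (simp add: null_dir_def)
  obtain \<rho> q where \<rho>: "strict_mono \<rho>" and qc: "\<And>j. j < r \<Longrightarrow> corner (n j) (q j)"
    and q0: "\<And>j. j < r \<Longrightarrow> (\<lambda>k. p (\<rho> k) j) \<longlonglongrightarrow> q j"
    using tuple_convergent_subseq[of p K] grD(1)[OF GD[OF pG]] norm_G_le[OF pG] by blast
  have "norm (w k j) \<le> 1" if "j < r" for k j
    using member_le_sum[of j "{..<r}" "\<lambda>j. norm (w k j)"] that sum1[of k] by simp
  note w1 = this
  obtain \<sigma> z where \<sigma>: "strict_mono \<sigma>" and zc: "\<And>j. j < r \<Longrightarrow> corner (n j) (z j)"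
    and z: "\<And>j. j < r \<Longrightarrow> (\<lambda>k. w (\<rho> (\<sigma> k)) j) \<longlonglongrightarrow> z j"
    by (rule tuple_convergent_subseq[of "\<lambda>k. w (\<rho> k)" 1, OF tangD(1)[OF TD[OF wT]] w1]) (assumption | rule that)+
  define \<tau> where "\<tau> = \<rho> \<circ> \<sigma>"
  have \<tau>: "strict_mono \<tau>"
    unfolding \<tau>_def by (rule strict_mono_o[OF \<rho> \<sigma>])
  have q: "(\<lambda>k. p (\<tau> k) j) \<longlonglongrightarrow> q j" if "j < r" for j
    using LIMSEQ_subseq_LIMSEQ[OF q0[OF that] \<sigma>] by (simp add: \<tau>_def o_def)
  have z: "(\<lambda>k. w (\<tau> k) j) \<longlonglongrightarrow> z j" if "j < r" for j
    using z[OF that] by (simp add: \<tau>_def)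
  have c: "(\<lambda>k. c (\<tau> k) t) \<longlonglongrightarrow> c' t" if "t \<in> {..<N} \<times> {..<N}" for t
    using LIMSEQ_subseq_LIMSEQ[OF c[OF that] \<tau>] by (simp add: o_def)
  have adj_lim: "adj l = l" if "f \<longlonglongrightarrow> l" "\<And>k. adj (f k) = f k" for f :: "nat \<Rightarrow> fmat" and l
    using LIMSEQ_unique[OF bounded_linear.tendsto[OF bounded_linear_adj that(1)]] that by simp
  have qG: "q \<in> G"
    unfolding G_def gr_def
  proof (intro CollectI allI impI conjI)
    fix j assume j: "j < r"
    note P = grD[OF GD[OF pG j]] and lim = q[OF j]
    show "corner (n j) (q j)"
      by (rule qc[OF j])
    show "adj (q j) = q j"
      by (rule adj_lim[OF lim P(2)])
    show "q j * q j = q j"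
      using LIMSEQ_unique[OF tendsto_mult[OF lim lim]] lim by (simp add: P)
    show "tr (q j) = of_nat (m j)"
      using LIMSEQ_unique[OF bounded_linear.tendsto[OF bounded_linear_tr lim]] by (simp add: P)
  qed
  have zT: "z \<in> T q"
    unfolding T_def tang_def
  proof (intro CollectI allI impI conjI)
    fix j assume j: "j < r"
    note W = TD[OF wT j]
    show "corner (n j) (z j)"
      by (rule zc[OF j])
    show "adj (z j) = z j"
      by (rule adj_lim[OF z[OF j] tangD(2)[OF W]])
    have "(\<lambda>k. p (\<tau> k) j * w (\<tau> k) j + w (\<tau> k) j * p (\<tau> k) j) \<longlonglongrightarrow> q j * z j + z j * q j"
      by (intro tendsto_add tendsto_mult q z j)
    then show "q j * z j + z j * q j = z j"
      using LIMSEQ_unique z[OF j] W by (simp add: tang_def)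
  qed
  have "(\<lambda>k. \<Sum>j<r. norm (w (\<tau> k) j)) \<longlonglongrightarrow> (\<Sum>j<r. norm (z j))"
    by (intro tendsto_sum tendsto_norm z) simp
  then have "(\<Sum>j<r. norm (z j)) = 1"
    by (simp add: sum1 LIMSEQ_const_iff)
  then have nz: "\<exists>j<r. z j \<noteq> 0"
    by (metis (no_types, lifting) lessThan_iff norm_zero sum.neutral zero_neq_one)
  \<comment> \<open>The tangent spaces move with the critical point. A test vector at the limit is
    therefore approximated by its projections to the moving spaces, which converge to it because
    \<open>tproj\<close> fixes tangent vectors.\<close>
  have approx: "\<exists>y. (\<forall>k. y k \<in> T (p (\<tau> k))) \<and> (\<forall>j<r. (\<lambda>k. y k j) \<longlonglongrightarrow> x j)" if x: "x \<in> T q" for x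
  proof (intro exI conjI allI impI)
    show "(\<lambda>j. tproj (p (\<tau> k) j) (x j)) \<in> T (p (\<tau> k))" for k
      using tangD[OF TD[OF x]] by (intro T_tproj pG) auto
    fix j assume j: "j < r"
    have "(\<lambda>k. tproj (p (\<tau> k) j) (x j)) \<longlonglongrightarrow> tproj (q j) (x j)"
      unfolding tproj_def by (intro tendsto_intros q j)
    then show "(\<lambda>k. tproj (p (\<tau> k) j) (x j)) \<longlonglongrightarrow> x j"
      using tproj_id[OF grD(3)[OF GD[OF qG j]] TD[OF x j]] by simp
  qed
  have "D1 c' q x = 0" if xT: "x \<in> T q" for x
  proof -
    obtain y where y: "\<And>k. y k \<in> T (p (\<tau> k))" "\<And>j. j < r \<Longrightarrow> (\<lambda>k. y k j) \<longlonglongrightarrow> x j"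
      using approx[OF xT] by blast
    have "(\<lambda>k. D1 (c (\<tau> k)) (p (\<tau> k)) (y k)) \<longlonglongrightarrow> D1 c' q x"
      by (rule tendsto_D1[OF c q y(2)])
    moreover have "D1 (c (\<tau> k)) (p (\<tau> k)) (y k) = 0" for k
      using cr y(1) by (simp add: crit_def)
    ultimately show ?thesis
      by (simp add: LIMSEQ_const_iff)
  qed
  then have "crit c' q"
    using qG by (simp add: crit_def)
  have "hess c' q z x = 0" if xT: "x \<in> T q" for x
  proof -
    obtain y where y: "\<And>k. y k \<in> T (p (\<tau> k))" "\<And>j. j < r \<Longrightarrow> (\<lambda>k. y k j) \<longlonglongrightarrow> x j"
      using approx[OF xT] by blast
    have "(\<lambda>k. hess (c (\<tau> k)) (p (\<tau> k)) (w (\<tau> k)) (y k)) \<longlonglongrightarrow> hess c' q z x"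
      by (rule tendsto_hess[OF c q z y(2)])
    moreover have "hess (c (\<tau> k)) (p (\<tau> k)) (w (\<tau> k)) (y k) = 0" for k
      using w y(1) by (simp add: null_dir_def)
    ultimately show ?thesis
      by (simp add: LIMSEQ_const_iff)
  qed
  then have "null_dir c' q z"
    using zT nz by (simp add: null_dir_def)
  with \<open>crit c' q\<close> show ?thesis
    by blast
qed

definition morse_set :: "complex mat set" where
  "morse_set = {A \<in> her N. \<forall>p w. crit (coef A) p \<longrightarrow> \<not> null_dir (coef A) p w}"

lemma openin_morse_set: "openin (her_topology N) morse_set"
proof -
  interpret her: Metric_space "her N" "frobenius_dist N"
    by (rule Metric_space_her)
  have "\<exists>\<epsilon>>0. her.mball A \<epsilon> \<subseteq> morse_set" if A: "A \<in> morse_set" for A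
  proof (rule ccontr)
    assume neg: "\<not> (\<exists>\<epsilon>>0. her.mball A \<epsilon> \<subseteq> morse_set)"
    have "\<exists>B p w. B \<in> her.mball A (1 / real (Suc k)) \<and> crit (coef B) p \<and> null_dir (coef B) p w" for k
    proof -
      have "\<not> her.mball A (1 / real (Suc k)) \<subseteq> morse_set"
        using neg by auto
      then show ?thesis
        by (fastforce simp: morse_set_def)
    qed
    then obtain B p w where B: "\<And>k. B k \<in> her.mball A (1 / real (Suc k))"
      and deg: "\<And>k. crit (coef (B k)) (p k)" "\<And>k. null_dir (coef (B k)) (p k) (w k)"
      by metis
    have "(\<lambda>k. coef (B k) t) \<longlonglongrightarrow> coef A t" if t: "t \<in> {..<N} \<times> {..<N}" for t
    proof (rule LIMSEQ_norm_0[THEN LIM_zero_cancel])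
      fix k
      have "cmod (A $$ t - B k $$ t) \<le> frobenius_dist N A (B k)"
        unfolding frobenius_dist_def using t by (intro member_le_L2_set) auto
      also have "\<dots> < 1 / real (Suc k)"
        using B[of k] by simp
      finally show "cmod (coef (B k) t - coef A t) < 1 / real (Suc k)"
        by (simp add: coef_def norm_minus_commute)
    qed
    from degenerate_limit[of "\<lambda>k. coef (B k)", OF this deg] show False
      using A by (auto simp: morse_set_def)
  qed
  moreover have "morse_set \<subseteq> her N"
    by (auto simp: morse_set_def)
  ultimately show ?thesis
    unfolding her_topology_def her.openin_mtopology by blast
qed

end

subsection \<open>Real coordinates on Hermitian matrices\<close>

text \<open>The real and imaginary parts of a Hermitian matrix are symmetric and antisymmetric, so
  their sum is an arbitrary real matrix, and this identification is isometric.\<close>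

definition coord :: "fmat \<Rightarrow> nat \<Rightarrow> nat \<Rightarrow> real" where
  "coord y a b = Re (ent y a b) + Im (ent y a b)"

definition herm :: "nat \<Rightarrow> (nat \<Rightarrow> nat \<Rightarrow> real) \<Rightarrow> fmat" where
  "herm n g = (\<Sum>a<n. \<Sum>b<n. munit a b (Complex ((g a b + g b a) / 2) ((g a b - g b a) / 2)))"

lemma ent_herm:
  "a < n \<Longrightarrow> b < n \<Longrightarrow> ent (herm n g) a b = Complex ((g a b + g b a) / 2) ((g a b - g b a) / 2)"
  by (simp add: herm_def munit.rep_eq sum_two_delta)

lemma corner_herm: "corner n (herm n g)"
  unfolding herm_def by (intro corner_sum corner_munit) auto

lemma adj_herm: "adj (herm n g) = herm n g"
proof (rule fmat_eqI)
  fix a b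
  show "ent (adj (herm n g)) a b = ent (herm n g) a b"
    using cornerD[OF corner_herm, of n a b g] cornerD[OF corner_herm, of n b a g]
    by (cases "a < n \<and> b < n") (auto simp: ent_herm complex_eq_iff field_simps)
qed

lemma coord_herm: "a < n \<Longrightarrow> b < n \<Longrightarrow> coord (herm n g) a b = g a b"
  by (simp add: coord_def ent_herm field_simps)

lemma coord_simps:
  "coord (x + y) a b = coord x a b + coord y a b" "coord (x - y) a b = coord x a b - coord y a b"
  "coord (c *\<^sub>R x) a b = c * coord x a b"
  by (simp_all add: coord_def algebra_simps)

lemma abs_coord_le: "\<bar>coord y a b\<bar> \<le> 2 * norm y"
  using abs_Re_le_cmod[of "ent y a b"] abs_Im_le_cmod[of "ent y a b"] norm_ent_le[of y a b]
  unfolding coord_def by linarith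

lemma adj_eq_ent:
  assumes "adj y = y"
  shows "Re (ent y b a) = Re (ent y a b) \<and> Im (ent y b a) = - Im (ent y a b)"
proof -
  have "ent (adj y) b a = cnj (ent y a b)"
    by simp
  then show ?thesis
    unfolding assms by simp
qed

lemma norm_le_coord:
  assumes "corner n y" "adj y = y" "\<And>a b. a < n \<Longrightarrow> b < n \<Longrightarrow> \<bar>coord y a b\<bar> \<le> \<delta>"
  shows "norm y \<le> real n * (real n * (2 * \<delta>))"
proof (rule norm_le_ent[OF assms(1)])
  fix a b assume "a < n" "b < n"
  then have "\<bar>coord y a b\<bar> \<le> \<delta>" "\<bar>coord y b a\<bar> \<le> \<delta>"
    using assms(3) by auto
  then have "\<bar>Re (ent y a b)\<bar> \<le> \<delta>" "\<bar>Im (ent y a b)\<bar> \<le> \<delta>"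
    using adj_eq_ent[OF assms(2), of b a] unfolding coord_def by linarith+
  then show "cmod (ent y a b) \<le> 2 * \<delta>"
    using cmod_le[of "ent y a b"] by linarith
qed

text \<open>Beyond the wanted pairing, the product of coordinates contains real times imaginary
  parts; these are antisymmetric in the two indices and cancel in the double sum.\<close>

lemma ip_coord:
  assumes "corner n x" "corner n y" "adj x = x" "adj y = y"
  shows "ip x y = (\<Sum>a<n. \<Sum>b<n. coord x a b * coord y a b)"
proof -
  let ?f = "\<lambda>a b. Re (ent x a b) * Im (ent y a b) + Im (ent x a b) * Re (ent y a b)"
  have "(\<Sum>a<n. \<Sum>b<n. ?f a b) = (\<Sum>a<n. \<Sum>b<n. ?f b a)"
    by (rule sum.swap)
  also have "\<dots> = - (\<Sum>a<n. \<Sum>b<n. ?f a b)"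
    unfolding sum_negf[symmetric]
  proof (intro sum.cong refl)
    show "?f b a = - ?f a b" for a b
      using adj_eq_ent[OF assms(3), of b a] adj_eq_ent[OF assms(4), of b a] by simp
  qed
  finally have "(\<Sum>a<n. \<Sum>b<n. ?f a b) = 0"
    by simp
  moreover have "ip x y = (\<Sum>a<n. \<Sum>b<n. coord x a b * coord y a b - ?f a b)"
    unfolding ip_def tr_mult_corner[OF assms(1,2)] Re_sum coord_def
  proof (intro sum.cong refl)
    show "Re (ent x a b * ent y b a) = (Re (ent x a b) + Im (ent x a b)) * (Re (ent y a b) + Im (ent y a b)) - ?f a b"
      for a b
      using adj_eq_ent[OF assms(4), of b a] by (simp add: algebra_simps)
  qed
  ultimately show ?thesis
    by (simp add: sum_subtractf)
qed

section \<open>Real coordinates on tuples\<close>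

context grassmann_tuple
begin

definition sip :: "(nat \<Rightarrow> fmat) \<Rightarrow> (nat \<Rightarrow> fmat) \<Rightarrow> real" where
  "sip x y = (\<Sum>j<r. ip (x j) (y j))"

lemma sip_simps:
  "sip (\<lambda>j. x j + y j) z = sip x z + sip y z" "sip z (\<lambda>j. x j + y j) = sip z x + sip z y"
  "sip (\<lambda>j. x j - y j) z = sip x z - sip y z" "sip z (\<lambda>j. x j - y j) = sip z x - sip z y"
  by (simp_all add: sip_def ip_simps sum.distrib sum_subtractf)

lemma sip_commute: "sip x y = sip y x"
  by (simp add: sip_def ip_commute)

lemma abs_sip_le:
  assumes "\<And>j. j < r \<Longrightarrow> norm (x j) \<le> a" "\<And>j. j < r \<Longrightarrow> norm (y j) \<le> b"
  shows "\<bar>sip x y\<bar> \<le> real r * (a * b)"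
proof -
  have "\<bar>sip x y\<bar> \<le> (\<Sum>j<r. a * b)"
    unfolding sip_def
  proof (intro order_trans[OF sum_abs] sum_mono)
    fix j assume "j \<in> {..<r}"
    then have "norm (x j) \<le> a" "norm (y j) \<le> b"
      using assms by auto
    then show "\<bar>ip (x j) (y j)\<bar> \<le> a * b"
      using ip_le[of "x j" "y j"] mult_mono[of "norm (x j)" a "norm (y j)" b]
      by (smt (verit) norm_ge_zero)
  qed
  then show ?thesis
    by simp
qed

definition I :: "(nat \<times> nat \<times> nat) set" where
  "I = (SIGMA j:{..<r}. {..<n j} \<times> {..<n j})"

definition tcoord :: "(nat \<Rightarrow> fmat) \<Rightarrow> nat \<times> nat \<times> nat \<Rightarrow> real" where
  "tcoord y = (\<lambda>(j, a, b). coord (y j) a b)"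

definition therm :: "(nat \<times> nat \<times> nat \<Rightarrow> real) \<Rightarrow> nat \<Rightarrow> fmat" where
  "therm g j = herm (n j) (\<lambda>a b. g (j, a, b))"

lemma finite_I: "finite I"
  by (simp add: I_def)

lemma tcoord_therm: "i \<in> I \<Longrightarrow> tcoord (therm g) i = g i"
  by (auto simp: I_def tcoord_def therm_def coord_herm)

lemma tcoord_diff: "tcoord (\<lambda>j. x j - y j) i = tcoord x i - tcoord y i"
  by (auto simp: tcoord_def coord_simps split: prod.split)

lemma sum_tcoord:
  assumes "\<And>j. j < r \<Longrightarrow> corner (n j) (x j)" "\<And>j. j < r \<Longrightarrow> adj (x j) = x j"
    and "\<And>j. j < r \<Longrightarrow> corner (n j) (y j)" "\<And>j. j < r \<Longrightarrow> adj (y j) = y j"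
  shows "(\<Sum>i\<in>I. tcoord x i * tcoord y i) = sip x y"
proof -
  have "(\<Sum>i\<in>I. tcoord x i * tcoord y i) =
      (\<Sum>j<r. \<Sum>(a, b)\<in>{..<n j} \<times> {..<n j}. coord (x j) a b * coord (y j) a b)"
    unfolding I_def by (subst sum.Sigma) (auto simp: tcoord_def intro!: sum.cong)
  also have "\<dots> = sip x y"
    unfolding sip_def
  proof (intro sum.cong refl)
    fix j assume "j \<in> {..<r}"
    then have j: "j < r"
      by simp
    show "(\<Sum>(a, b)\<in>{..<n j} \<times> {..<n j}. coord (x j) a b * coord (y j) a b) = ip (x j) (y j)"
      unfolding ip_coord[OF assms(1)[OF j] assms(3)[OF j] assms(2)[OF j] assms(4)[OF j]]
      by (rule sum.cartesian_product[symmetric])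
  qed
  finally show ?thesis .
qed

text \<open>A common bound for the sizes \<open>n j\<close>; the summand \<open>1\<close> makes it
  positive, as it later occurs in a denominator.\<close>

definition L :: real where
  "L = 1 + (\<Sum>j<r. real (n j))"

lemma n_le_L: "j < r \<Longrightarrow> real (n j) \<le> L"
  using member_le_sum[of j "{..<r}" "\<lambda>j. real (n j)"] by (simp add: L_def)

lemma norm_le_tcoord:
  assumes "j < r" "corner (n j) (y j)" "adj (y j) = y j"
    and "\<And>i. i \<in> I \<Longrightarrow> \<bar>tcoord y i\<bar> \<le> \<delta>" "0 \<le> \<delta>"
  shows "norm (y j) \<le> L * (L * (2 * \<delta>))"
proof -
  have "norm (y j) \<le> real (n j) * (real (n j) * (2 * \<delta>))"
  proof (rule norm_le_coord[OF assms(2,3)])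
    show "\<bar>coord (y j) a b\<bar> \<le> \<delta>" if "a < n j" "b < n j" for a b
      using assms(4)[of "(j, a, b)"] assms(1) that by (simp add: I_def tcoord_def)
  qed
  also have "\<dots> \<le> L * (L * (2 * \<delta>))"
    using n_le_L[OF assms(1)] assms(5) by (intro mult_mono) auto
  finally show ?thesis .
qed

subsection \<open>Linear perturbations\<close>

text \<open>The coefficients of the sum over \<open>l\<close> of the matrices \<open>1 \<otimes> \<dots> \<otimes> H l \<otimes> \<dots> \<otimes> 1\<close>, scaled such that
  they perturb the Rayleigh quotient by \<open>sip H\<close>.\<close>

definition \<mu> :: "nat \<Rightarrow> real" where
  "\<mu> l = (\<Prod>k\<in>{..<r} - {l}. real (m k))"

definition pert :: "(nat \<Rightarrow> fmat) \<Rightarrow> nat \<times> nat \<Rightarrow> complex" where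
  "pert H = (\<lambda>(i, k). \<Sum>l<r. (1 / \<mu> l) *\<^sub>R (ent (H l) (dig ns l i) (dig ns l k) *
    (\<Prod>j\<in>{..<r} - {l}. if dig ns j i = dig ns j k then 1 else 0)))"

abbreviation shift :: "(nat \<times> nat \<Rightarrow> complex) \<Rightarrow> (nat \<Rightarrow> fmat) \<Rightarrow> nat \<times> nat \<Rightarrow> complex" where
  "shift c H \<equiv> (\<lambda>t. c t + pert H t)"

text \<open>For each \<open>l\<close> the perturbing matrix is a Kronecker product with identities
  in all other places, so its trace pairing splits into the traces of the single slots.\<close>

lemma phi_pert:
  assumes H: "\<And>j. j < r \<Longrightarrow> corner (n j) (H j)" and y: "\<And>j. j < r \<Longrightarrow> corner (n j) (y j)"
  shows "phi (pert H) y = (\<Sum>l<r. Re (tr (H l * y l) * (\<Prod>k\<in>{..<r} - {l}. tr (y k))) / \<mu> l)"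
proof -
  let ?h = "\<lambda>l j a b. (if j = l then ent (H j) a b else if a = b then 1 else 0) * ent (y j) b a"
  have summand: "pert H (i, k) * mon (i, k) y =
      (\<Sum>l<r. (1 / \<mu> l) *\<^sub>R (\<Prod>j<r. ?h l j (dig ns j i) (dig ns j k)))" for i k
  proof -
    have "ent (H l) (dig ns l i) (dig ns l k) *
        (\<Prod>j\<in>{..<r} - {l}. if dig ns j i = dig ns j k then 1 else 0) * mon (i, k) y =
      (\<Prod>j<r. ?h l j (dig ns j i) (dig ns j k))" if "l < r" for l
    proof -
      have "(\<Prod>j<r. if j = l then ent (H j) (dig ns j i) (dig ns j k)
            else if dig ns j i = dig ns j k then 1 else 0) =
          ent (H l) (dig ns l i) (dig ns l k) *
          (\<Prod>j\<in>{..<r} - {l}. if dig ns j i = dig ns j k then 1 else 0)"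
        using that by (subst prod.remove[of _ l]) (auto intro!: prod.cong)
      then show ?thesis
        by (simp add: mon_def prod.distrib)
    qed
    then show ?thesis
      by (simp add: pert_def sum_distrib_right)
  qed
  have sums: "(\<Sum>i<N. \<Sum>k<N. \<Prod>j<r. ?h l j (dig ns j i) (dig ns j k)) =
      tr (H l * y l) * (\<Prod>k\<in>{..<r} - {l}. tr (y k))" if l: "l < r" for l
  proof -
    have "(\<Sum>i<N. \<Sum>k<N. \<Prod>j<r. ?h l j (dig ns j i) (dig ns j k)) =
        (\<Prod>j<r. \<Sum>a<n j. \<Sum>b<n j. ?h l j a b)"
      using sum_prod_dig[where ns = ns and h = "?h l"] by simp
    also have "\<dots> = (\<Prod>j<r. if j = l then tr (H l * y l) else tr (y j))"
    proof (intro prod.cong refl)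
      fix j assume "j \<in> {..<r}"
      then have j: "j < r"
        by simp
      have "(\<Sum>a<n j. \<Sum>b<n j. (if a = b then 1 else 0) * ent (y j) b a) = tr (y j)"
      proof -
        have "(\<Sum>b<n j. (if a = b then 1 else 0) * ent (y j) b a) = ent (y j) a a" if "a < n j" for a
          using that by (simp add: if_distrib[where f = "\<lambda>x. x * _"] cong: if_cong)
        then show ?thesis
          by (simp add: tr_corner[OF y[OF j]])
      qed
      then show "(\<Sum>a<n j. \<Sum>b<n j. ?h l j a b) = (if j = l then tr (H l * y l) else tr (y j))"
        by (auto simp: tr_mult_corner[OF H[OF l] y[OF l]])
    qed
    also have "\<dots> = tr (H l * y l) * (\<Prod>k\<in>{..<r} - {l}. tr (y k))"
      using l by (subst prod.remove[of _ l]) (auto intro!: prod.cong)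
    finally show ?thesis .
  qed
  have "(\<Sum>t\<in>{..<N} \<times> {..<N}. pert H t * mon t y) =
      (\<Sum>i<N. \<Sum>k<N. \<Sum>l<r. (1 / \<mu> l) *\<^sub>R (\<Prod>j<r. ?h l j (dig ns j i) (dig ns j k)))"
    unfolding sum.cartesian_product summand[symmetric] by (intro sum.cong) auto
  also have "\<dots> = (\<Sum>i<N. \<Sum>l<r. \<Sum>k<N. (1 / \<mu> l) *\<^sub>R (\<Prod>j<r. ?h l j (dig ns j i) (dig ns j k)))"
    by (intro sum.cong refl sum.swap)
  also have "\<dots> = (\<Sum>l<r. \<Sum>i<N. \<Sum>k<N. (1 / \<mu> l) *\<^sub>R (\<Prod>j<r. ?h l j (dig ns j i) (dig ns j k)))"
    by (rule sum.swap)
  also have "\<dots> = (\<Sum>l<r. (1 / \<mu> l) *\<^sub>R (tr (H l * y l) * (\<Prod>k\<in>{..<r} - {l}. tr (y k))))"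
    by (intro sum.cong refl) (simp only: sums scaleR_sum_right[symmetric] lessThan_iff)
  finally show ?thesis
    by (simp add: phi_def)
qed

lemma \<mu>_pos: "(\<And>j. j < r \<Longrightarrow> 1 \<le> m j) \<Longrightarrow> 1 \<le> \<mu> l"
  unfolding \<mu>_def by (rule prod_ge_1) auto

text \<open>With \<open>x j\<close> in slot \<open>j\<close>, every summand belonging to another
  \<open>l\<close> contains the factor \<open>tr (x j)\<close>, which is zero. In the summand
  \<open>l = j\<close> the other slots contribute their ranks, whose product \<open>\<mu> j\<close>
  is divided out.\<close>

lemma D1_pert:
  assumes m: "\<And>j. j < r \<Longrightarrow> 1 \<le> m j" and H: "\<And>j. j < r \<Longrightarrow> corner (n j) (H j)" and p: "p \<in> G"
    and x: "\<And>j. j < r \<Longrightarrow> corner (n j) (x j)" "\<And>j. j < r \<Longrightarrow> tr (x j) = 0"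
  shows "D1 (pert H) p x = sip H x"
  unfolding D1_def sip_def
proof (intro sum.cong refl)
  fix j assume "j \<in> {..<r}"
  then have j: "j < r"
    by simp
  let ?y = "p(j := x j)"
  have "phi (pert H) ?y = (\<Sum>l<r. Re (tr (H l * ?y l) * (\<Prod>k\<in>{..<r} - {l}. tr (?y k))) / \<mu> l)"
    using grD(1)[OF GD[OF p]] x by (intro phi_pert H) auto
  also have "\<dots> = (\<Sum>l<r. if l = j then ip (H j) (x j) else 0)"
  proof (intro sum.cong refl)
    fix l assume "l \<in> {..<r}"
    show "Re (tr (H l * ?y l) * (\<Prod>k\<in>{..<r} - {l}. tr (?y k))) / \<mu> l =
        (if l = j then ip (H j) (x j) else 0)"
    proof (cases "l = j")
      case True
      have "(\<Prod>k\<in>{..<r} - {j}. tr (?y k)) = (\<Prod>k\<in>{..<r} - {j}. of_real (real (m k)))"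
        using grD(4)[OF GD[OF p]] by (intro prod.cong) auto
      also have "\<dots> = of_real (\<mu> j)"
        unfolding \<mu>_def by (rule of_real_prod[symmetric])
      finally show ?thesis
        using True \<mu>_pos[OF m, of j] by (simp add: ip_def)
    next
      case False
      then have 0: "(\<Prod>k\<in>{..<r} - {l}. tr (?y k)) = 0"
        using j x(2) by (intro prod_zero) (auto intro!: bexI[of _ j])
      show ?thesis
        unfolding 0 using False by simp
    qed
  qed
  finally show "phi (pert H) ?y = ip (H j) (x j)"
    using j by simp
qed

text \<open>Two slots hold vectors of trace zero, and the factor \<open>H l\<close> can sit in only
  one of them.\<close>

lemma D2_pert:
  assumes H: "\<And>j. j < r \<Longrightarrow> corner (n j) (H j)" and p: "p \<in> G"
    and x: "x \<in> T p" and w: "w \<in> T p"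
  shows "D2 (pert H) p w x = 0"
  unfolding D2_def
proof (intro sum.neutral ballI)
  fix j i assume ji: "j \<in> {..<r}" "i \<in> {..<r} - {j}"
  let ?y = "p(j := x j, i := w i)"
  have "phi (pert H) ?y = (\<Sum>l<r. Re (tr (H l * ?y l) * (\<Prod>k\<in>{..<r} - {l}. tr (?y k))) / \<mu> l)"
    using grD(1)[OF GD[OF p]] tangD(1)[OF TD[OF x]] tangD(1)[OF TD[OF w]] ji
    by (intro phi_pert H) auto
  also have "\<dots> = 0"
  proof (intro sum.neutral ballI)
    fix l assume "l \<in> {..<r}"
    have "tr (?y i) = 0" "tr (?y j) = 0"
      using ji tr_tang[OF grD(3)[OF GD[OF p]] TD[OF x]] tr_tang[OF grD(3)[OF GD[OF p]] TD[OF w]]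
      by auto
    moreover have "i \<noteq> l \<or> j \<noteq> l"
      using ji by auto
    ultimately have "\<exists>k\<in>{..<r} - {l}. tr (?y k) = 0"
      using ji by blast
    then have 0: "(\<Prod>k\<in>{..<r} - {l}. tr (?y k)) = 0"
      by (intro prod_zero) auto
    show "Re (tr (H l * ?y l) * (\<Prod>k\<in>{..<r} - {l}. tr (?y k))) / \<mu> l = 0"
      unfolding 0 by simp
  qed
  finally show "phi (pert H) ?y = 0" .
qed

lemma corner_grad_j: "j < r \<Longrightarrow> corner (n j) (grad c p j)"
  using dig_less[of j ns] by (intro corner_grad) auto

lemma crit_pert:
  assumes m: "\<And>j. j < r \<Longrightarrow> 1 \<le> m j" and H: "\<And>j. j < r \<Longrightarrow> corner (n j) (H j)"
    and cr: "crit (shift c H) p" and x: "x \<in> T p"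
  shows "sip (\<lambda>j. H j + grad c p j) x = 0"
proof -
  have p: "p \<in> G"
    using cr by (simp add: crit_def)
  have "D1 c p x + D1 (pert H) p x = 0"
    using cr x by (simp add: crit_def D1_coeff_add)
  moreover have "D1 (pert H) p x = sip H x"
    using tangD(1)[OF TD[OF x]] tr_tang[OF grD(3)[OF GD[OF p]] TD[OF x]]
    by (intro D1_pert m H p)
  moreover have "D1 c p x = sip (grad c p) x"
    unfolding sip_def using tangD(2)[OF TD[OF x]] by (rule D1_eq_ip_grad)
  ultimately show ?thesis
    by (simp add: sip_simps)
qed

text \<open>The perturbation reaches the Hessian only through the curvature term. Hence
  \<open>H\<close> combines with the gradient into the same normal vector as in
  \<open>crit_pert\<close>.\<close>

lemma null_dir_pert:
  assumes m: "\<And>j. j < r \<Longrightarrow> 1 \<le> m j" and H: "\<And>j. j < r \<Longrightarrow> corner (n j) (H j)"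
    and p: "p \<in> G" and nd: "null_dir (shift c H) p v" and x: "x \<in> T p"
  shows "D2 c p v x + sip (\<lambda>j. H j + grad c p j) (\<lambda>j. curv (p j) (v j) (x j)) = 0"
proof -
  let ?k = "\<lambda>j. curv (p j) (v j) (x j)"
  have v: "v \<in> T p"
    using nd by (simp add: null_dir_def)
  have k: "corner (n j) (?k j)" "tr (?k j) = 0" "adj (?k j) = ?k j" if j: "j < r" for j
    using grD(1)[OF GD[OF p j]] tangD(1)[OF TD[OF v j]] tangD(1)[OF TD[OF x j]]
      tr_curv[OF GD[OF p j] TD[OF v j] TD[OF x j]] curv_adj[OF GD[OF p j] TD[OF v j] TD[OF x j]]
    by (auto intro: curv_corner)
  have "hess (shift c H) p v x = 0"
    using nd x by (simp add: null_dir_def)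
  moreover have "D2 (pert H) p v x = 0"
    by (rule D2_pert[OF H p x v])
  moreover have "D1 (pert H) p ?k = sip H ?k"
    by (rule D1_pert[OF m H p k(1,2)])
  moreover have "D1 c p ?k = sip (grad c p) ?k"
    unfolding sip_def by (rule D1_eq_ip_grad[OF k(3)])
  ultimately show ?thesis
    by (simp add: hess_def D2_coeff_add D1_coeff_add sip_simps)
qed

text \<open>Test tuples supported in a single slot decouple the first-order condition, and
  \<open>normal_commutes\<close> applies in that slot.\<close>

lemma crit_pert_commutes:
  assumes m: "\<And>j. j < r \<Longrightarrow> 1 \<le> m j" and H: "\<And>j. j < r \<Longrightarrow> corner (n j) (H j)"
    "\<And>j. j < r \<Longrightarrow> adj (H j) = H j"
    and cr: "crit (shift c H) p" and j: "j < r"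
  shows "(H j + grad c p j) * p j = p j * (H j + grad c p j)"
proof (rule normal_commutes)
  have p: "p \<in> G"
    using cr by (simp add: crit_def)
  show "p j \<in> gr (m j) (n j)"
    by (rule GD[OF p j])
  show "corner (n j) (H j + grad c p j)" "adj (H j + grad c p j) = H j + grad c p j"
    using H j by (auto simp: adj_grad corner_grad_j)
  fix x assume x: "x \<in> tang (n j) (p j)"
  let ?x = "\<lambda>k. if k = j then x else 0"
  have "?x \<in> T p"
    using x by (simp add: T_def tang_zero)
  from crit_pert[OF m H(1) cr this] have "sip (\<lambda>j. H j + grad c p j) ?x = 0"
    by blast
  moreover have "ip (H k + grad c p k) (?x k) = (if k = j then ip (H j + grad c p j) x else 0)" for k
    by (simp add: ip_def)
  ultimately show "ip (H j + grad c p j) x = 0"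
    using j by (simp add: sip_def)
qed

subsection \<open>Density\<close>

lemma D2_le:
  assumes "1 \<le> B"
  obtains C where "0 \<le> C" "\<And>p e v \<eta>. (\<And>j. j < r \<Longrightarrow> norm (p j) \<le> B) \<Longrightarrow>
    (\<And>j. j < r \<Longrightarrow> norm (v j) \<le> B) \<Longrightarrow> (\<And>j. j < r \<Longrightarrow> norm (e j) \<le> \<eta>) \<Longrightarrow>
    \<bar>D2 c p e v\<bar> \<le> C * \<eta>"
proof -
  obtain C where C: "0 \<le> C" "\<And>p j x. (\<And>k. k < r \<Longrightarrow> norm (p k) \<le> B) \<Longrightarrow> j < r \<Longrightarrow>
      \<bar>phi c (p(j := x))\<bar> \<le> C * norm x"
    by (rule abs_phi_upd_le[OF assms, of c]) (rule that, assumption, blast)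
  show ?thesis
  proof (rule that[of "(\<Sum>j<r. \<Sum>i\<in>{..<r} - {j}. C)"])
    fix p e v :: "nat \<Rightarrow> fmat" and \<eta>
    assume b: "\<And>j. j < r \<Longrightarrow> norm (p j) \<le> B" "\<And>j. j < r \<Longrightarrow> norm (v j) \<le> B"
      "\<And>j. j < r \<Longrightarrow> norm (e j) \<le> \<eta>"
    have "\<bar>D2 c p e v\<bar> \<le> (\<Sum>j<r. \<Sum>i\<in>{..<r} - {j}. C * \<eta>)"
      unfolding D2_def
    proof (intro order_trans[OF sum_abs] sum_mono)
      fix j i assume ji: "j \<in> {..<r}" "i \<in> {..<r} - {j}"
      have "\<bar>phi c (p(j := v j, i := e i))\<bar> \<le> C * norm (e i)"
        using b ji by (intro C(2)) auto
      also have "\<dots> \<le> C * \<eta>"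
        using b ji C(1) by (intro mult_left_mono) auto
      finally show "\<bar>phi c (p(j := v j, i := e i))\<bar> \<le> C * \<eta>" .
    qed
    then show "\<bar>D2 c p e v\<bar> \<le> (\<Sum>j<r. \<Sum>i\<in>{..<r} - {j}. C) * \<eta>"
      by (simp add: sum_distrib_right)
  qed (intro sum_nonneg C(1))
qed

definition hermitian_tuple :: "real \<Rightarrow> (nat \<Rightarrow> fmat) \<Rightarrow> bool" where
  "hermitian_tuple b H \<longleftrightarrow> (\<forall>j<r. corner (n j) (H j) \<and> adj (H j) = H j \<and> norm (H j) \<le> b)"

text \<open>The tuple X of the overview. The scalars \<open>\<kappa> j\<close> will come from
  \<open>spectral_lipschitz\<close>, one for each factor.\<close>

definition shear :: "(nat \<times> nat \<Rightarrow> complex) \<Rightarrow> (nat \<Rightarrow> real) \<Rightarrow> (nat \<Rightarrow> fmat) \<Rightarrow> (nat \<Rightarrow> fmat) \<Rightarrow> nat \<Rightarrow> fmat" where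
  "shear c \<kappa> H p j = H j + grad c p j + \<kappa> j *\<^sub>R p j"

text \<open>The slab hypothesis of \<open>counting_sard\<close> for critical pairs, with the trace
  pairing in place of the coordinate sum. It is asymmetric: only the pair \<open>(p, H)\<close> is
  assumed degenerate.\<close>

definition slab_bound ::
  "(nat \<times> nat \<Rightarrow> complex) \<Rightarrow> (nat \<Rightarrow> real) \<Rightarrow> real \<Rightarrow> real \<Rightarrow> bool" where
  "slab_bound c \<kappa> b C \<longleftrightarrow> (\<forall>p q H H' v \<delta>. hermitian_tuple b H \<longrightarrow> hermitian_tuple b H' \<longrightarrow>
    crit (shift c H) p \<longrightarrow> crit (shift c H') q \<longrightarrow> null_dir (shift c H) p v \<longrightarrow>
    (\<forall>i\<in>I. \<bar>tcoord v i\<bar> \<le> 1) \<longrightarrow> 0 < \<delta> \<longrightarrow>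
    (\<forall>i\<in>I. \<bar>tcoord (shear c \<kappa> H' q) i - tcoord (shear c \<kappa> H p) i\<bar> \<le> \<delta>) \<longrightarrow>
    (\<forall>i\<in>I. \<bar>tcoord H' i - tcoord H i\<bar> \<le> C * \<delta>) \<and> \<bar>sip v (\<lambda>j. H' j - H j)\<bar> \<le> C * \<delta>\<^sup>2)"

text \<open>The estimate behind Sard's theorem: the pair of a critical point \<open>p\<close> and a perturbation \<open>H\<close>
  is parametrized by \<open>shear c \<kappa> H p\<close>, which has as many real coordinates as \<open>H\<close>; near a pair with a
  null vector \<open>v\<close> of the Hessian, \<open>H\<close> moves orthogonally to \<open>v\<close> up to second order.\<close>

lemma degenerate_slab:
  assumes m: "\<And>j. j < r \<Longrightarrow> 1 \<le> m j"
  obtains C R \<kappa> where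
    "\<forall>p\<in>G. \<forall>H. hermitian_tuple b H \<longrightarrow> (\<forall>i\<in>I. \<bar>tcoord (shear c \<kappa> H p) i\<bar> \<le> R)"
    "slab_bound c \<kappa> b C"
proof -
  have "0 \<le> K" "1 \<le> L" "0 \<le> L"
    using K_ge_1 by (auto simp: L_def sum_nonneg)
  obtain Cg where Cg: "0 \<le> Cg" "\<And>p q \<delta> j. (\<And>k. k < r \<Longrightarrow> norm (p k) \<le> K) \<Longrightarrow>
    (\<And>k. k < r \<Longrightarrow> norm (q k) \<le> K) \<Longrightarrow> (\<And>k. k < r \<Longrightarrow> norm (q k - p k) \<le> \<delta>) \<Longrightarrow> 0 \<le> \<delta> \<Longrightarrow>
    norm (grad c q j - grad c p j) \<le> Cg * \<delta>"
    by (rule norm_grad_diff_le[OF K_ge_1, of c]) (rule that, assumption, blast)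
  \<comment> \<open>The zero tuple lies in the ball of radius \<open>K\<close>, so the Lipschitz
    bound compares the gradient at any point of \<open>G\<close> with its value at zero.\<close>
  define Rg where "Rg = Cg * K + (\<Sum>j<r. norm (grad c (\<lambda>_. 0) j))"
  have Rg: "norm (grad c p j) \<le> Rg" if p: "p \<in> G" and j: "j < r" for p j
  proof -
    have "norm (grad c p j - grad c (\<lambda>_. 0) j) \<le> Cg * K"
      using norm_G_le[OF p] \<open>0 \<le> K\<close> by (intro Cg(2)) auto
    moreover have "norm (grad c (\<lambda>_. 0) j) \<le> (\<Sum>j<r. norm (grad c (\<lambda>_. 0) j))"
      by (rule member_le_sum) (use j in auto)
    ultimately show ?thesis
      using norm_triangle_sub[of "grad c p j" "grad c (\<lambda>_. 0) j"] by (simp add: Rg_def)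
  qed
  define R where "R = b + Rg"
  have "\<exists>\<kappa>. \<forall>p q u v. p \<in> gr (m j) (n j) \<longrightarrow> q \<in> gr (m j) (n j) \<longrightarrow> u * p = p * u \<longrightarrow>
      v * q = q * v \<longrightarrow> norm u \<le> R \<longrightarrow> norm v \<le> R \<longrightarrow>
      norm (p - q) \<le> (real (n j))\<^sup>2 * norm ((u + \<kappa> *\<^sub>R p) - (v + \<kappa> *\<^sub>R q))" for j
    using spectral_lipschitz[of "m j" "n j" R] by metis
  then obtain \<kappa> where \<kappa>: "\<And>j p q u v. p \<in> gr (m j) (n j) \<Longrightarrow> q \<in> gr (m j) (n j) \<Longrightarrow> u * p = p * u \<Longrightarrow>
      v * q = q * v \<Longrightarrow> norm u \<le> R \<Longrightarrow> norm v \<le> R \<Longrightarrow>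
      norm (p - q) \<le> (real (n j))\<^sup>2 * norm ((u + \<kappa> j *\<^sub>R p) - (v + \<kappa> j *\<^sub>R q))"
    by metis
  define \<kappa>m where "\<kappa>m = (\<Sum>j<r. \<bar>\<kappa> j\<bar>)"
  have \<kappa>m: "\<bar>\<kappa> j\<bar> \<le> \<kappa>m" if "j < r" for j
    unfolding \<kappa>m_def by (rule member_le_sum) (use that in auto)
  have "0 \<le> \<kappa>m"
    by (simp add: \<kappa>m_def sum_nonneg)
  \<comment> \<open>\<open>norm_le_tcoord\<close> for a null vector whose coordinates are bounded by
    one.\<close>
  define V where "V = L * (L * (2 * 1))"
  have "0 \<le> V"
    using \<open>0 \<le> L\<close> by (simp add: V_def)
  obtain Ct where Ct: "0 \<le> Ct" "\<And>p q w \<delta>. (\<And>k. k < r \<Longrightarrow> norm (p k) \<le> K) \<Longrightarrow>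
    (\<And>k. k < r \<Longrightarrow> norm (q k) \<le> K) \<Longrightarrow> (\<And>k. k < r \<Longrightarrow> norm (q k - p k) \<le> \<delta>) \<Longrightarrow>
    (\<And>k. k < r \<Longrightarrow> norm (w k) \<le> V) \<Longrightarrow>
    \<bar>D1 c q w - D1 c p w - D2 c p (\<lambda>j. q j - p j) w\<bar> \<le> Ct * \<delta>\<^sup>2"
    by (rule D1_taylor[OF K_ge_1, where W = V and c = c]) (rule that, assumption, blast)
  have "1 \<le> K + V"
    using K_ge_1 \<open>0 \<le> V\<close> by simp
  obtain Cp where Cp: "0 \<le> Cp" "\<And>p e v \<eta>. (\<And>j. j < r \<Longrightarrow> norm (p j) \<le> K + V) \<Longrightarrow>
    (\<And>j. j < r \<Longrightarrow> norm (v j) \<le> K + V) \<Longrightarrow> (\<And>j. j < r \<Longrightarrow> norm (e j) \<le> \<eta>) \<Longrightarrow>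
    \<bar>D2 c p e v\<bar> \<le> Cp * \<eta>"
    by (rule D2_le[OF \<open>1 \<le> K + V\<close>, of c]) (rule that, assumption, blast)
  \<comment> \<open>Lipschitz constants in terms of the distance of the sheared tuples:
    \<open>C1\<close> for the critical point, \<open>C2\<close> for the normal vector
    \<open>H + grad\<close>, \<open>C3\<close> for \<open>H\<close>. \<open>A1\<close>,
    \<open>A2\<close> and \<open>A3\<close> are the resulting bounds from
    \<open>tproj_estimates\<close>, and \<open>C4\<close> collects the four quadratic errors of the
    final identity.\<close>
  define C1 where "C1 = L\<^sup>2 * (L * (L * 2))"
  define C2 where "C2 = L * (L * 2) + \<kappa>m * C1"
  define C3 where "C3 = C2 + Cg * C1"
  define A1 where "A1 = (4 + (2 + 4 * K) * (1 + 2 * K)) * V * C1\<^sup>2"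
  define A2 where "A2 = (2 + 12 * K) * V * C1"
  define A3 where "A3 = (1 + 2 * K) * C1\<^sup>2"
  define C4 where "C4 = real r * (R * A1) + real r * (C2 * A2) + Ct * C1\<^sup>2 + Cp * A3"
  have "0 \<le> C1" "0 \<le> C2"
    using \<open>0 \<le> L\<close> \<open>0 \<le> \<kappa>m\<close> by (simp_all add: C1_def C2_def)
  then have "0 \<le> C3"
    using Cg(1) by (simp add: C3_def)
  have u_le: "norm (H j + grad c p j) \<le> R" if "p \<in> G" "norm (H j) \<le> b" "j < r" for p H j
    using norm_triangle_ineq[of "H j" "grad c p j"] that Rg by (fastforce simp: R_def)
  \<comment> \<open>The factors 2 stem from \<open>abs_coord_le\<close>; the absolute value makes
    the sum an upper bound for \<open>2 * C3\<close> and for \<open>C4\<close> whatever the sign of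
    \<open>C4\<close>.\<close>
  show ?thesis
  proof (rule that[where C = "2 * C3 + \<bar>C4\<bar>" and R = "2 * (R + \<kappa>m * K)" and \<kappa> = \<kappa>],
      intro ballI allI impI)
    fix p H i assume p: "p \<in> G" and HT: "hermitian_tuple b H" and "i \<in> I"
    then obtain j a d where i: "i = (j, a, d)" "j < r"
      by (auto simp: I_def)
    have H: "\<And>j. j < r \<Longrightarrow> norm (H j) \<le> b"
      using HT by (simp add: hermitian_tuple_def)
    have "norm (shear c \<kappa> H p j) \<le> norm (H j + grad c p j) + \<bar>\<kappa> j\<bar> * norm (p j)"
      unfolding shear_def using norm_triangle_ineq[of "H j + grad c p j" "\<kappa> j *\<^sub>R p j"] by simp
    also have "\<dots> \<le> R + \<kappa>m * K"
      using u_le[of p H j, OF p H[OF i(2)] i(2)] \<kappa>m[OF i(2)] norm_G_le[OF p i(2)] \<open>0 \<le> \<kappa>m\<close>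
      by (intro add_mono mult_mono) auto
    finally show "\<bar>tcoord (shear c \<kappa> H p) i\<bar> \<le> 2 * (R + \<kappa>m * K)"
      using abs_coord_le[of "shear c \<kappa> H p j" a d] by (simp add: tcoord_def i)
  next
    show "slab_bound c \<kappa> b (2 * C3 + \<bar>C4\<bar>)"
      unfolding slab_bound_def
    proof (intro allI impI)
      fix p q H H' v and \<delta> :: real
      assume HT: "hermitian_tuple b H" "hermitian_tuple b H'"
        and cp: "crit (shift c H) p" and cq: "crit (shift c H') q"
        and nd: "null_dir (shift c H) p v" and v1: "\<forall>i\<in>I. \<bar>tcoord v i\<bar> \<le> 1"
        and "0 < \<delta>" and close: "\<forall>i\<in>I. \<bar>tcoord (shear c \<kappa> H' q) i - tcoord (shear c \<kappa> H p) i\<bar> \<le> \<delta>"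
      have H: "\<And>j. j < r \<Longrightarrow> corner (n j) (H j) \<and> adj (H j) = H j \<and> norm (H j) \<le> b"
        and H': "\<And>j. j < r \<Longrightarrow> corner (n j) (H' j) \<and> adj (H' j) = H' j \<and> norm (H' j) \<le> b"
        using HT by (auto simp: hermitian_tuple_def)
      have p: "p \<in> G" and q: "q \<in> G" and v: "v \<in> T p"
        using cp cq nd by (auto simp: crit_def null_dir_def)
      have Kp: "norm (p j) \<le> K" and Kq: "norm (q j) \<le> K" if "j < r" for j
        using norm_G_le[OF p that] norm_G_le[OF q that] by auto
      define u where "u j = H j + grad c p j" for j
      define u' where "u' j = H' j + grad c q j" for j
      have ul: "norm (u j) \<le> R" and ul': "norm (u' j) \<le> R" if "j < r" for j
        using u_le[of p H j, OF p] u_le[of q H' j, OF q] H[OF that] H'[OF that] that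
        by (auto simp: u_def u'_def)
      have sh: "norm (shear c \<kappa> H' q j - shear c \<kappa> H p j) \<le> L * (L * (2 * \<delta>))" if j: "j < r" for j
      proof (rule norm_le_tcoord[of j "\<lambda>j. shear c \<kappa> H' q j - shear c \<kappa> H p j", OF j])
        note P = grD[OF GD[OF p j]] and Q = grD[OF GD[OF q j]]
        show "corner (n j) (shear c \<kappa> H' q j - shear c \<kappa> H p j)"
          unfolding shear_def using P Q H[OF j] H'[OF j] corner_grad_j[OF j]
          by (intro corner_minus corner_plus corner_scaleR) auto
        show "adj (shear c \<kappa> H' q j - shear c \<kappa> H p j) = shear c \<kappa> H' q j - shear c \<kappa> H p j"
          unfolding shear_def using P Q H[OF j] H'[OF j] by (simp add: adj_grad)
        show "\<bar>tcoord (\<lambda>j. shear c \<kappa> H' q j - shear c \<kappa> H p j) i\<bar> \<le> \<delta>" if "i \<in> I" for i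
          using close that by (simp add: tcoord_diff)
      qed (use \<open>0 < \<delta>\<close> in simp)
      have d: "norm (q j - p j) \<le> C1 * \<delta>" if j: "j < r" for j
      proof -
        have Hc: "\<And>j. j < r \<Longrightarrow> corner (n j) (H j)" "\<And>j. j < r \<Longrightarrow> adj (H j) = H j"
          and Hc': "\<And>j. j < r \<Longrightarrow> corner (n j) (H' j)" "\<And>j. j < r \<Longrightarrow> adj (H' j) = H' j"
          using H H' by auto
        have "u j * p j = p j * u j"
          unfolding u_def by (rule crit_pert_commutes[OF m Hc cp j])
        moreover have "u' j * q j = q j * u' j"
          unfolding u'_def by (rule crit_pert_commutes[OF m Hc' cq j])
        ultimately have "norm (q j - p j) \<le> (real (n j))\<^sup>2 * norm (shear c \<kappa> H' q j - shear c \<kappa> H p j)"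
          using \<kappa>[OF GD[OF q j] GD[OF p j], of "u' j" "u j"] ul[OF j] ul'[OF j]
          by (simp add: shear_def u_def u'_def)
        also have "\<dots> \<le> L\<^sup>2 * (L * (L * (2 * \<delta>)))"
          using sh[OF j] n_le_L[OF j] \<open>0 \<le> L\<close> by (intro mult_mono power_mono) auto
        finally show ?thesis
          by (simp add: C1_def mult.assoc)
      qed
      have du: "norm (u' j - u j) \<le> C2 * \<delta>" if j: "j < r" for j
      proof -
        have "u' j - u j = (shear c \<kappa> H' q j - shear c \<kappa> H p j) - \<kappa> j *\<^sub>R (q j - p j)"
          by (simp add: shear_def u_def u'_def algebra_simps)
        then have "norm (u' j - u j) \<le> L * (L * (2 * \<delta>)) + \<bar>\<kappa> j\<bar> * norm (q j - p j)"
          using norm_triangle_ineq4[of "shear c \<kappa> H' q j - shear c \<kappa> H p j" "\<kappa> j *\<^sub>R (q j - p j)"] sh[OF j]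
          by simp
        also have "\<dots> \<le> L * (L * (2 * \<delta>)) + \<kappa>m * (C1 * \<delta>)"
          using d[OF j] \<kappa>m[OF j] \<open>0 \<le> \<kappa>m\<close> by (intro add_left_mono mult_mono) auto
        finally show ?thesis
          by (simp add: C2_def algebra_simps)
      qed
      have dH: "norm (H' j - H j) \<le> C3 * \<delta>" if j: "j < r" for j
      proof -
        have "norm (grad c q j - grad c p j) \<le> Cg * (C1 * \<delta>)"
          using Kp Kq d \<open>0 \<le> C1\<close> \<open>0 < \<delta>\<close> by (intro Cg(2)) auto
        moreover have eq: "H' j - H j = (u' j - u j) - (grad c q j - grad c p j)"
          by (simp add: u_def u'_def)
        have "norm (H' j - H j) \<le> norm (u' j - u j) + norm (grad c q j - grad c p j)"
          unfolding eq by (rule norm_triangle_ineq4)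
        moreover have "C3 * \<delta> = C2 * \<delta> + Cg * (C1 * \<delta>)"
          by (simp add: C3_def algebra_simps)
        ultimately show ?thesis
          using du[OF j] by linarith
      qed
      have "\<bar>tcoord H' i - tcoord H i\<bar> \<le> (2 * C3 + \<bar>C4\<bar>) * \<delta>" if iI: "i \<in> I" for i
      proof -
        obtain j a b where i: "i = (j, a, b)" "j < r"
          using iI by (auto simp: I_def)
        have "\<bar>tcoord H' i - tcoord H i\<bar> \<le> 2 * (C3 * \<delta>)"
          using abs_coord_le[of "H' j - H j" a b] dH[OF i(2)] by (simp add: i tcoord_def coord_simps)
        moreover have "0 \<le> \<bar>C4\<bar> * \<delta>"
          using \<open>0 < \<delta>\<close> by simp
        ultimately show ?thesis
          by (simp add: algebra_simps)
      qed
      moreover have "\<bar>sip v (\<lambda>j. H' j - H j)\<bar> \<le> (2 * C3 + \<bar>C4\<bar>) * \<delta>\<^sup>2"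
      proof -
        \<comment> \<open>Criticality at \<open>q\<close> can be tested only on tangent vectors at
          \<open>q\<close>, so \<open>v\<close> is transported to \<open>v'\<close>;
          \<open>k\<close> is the first-order change of \<open>v\<close> under this transport along
          the tangential displacement \<open>\<xi>\<close>.\<close>
        define \<xi> where "\<xi> j = tproj (p j) (q j - p j)" for j
        define v' where "v' j = tproj (q j) (v j)" for j
        define k where "k j = curv (p j) (v j) (\<xi> j)" for j
        have \<xi>: "\<xi> \<in> T p"
          unfolding \<xi>_def using grD[OF GD[OF p]] grD[OF GD[OF q]] by (intro T_tproj p) auto
        have v': "v' \<in> T q"
          unfolding v'_def using tangD[OF TD[OF v]] by (intro T_tproj q) auto
        have nv: "norm (v j) \<le> V" if j: "j < r" for j
          unfolding V_def using tangD[OF TD[OF v j]] v1 by (intro norm_le_tcoord j) auto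
        have dsq: "(norm (q j - p j))\<^sup>2 \<le> C1\<^sup>2 * \<delta>\<^sup>2" if "j < r" for j
          using power_mono[OF d[OF that], of 2] by (simp add: power_mult_distrib)
        have e1: "norm (v' j - v j - k j) \<le> A1 * \<delta>\<^sup>2" and e2: "norm (v' j - v j) \<le> A2 * \<delta>"
          and e3: "norm (q j - p j - \<xi> j) \<le> A3 * \<delta>\<^sup>2" if j: "j < r" for j
        proof -
          note est = tproj_estimates[OF grD(3)[OF GD[OF p j]] grD(3)[OF GD[OF q j]] TD[OF v j] Kp[OF j] Kq[OF j]]
          have "norm (v' j - v j - k j) \<le> (4 + (2 + 4 * K) * (1 + 2 * K)) * norm (v j) * (norm (q j - p j))\<^sup>2"
            using est(2) by (simp add: v'_def k_def \<xi>_def)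
          also have "\<dots> \<le> (4 + (2 + 4 * K) * (1 + 2 * K)) * V * (C1\<^sup>2 * \<delta>\<^sup>2)"
            using nv[OF j] dsq[OF j] \<open>0 \<le> K\<close> \<open>0 \<le> V\<close> by (intro mult_mono) auto
          finally show "norm (v' j - v j - k j) \<le> A1 * \<delta>\<^sup>2"
            by (simp add: A1_def mult.assoc)
          have "norm (v' j - v j) \<le> (2 + 12 * K) * norm (v j) * norm (q j - p j)"
            using est(3) by (simp add: v'_def)
          also have "\<dots> \<le> (2 + 12 * K) * V * (C1 * \<delta>)"
            using nv[OF j] d[OF j] \<open>0 \<le> K\<close> \<open>0 \<le> V\<close> by (intro mult_mono) auto
          finally show "norm (v' j - v j) \<le> A2 * \<delta>"
            by (simp add: A2_def mult.assoc)
          have "norm (q j - p j - \<xi> j) \<le> (1 + 2 * K) * (norm (q j - p j))\<^sup>2"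
            using est(1) by (simp add: \<xi>_def)
          also have "\<dots> \<le> (1 + 2 * K) * (C1\<^sup>2 * \<delta>\<^sup>2)"
            using dsq[OF j] \<open>0 \<le> K\<close> by (intro mult_left_mono) auto
          finally show "norm (q j - p j - \<xi> j) \<le> A3 * \<delta>\<^sup>2"
            by (simp add: A3_def mult.assoc)
        qed
        have "sip u v = 0"
          unfolding u_def using H by (intro crit_pert[OF m _ cp v]) auto
        have "sip u' v' = 0"
          unfolding u'_def using H' by (intro crit_pert[OF m _ cq v']) auto
        have hk: "D2 c p v \<xi> + sip u k = 0"
          unfolding u_def k_def using H by (intro null_dir_pert[OF m _ p nd \<xi>]) auto
        have gr: "D1 c q v - D1 c p v = sip (grad c q) v - sip (grad c p) v"
          unfolding sip_def using tangD(2)[OF TD[OF v]] by (simp add: D1_eq_ip_grad)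
        have split: "D2 c p (\<lambda>j. q j - p j) v = D2 c p v \<xi> + D2 c p (\<lambda>j. q j - p j - \<xi> j) v"
          using D2_add_left[of c p \<xi> "\<lambda>j. q j - p j - \<xi> j" v] by (simp add: D2_commute[of c p v])
        have "sip v (\<lambda>j. H' j - H j) = sip u' v - sip u v - (D1 c q v - D1 c p v)"
        proof -
          have "u = (\<lambda>j. H j + grad c p j)" "u' = (\<lambda>j. H' j + grad c q j)"
            by (auto simp: u_def u'_def)
          then show ?thesis
            unfolding gr by (simp add: sip_simps sip_commute[of v])
        qed
        \<comment> \<open>As \<open>sip u' v' = 0\<close>, the term \<open>sip u' v\<close> is
          \<open>- sip u' (v' - v)\<close>, to first order \<open>- sip u k\<close>. The derivative
          of the unperturbed form changes to first order by \<open>D2 c p v \<xi>\<close>. Both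
          leading terms cancel by \<open>hk\<close>, the null vector equation, and four quadratic
          errors remain.\<close>
        also have "\<dots> = - sip u (\<lambda>j. v' j - v j - k j) - sip (\<lambda>j. u' j - u j) (\<lambda>j. v' j - v j)
            - (D1 c q v - D1 c p v - D2 c p (\<lambda>j. q j - p j) v) - D2 c p (\<lambda>j. q j - p j - \<xi> j) v"
          using hk \<open>sip u v = 0\<close> \<open>sip u' v' = 0\<close> by (simp add: sip_simps split)
        finally have eq: "sip v (\<lambda>j. H' j - H j) = \<dots>" .
        have "\<bar>sip u (\<lambda>j. v' j - v j - k j)\<bar> \<le> real r * (R * (A1 * \<delta>\<^sup>2))"
          by (intro abs_sip_le ul e1)
        moreover have "\<bar>sip (\<lambda>j. u' j - u j) (\<lambda>j. v' j - v j)\<bar> \<le> real r * (C2 * \<delta> * (A2 * \<delta>))"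
          by (intro abs_sip_le du e2)
        moreover have "\<bar>D1 c q v - D1 c p v - D2 c p (\<lambda>j. q j - p j) v\<bar> \<le> Ct * (C1 * \<delta>)\<^sup>2"
          by (intro Ct(2) Kp Kq d nv)
        moreover have "\<bar>D2 c p (\<lambda>j. q j - p j - \<xi> j) v\<bar> \<le> Cp * (A3 * \<delta>\<^sup>2)"
        proof (rule Cp(2))
          show "norm (p j) \<le> K + V" "norm (v j) \<le> K + V" if "j < r" for j
            using Kp[OF that] nv[OF that] \<open>0 \<le> V\<close> \<open>0 \<le> K\<close> by auto
        qed (rule e3)
        ultimately have "\<bar>sip v (\<lambda>j. H' j - H j)\<bar> \<le> real r * (R * (A1 * \<delta>\<^sup>2)) +
            real r * (C2 * \<delta> * (A2 * \<delta>)) + Ct * (C1 * \<delta>)\<^sup>2 + Cp * (A3 * \<delta>\<^sup>2)"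
          unfolding eq by linarith
        also have "\<dots> = C4 * \<delta>\<^sup>2"
          by (simp add: C4_def algebra_simps power2_eq_square)
        also have "\<dots> \<le> (2 * C3 + \<bar>C4\<bar>) * \<delta>\<^sup>2"
          using \<open>0 \<le> C3\<close> by (intro mult_right_mono) auto
        finally show ?thesis .
      qed
      ultimately show "(\<forall>i\<in>I. \<bar>tcoord H' i - tcoord H i\<bar> \<le> (2 * C3 + \<bar>C4\<bar>) * \<delta>) \<and>
          \<bar>sip v (\<lambda>j. H' j - H j)\<bar> \<le> (2 * C3 + \<bar>C4\<bar>) * \<delta>\<^sup>2"
        by blast
    qed
  qed
qed

text \<open>\<open>counting_sard\<close> with the coordinates of the sheared tuple as parameter and
  those of the perturbation as value. The covector is the null vector itself, because the
  coordinates are isometric.\<close>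

lemma exists_morse_perturbation:
  assumes m: "\<And>j. j < r \<Longrightarrow> 1 \<le> m j" and "0 < b"
  obtains H where "hermitian_tuple b H"
    "\<And>p v. crit (shift c H) p \<Longrightarrow> \<not> null_dir (shift c H) p v"
proof -
  have "1 \<le> L"
    by (simp add: L_def sum_nonneg)
  then have L2: "0 < L * (L * 2)"
    by simp
  \<comment> \<open>The side of the box for which \<open>norm_le_tcoord\<close> yields exactly the
    norm bound \<open>b\<close>.\<close>
  define \<epsilon> where "\<epsilon> = b / (L * (L * 2))"
  have "0 < \<epsilon>" and \<epsilon>b: "L * (L * (2 * \<epsilon>)) = b"
    using L2 \<open>0 < b\<close> \<open>1 \<le> L\<close> by (auto simp: \<epsilon>_def)
  define box where "box g \<longleftrightarrow> (\<forall>i\<in>I. 0 \<le> g i \<and> g i \<le> \<epsilon>)" for g :: "nat \<times> nat \<times> nat \<Rightarrow> real"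
  have th: "hermitian_tuple b (therm g)" if g: "box g" for g
    unfolding hermitian_tuple_def
  proof (intro allI impI conjI)
    fix j assume j: "j < r"
    show c: "corner (n j) (therm g j)" and a: "adj (therm g j) = therm g j"
      by (simp_all add: therm_def corner_herm adj_herm)
    have "\<bar>tcoord (therm g) i\<bar> \<le> \<epsilon>" if "i \<in> I" for i
      using g that by (simp add: box_def tcoord_therm)
    then show "norm (therm g j) \<le> b"
      using norm_le_tcoord[of j "therm g" \<epsilon>, OF j c a] \<open>0 < \<epsilon>\<close> \<epsilon>b by simp
  qed
  define cc where "cc g = shift c (therm g)" for g
  obtain C R \<kappa> where
    bound: "\<forall>p\<in>G. \<forall>H. hermitian_tuple b H \<longrightarrow> (\<forall>i\<in>I. \<bar>tcoord (shear c \<kappa> H p) i\<bar> \<le> R)"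
    and slab: "slab_bound c \<kappa> b C"
    by (rule degenerate_slab[OF m, of b c]) (rule that | assumption)+
  \<comment> \<open>Null vectors are scaled so that the largest modulus of a coordinate is one: this
    provides the pivot and also the bound demanded by \<open>slab_bound\<close>.\<close>
  define S where "S X g w \<longleftrightarrow> box g \<and> (\<exists>p v. crit (cc g) p \<and> null_dir (cc g) p v \<and>
    X = tcoord (shear c \<kappa> (therm g) p) \<and> w = tcoord v \<and> (\<forall>i\<in>I. \<bar>w i\<bar> \<le> 1) \<and> (\<exists>i\<in>I. \<bar>w i\<bar> = 1))"
    for X g w :: "nat \<times> nat \<times> nat \<Rightarrow> real"
  have "\<exists>g. (\<forall>i\<in>I. 0 \<le> g i \<and> g i \<le> \<epsilon>) \<and> (\<forall>X w. \<not> S X g w)"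
  proof (rule counting_sard[where S = S and R = R and C = C, OF finite_I \<open>0 < \<epsilon>\<close>])
    fix X g w i assume S: "S X g w" and i: "i \<in> I"
    then obtain p where "box g" "p \<in> G" "X = tcoord (shear c \<kappa> (therm g) p)"
      by (auto simp: S_def crit_def)
    then show "\<bar>X i\<bar> \<le> R"
      using bound[rule_format, of p "therm g" i] th[of g] i by simp
  next
    fix X g w assume "S X g w"
    then show "\<exists>k\<in>I. \<bar>w k\<bar> = 1"
      by (auto simp: S_def)
  next
    fix X g w X' g' w' and \<delta> :: real
    assume S: "S X g w" and S': "S X' g' w'" and \<delta>: "0 < \<delta>"
      and close: "\<And>i. i \<in> I \<Longrightarrow> \<bar>X' i - X i\<bar> \<le> \<delta>"
    from S obtain p v where g: "box g" and p: "crit (cc g) p" "null_dir (cc g) p v"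
      and X: "X = tcoord (shear c \<kappa> (therm g) p)" and w: "w = tcoord v" "\<forall>i\<in>I. \<bar>w i\<bar> \<le> 1"
      by (auto simp: S_def)
    from S' obtain q where g': "box g'" and q: "crit (cc g') q"
      and X': "X' = tcoord (shear c \<kappa> (therm g') q)"
      by (auto simp: S_def)
    have v: "v \<in> T p"
      using p by (simp add: null_dir_def)
    have "(\<forall>i\<in>I. \<bar>tcoord (therm g') i - tcoord (therm g) i\<bar> \<le> C * \<delta>) \<and>
        \<bar>sip v (\<lambda>j. therm g' j - therm g j)\<bar> \<le> C * \<delta>\<^sup>2"
    proof (rule slab[unfolded slab_bound_def, rule_format, OF th[OF g] th[OF g'] p(1)[unfolded cc_def]
          q[unfolded cc_def] p(2)[unfolded cc_def] _ \<delta>])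
      show "\<bar>tcoord v i\<bar> \<le> 1" if "i \<in> I" for i
        using w that by simp
      show "\<bar>tcoord (shear c \<kappa> (therm g') q) i - tcoord (shear c \<kappa> (therm g) p) i\<bar> \<le> \<delta>" if "i \<in> I" for i
        using close[OF that] by (simp add: X X')
    qed
    moreover have "(\<Sum>i\<in>I. w i * (g' i - g i)) = sip v (\<lambda>j. therm g' j - therm g j)"
    proof -
      have "(\<Sum>i\<in>I. w i * (g' i - g i)) = (\<Sum>i\<in>I. tcoord v i * tcoord (\<lambda>j. therm g' j - therm g j) i)"
        by (intro sum.cong) (simp_all add: w tcoord_diff tcoord_therm)
      also have "\<dots> = sip v (\<lambda>j. therm g' j - therm g j)"
        using th[OF g] th[OF g'] tangD[OF TD[OF v]]
        by (intro sum_tcoord) (auto simp: hermitian_tuple_def)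
      finally show ?thesis .
    qed
    ultimately show "(\<forall>i\<in>I. \<bar>g' i - g i\<bar> \<le> C * \<delta>) \<and> \<bar>\<Sum>i\<in>I. w i * (g' i - g i)\<bar> \<le> C * \<delta>\<^sup>2"
      by (simp add: tcoord_therm)
  qed
  then obtain g where g: "box g" and none: "\<And>X w. \<not> S X g w"
    by (auto simp: box_def)
  have "\<not> null_dir (cc g) p v" if cr: "crit (cc g) p" for p v
  proof
    assume nd: "null_dir (cc g) p v"
    then obtain j where j: "j < r" "v j \<noteq> 0" and v: "v \<in> T p"
      by (auto simp: null_dir_def)
    have "\<exists>i\<in>I. tcoord v i \<noteq> 0"
    proof (rule ccontr)
      assume "\<not> ?thesis"
      then have "norm (v j) \<le> L * (L * (2 * 0))"
        using tangD[OF TD[OF v j(1)]] by (intro norm_le_tcoord j) auto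
      then show False
        using j by simp
    qed
    then obtain i0 where i0: "i0 \<in> I" "tcoord v i0 \<noteq> 0"
      by blast
    define M where "M = Max ((\<lambda>i. \<bar>tcoord v i\<bar>) ` I)"
    have fin: "finite ((\<lambda>i. \<bar>tcoord v i\<bar>) ` I)" "(\<lambda>i. \<bar>tcoord v i\<bar>) ` I \<noteq> {}"
      using finite_I i0 by auto
    have le: "\<bar>tcoord v i\<bar> \<le> M" if "i \<in> I" for i
      unfolding M_def using fin(1) that by (intro Max_ge) auto
    have "M > 0"
      using le[OF i0(1)] i0(2) by linarith
    obtain i1 where i1: "i1 \<in> I" "\<bar>tcoord v i1\<bar> = M"
      using Max_in[OF fin] unfolding M_def by auto
    define w where "w j = (1 / M) *\<^sub>R v j" for j
    have tw: "tcoord w i = tcoord v i / M" for i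
      by (auto simp: tcoord_def w_def coord_simps split: prod.split)
    have "null_dir (cc g) p w"
      unfolding w_def using null_dir_scaleR[OF nd] \<open>M > 0\<close> by simp
    moreover have "\<forall>i\<in>I. \<bar>tcoord w i\<bar> \<le> 1" "\<exists>i\<in>I. \<bar>tcoord w i\<bar> = 1"
      using le i1 \<open>M > 0\<close> by (auto simp: tw intro!: bexI[of _ i1])
    ultimately have "S (tcoord (shear c \<kappa> (therm g) p)) g (tcoord w)"
      unfolding S_def using g cr by blast
    then show False
      using none by blast
  qed
  then show ?thesis
    using th[OF g] by (intro that[of "therm g"]) (auto simp: cc_def)
qed

text \<open>The perturbed matrix is known to have the shifted coefficients only inside its index
  range, so the equality of coefficients that is available is local.\<close>

lemma crit_null_coeff_cong:
  assumes "\<And>t. t \<in> {..<N} \<times> {..<N} \<Longrightarrow> c t = c' t"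
  shows "crit c = crit c'" "null_dir c = null_dir c'"
proof -
  have "phi c = phi c'"
    unfolding phi_def using assms by (intro ext arg_cong[where f = Re] sum.cong) auto
  then have "D1 c = D1 c'" "hess c = hess c'"
    by (auto simp: D1_def D2_def hess_def fun_eq_iff)
  then show "crit c = crit c'" "null_dir c = null_dir c'"
    by (auto simp: crit_def null_dir_def fun_eq_iff)
qed

lemma cnj_pert:
  assumes "\<And>j. j < r \<Longrightarrow> adj (H j) = H j"
  shows "cnj (pert H (k, i)) = pert H (i, k)"
  unfolding pert_def prod.case cnj_sum
proof (intro sum.cong refl)
  fix l assume "l \<in> {..<r}"
  have "cnj (ent (H l) a b) = ent (H l) b a" for a b
  proof -
    have "ent (adj (H l)) b a = cnj (ent (H l) a b)"
      by simp
    moreover have "adj (H l) = H l"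
      using assms \<open>l \<in> {..<r}\<close> by simp
    ultimately show ?thesis
      by metis
  qed
  moreover have "cnj (if x = y then 1 else 0) = (if y = x then 1 else 0)" for x y :: nat
    by auto
  ultimately show "cnj ((1 / \<mu> l) *\<^sub>R (ent (H l) (dig ns l k) (dig ns l i) *
      (\<Prod>j\<in>{..<r} - {l}. if dig ns j k = dig ns j i then 1 else 0))) =
    (1 / \<mu> l) *\<^sub>R (ent (H l) (dig ns l i) (dig ns l k) *
      (\<Prod>j\<in>{..<r} - {l}. if dig ns j i = dig ns j k then 1 else 0))"
    by (simp add: complex_scaleR)
qed

lemma cmod_pert_le:
  assumes m: "\<And>j. j < r \<Longrightarrow> 1 \<le> m j" and "\<And>j. j < r \<Longrightarrow> norm (H j) \<le> b"
  shows "cmod (pert H t) \<le> real r * b"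
proof -
  obtain i k where t: "t = (i, k)"
    by fastforce
  have "cmod (pert H t) \<le> (\<Sum>l<r. b)"
    unfolding t pert_def prod.case
  proof (intro order_trans[OF norm_sum] sum_mono)
    fix l assume l: "l \<in> {..<r}"
    let ?d = "\<Prod>j\<in>{..<r} - {l}. if dig ns j i = dig ns j k then 1 else (0 :: complex)"
    have "cmod ?d \<le> 1"
      unfolding prod_norm[symmetric] by (rule prod_le_1) auto
    then have "cmod (ent (H l) (dig ns l i) (dig ns l k) * ?d) \<le> norm (H l) * 1"
      unfolding norm_mult by (intro mult_mono norm_ent_le) auto
    moreover have "\<bar>1 / \<mu> l\<bar> \<le> 1"
      using \<mu>_pos[OF m, of l] by simp
    ultimately have "norm ((1 / \<mu> l) *\<^sub>R (ent (H l) (dig ns l i) (dig ns l k) * ?d)) \<le> 1 * (norm (H l) * 1)"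
      unfolding norm_scaleR by (intro mult_mono) auto
    then show "norm ((1 / \<mu> l) *\<^sub>R (ent (H l) (dig ns l i) (dig ns l k) * ?d)) \<le> b"
      using assms(2)[of l] l by simp
  qed
  then show ?thesis
    by simp
qed

lemma closure_morse_set:
  assumes m: "\<And>j. j < r \<Longrightarrow> 1 \<le> m j"
  shows "her_topology N closure_of morse_set = her N"
proof -
  interpret her: Metric_space "her N" "frobenius_dist N"
    by (rule Metric_space_her)
  have "\<exists>B\<in>morse_set. B \<in> her.mball A \<epsilon>" if A: "A \<in> her N" and "0 < \<epsilon>" for A \<epsilon>
  proof -
    have Ac: "A \<in> carrier_mat N N" and Aa: "mat_adjoint A = A"
      using A by (auto simp: her_def)
    \<comment> \<open>The distance is at most the sum of \<open>N * N\<close> entries, each bounded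
      by \<open>real r * b\<close>. The summand \<open>1\<close> keeps the denominator positive, and
      the factor 2 makes the final inequality strict.\<close>
    define b where "b = \<epsilon> / (2 * (real (N * N) * real r + 1))"
    have D: "0 < real (N * N) * real r + 1"
      by (simp add: add_nonneg_pos)
    have "0 < b"
      unfolding b_def using \<open>0 < \<epsilon>\<close> D by (intro divide_pos_pos) auto
    obtain H where HT: "hermitian_tuple b H"
      and mor: "\<And>p v. crit (shift (coef A) H) p \<Longrightarrow> \<not> null_dir (shift (coef A) H) p v"
      using exists_morse_perturbation[OF m \<open>0 < b\<close>, where c = "coef A"] by blast
    then have H: "\<And>j. j < r \<Longrightarrow> adj (H j) = H j" "\<And>j. j < r \<Longrightarrow> norm (H j) \<le> b"
      by (simp_all add: hermitian_tuple_def)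
    define B where "B = mat N N (shift (coef A) H)"
    have Bc: "B \<in> carrier_mat N N"
      by (simp add: B_def)
    have Bt: "B $$ t = coef A t + pert H t" if "t \<in> {..<N} \<times> {..<N}" for t
      using that by (auto simp: B_def)
    have "mat_adjoint B = B"
    proof (rule eq_matI)
      fix i k assume "i < dim_row B" "k < dim_col B"
      then have ik: "i < N" "k < N"
        by (auto simp: B_def)
      have "cnj (A $$ (k, i)) = A $$ (i, k)"
        using mat_adjoint_index[OF Ac ik] Aa by simp
      then show "mat_adjoint B $$ (i, k) = B $$ (i, k)"
        using ik cnj_pert[OF H(1)] by (simp add: mat_adjoint_index[OF Bc ik] Bt coef_def)
    qed (use mat_adjoint_carrier[OF Bc] Bc in auto)
    then have B: "B \<in> her N"
      using Bc by (simp add: her_def)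
    have "coef B t = coef A t + pert H t" if "t \<in> {..<N} \<times> {..<N}" for t
      using Bt[OF that] by (simp add: coef_def)
    note cong = crit_null_coeff_cong[of "coef B" "\<lambda>t. coef A t + pert H t", OF this]
    have "B \<in> morse_set"
      unfolding morse_set_def using B mor cong by simp
    moreover have "frobenius_dist N A B < \<epsilon>"
    proof -
      have "frobenius_dist N A B \<le> (\<Sum>t\<in>{..<N} \<times> {..<N}. cmod (A $$ t - B $$ t))"
        unfolding frobenius_dist_def by (rule L2_set_le_sum) auto
      also have "\<dots> \<le> (\<Sum>t\<in>{..<N} \<times> {..<N}. real r * b)"
        by (intro sum_mono) (use Bt cmod_pert_le[OF m H(2)] in \<open>auto simp: coef_def\<close>)
      also have "\<dots> = (real (N * N) * real r) * b"
        by simp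
      also have "\<dots> \<le> (real (N * N) * real r + 1) * b"
        using \<open>0 < b\<close> by (intro mult_right_mono) auto
      also have "\<dots> = \<epsilon> / 2"
        using D unfolding b_def by (simp add: field_simps del: of_nat_mult)
      finally show ?thesis
        using \<open>0 < \<epsilon>\<close> by simp
    qed
    ultimately show ?thesis
      using A B by auto
  qed
  then show ?thesis
    unfolding her_topology_def her.metric_closure_of by auto
qed

end

theorem corollary3p14:
  fixes mn :: "(nat \<times> nat) list" and N :: nat
  assumes "length mn \<ge> 1"
    and "\<forall>(m, n) \<in> set mn. 1 \<le> m \<and> m \<le> n"
    and "N = prod_list (map snd mn)"
  shows "let S = {A \<in> her N. \<forall>P. critical_point (Gr_prod mn) (rayleigh A) P \<longrightarrow>
                    nondegenerate_critical_point (Gr_prod mn) (rayleigh A) P}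
         in openin (her_topology N) S \<and> her_topology N closure_of S = her N"
proof -
  interpret grassmann_tuple mn .
  have m: "1 \<le> fst (mn ! j)" if "j < length mn" for j
    using assms(2) nth_mem[OF that] by (auto simp: case_prod_beta)
  have "{A \<in> her N. \<forall>P. critical_point (Gr_prod mn) (rayleigh A) P \<longrightarrow>
      nondegenerate_critical_point (Gr_prod mn) (rayleigh A) P} = morse_set"
    unfolding morse_set_def assms(3) using nondegenerate_iff by (auto simp: her_def)
  then show ?thesis
    using openin_morse_set closure_morse_set[OF m] by (simp add: assms(3))
qed

end
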